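(* Let $I\in\mathbb{C}$ be a constant and consider the non-autonomous system $$\frac{dx}{dt}=x^2-xy-2x,\qquad \frac{dy}{dt}=y^2-3xy-2y-\frac{I}{2}e^{-6t}.$$ After a series of explicit blowing-ups at ten points including seven infinitely near points, the phase space $\mathcal{X}$ for this system can be obtained by gluing four copies of $\mathbb{C}^2\times\mathbb{C}$, $U_j\times\mathbb{C}\cong\mathbb{C}^2\times\mathbb{C}\ni(x_j,y_j,t)$, $j=0,1,2,3$, via the following birational transformations: 0) $x_0=x,\quad y_0=y$; 1) $x_1=\dfrac1x,\quad y_1=\left(\left(yx+\frac{I}{4}e^{-6t}\right)x+\frac{I}{2}e^{-6t}\right)x$; 2) $x_2=\dfrac1x,\quad y_2=\left(\left((y-2x)x-\frac{I}{4}e^{-6t}\right)x+\frac{I}{2}e^{-6t}\right)x$; 3) $x_3=xy,\quad y_3=\dfrac1y$.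
   Context: Compactify each fibre $\mathbb{C}^2\ni(x,y)$ (for fixed $t$) to $\mathbb{P}^2$ and extend the vector field of the system to a rational vector field on $\mathbb{P}^2\times\mathbb{C}$. Its accessible singularities lie on the line at infinity: a point of a boundary divisor $\{x_1=0\}$, near which the vector field has the form $\frac{\partial}{\partial t}+a_1\frac{\partial}{\partial x_1}+\frac{a_2}{x_1}\frac{\partial}{\partial x_2}$ with $a_1,a_2$ holomorphic, is accessible if $a_2$ vanishes there. They are resolved, for each $t$, by successive blow-ups (at points of the line at infinity and at points infinitely near to them). The phase space for the system is the complex manifold, fibred over the $t$-line, obtained by gluing to the original $\mathbb{C}^2\times\mathbb{C}$ the final affine charts of this resolution; in each of its charts $(x_j,y_j,t)$ the system must have right-hand side polynomial in $(x_j,y_j)$ with coefficients holomorphic in $t$, i.e. the vector field is regular on the whole phase space. *)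

theory Defs
  imports "HOL-Analysis.Analysis"
begin

type_synonym c3 = "complex \<times> complex \<times> complex"

text \<open>
  A chart of a space with points of type \<open>'p\<close> is a parametrisation \<open>\<psi>\<close> defined on a set
  \<open>V\<close> of triples \<open>(x, y, t)\<close>; a space fibred over the \<open>t\<close>-line is given by its atlas.
\<close>

type_synonym 'p chart = "c3 set \<times> (c3 \<Rightarrow> 'p)"

definition points :: "'p chart set \<Rightarrow> 'p set" where
  "points A = (\<Union>(V, \<psi>) \<in> A. \<psi> ` V)"

definition holo3_on :: "(c3 \<Rightarrow> complex) \<Rightarrow> c3 set \<Rightarrow> bool" where
  "holo3_on f S \<longleftrightarrow>
     (\<forall>z\<in>S. \<exists>a b c. (f has_derivative (\<lambda>(u, v, s). a * u + b * v + c * s)) (at z))"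

definition holo3_map_on :: "(c3 \<Rightarrow> c3) \<Rightarrow> c3 set \<Rightarrow> bool" where
  "holo3_map_on F S \<longleftrightarrow>
     holo3_on (\<lambda>z. fst (F z)) S \<and> holo3_on (\<lambda>z. fst (snd (F z))) S \<and>
     holo3_on (\<lambda>z. snd (snd (F z))) S"

definition atlas_topology :: "'p chart set \<Rightarrow> 'p topology" where
  "atlas_topology A =
     topology (\<lambda>O'. O' \<subseteq> points A \<and> (\<forall>(V, \<psi>)\<in>A. open {z \<in> V. \<psi> z \<in> O'}))"

lemma istopology_atlas:
  assumes "\<And>V \<psi>. (V, \<psi>) \<in> A \<Longrightarrow> open V"
  shows "istopology (\<lambda>O'. O' \<subseteq> points A \<and> (\<forall>(V, \<psi>)\<in>A. open {z \<in> V. \<psi> z \<in> O'}))"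
proof -
  have int: "open {z \<in> V. \<psi> z \<in> S \<inter> T}"
    if "open {z \<in> V. \<psi> z \<in> S}" "open {z \<in> V. \<psi> z \<in> T}" for V \<psi> and S T :: "'a set"
  proof -
    have "{z \<in> V. \<psi> z \<in> S \<inter> T} = {z \<in> V. \<psi> z \<in> S} \<inter> {z \<in> V. \<psi> z \<in> T}" by auto
    then show ?thesis using that by (simp add: open_Int)
  qed
  have un: "open {z \<in> V. \<psi> z \<in> \<Union>K}"
    if "\<forall>S\<in>K. open {z \<in> V. \<psi> z \<in> S}" for V \<psi> and K :: "'a set set"
  proof -
    have "{z \<in> V. \<psi> z \<in> \<Union>K} = (\<Union>S\<in>K. {z \<in> V. \<psi> z \<in> S})" by auto
    then show ?thesis using that by auto
  qed
  show ?thesis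
    unfolding istopology_def using int un by (fast intro: int un)
qed

text \<open>
  The transition maps have to preserve the coordinate \<open>t\<close>, so that the manifold is fibred
  over the \<open>t\<close>-line.
\<close>

definition fibred_complex_manifold :: "'p chart set \<Rightarrow> bool" where
  "fibred_complex_manifold A \<longleftrightarrow>
     (\<forall>(V, \<psi>)\<in>A. open V \<and> inj_on \<psi> V) \<and>
     (\<forall>(V, \<psi>)\<in>A. \<forall>(W, \<phi>)\<in>A.
        open {z \<in> V. \<psi> z \<in> \<phi> ` W} \<and>
        holo3_map_on (\<lambda>z. inv_into W \<phi> (\<psi> z)) {z \<in> V. \<psi> z \<in> \<phi> ` W} \<and>
        (\<forall>z\<in>V. \<psi> z \<in> \<phi> ` W \<longrightarrow> snd (snd (inv_into W \<phi> (\<psi> z))) = snd (snd z))) \<and>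
     Hausdorff_space (atlas_topology A)"


section \<open>Blow-ups of the projective plane\<close>

definition ratio3 :: "complex \<Rightarrow> complex \<Rightarrow> complex \<Rightarrow> c3 set" where
  "ratio3 a b c = {(s * a, s * b, s * c) |s. s \<noteq> 0}"

definition ratio2 :: "complex \<Rightarrow> complex \<Rightarrow> (complex \<times> complex) set" where
  "ratio2 a b = {(s * a, s * b) |s. s \<noteq> 0}"

text \<open>
  \<open>Proper Q t\<close> is the point \<open>Q\<close> of the plane in the fibre over \<open>t\<close>.  \<open>Near P d\<close> is the point
  infinitely near to \<open>P\<close> given by the direction \<open>d\<close> at \<open>P\<close>, that is, a point of the exceptional
  curve that replaces \<open>P\<close>; the ratio \<open>d\<close> refers to the first two coordinates of the chart in
  which \<open>P\<close> is blown up.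
\<close>

datatype point = Proper "c3 set" complex | Near point "(complex \<times> complex) set"

fun infinitely_near :: "point \<Rightarrow> bool" where
  "infinitely_near (Proper Q t) = False"
| "infinitely_near (Near P d) = True"

fun original :: "c3 \<Rightarrow> point" where
  "original (x, y, t) = Proper (ratio3 1 x y) t"

definition plane :: "point chart set" where
  "plane = {(UNIV, original),
            (UNIV, \<lambda>(X, Y, t). Proper (ratio3 X 1 Y) t),
            (UNIV, \<lambda>(Z, X, t). Proper (ratio3 X Z 1) t)}"

text \<open>
  Blow-up along the section with coordinates \<open>(a t, b t, t)\<close> in the chart \<open>(V, \<psi>)\<close>.  With
  \<open>(x, y, t)\<close> the coordinates of that chart, the two affine charts covering the exceptional
  curves have the coordinates \<open>(x - a, (y - b) / (x - a), t)\<close> and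
  \<open>((x - a) / (y - b), y - b, t)\<close>.  The previous charts lose the blown-up points.
\<close>

fun blow_up ::
  "point chart set \<Rightarrow> point chart \<Rightarrow> (complex \<Rightarrow> complex) \<Rightarrow> (complex \<Rightarrow> complex) \<Rightarrow> point chart set"
where
  "blow_up A (V, \<psi>) a b =
     (\<lambda>(W, \<phi>). ({z \<in> W. \<forall>t. \<phi> z \<noteq> \<psi> (a t, b t, t)}, \<phi>)) ` A \<union>
     {({(u, w, t). (a t + u, b t + u * w, t) \<in> V},
       \<lambda>(u, w, t). if u = 0 then Near (\<psi> (a t, b t, t)) (ratio2 1 w)
                   else \<psi> (a t + u, b t + u * w, t)),
      ({(w, v, t). (a t + w * v, b t + v, t) \<in> V},
       \<lambda>(w, v, t). if v = 0 then Near (\<psi> (a t, b t, t)) (ratio2 w 1)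
                   else \<psi> (a t + w * v, b t + v, t))}"


section \<open>The system and its accessible singularities\<close>

fun system_field :: "complex \<Rightarrow> c3 \<Rightarrow> c3" where
  "system_field I (x, y, t) =
     (x\<^sup>2 - x * y - 2 * x, y\<^sup>2 - 3 * x * y - 2 * y - I / 2 * exp (- 6 * t), 1)"

text \<open>
  \<open>F\<close> is the vector field of the system in the chart \<open>(V, \<psi>)\<close>: the derivative of the
  coordinates of the chart, as functions of the original \<open>(x, y, t)\<close>, along the system.  Nothing
  is required of \<open>F\<close> at boundary points (points outside the original \<open>(x, y, t)\<close>-space).
\<close>

fun field_in_chart :: "complex \<Rightarrow> point chart \<Rightarrow> (c3 \<Rightarrow> c3) \<Rightarrow> c3 set \<Rightarrow> bool" where
  "field_in_chart I (V, \<psi>) F N \<longleftrightarrow>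
     (\<forall>z\<in>N. \<forall>p. \<psi> z = original p \<longrightarrow>
        (\<exists>D. ((\<lambda>q. inv_into V \<psi> (original q)) has_derivative D) (at p) \<and>
             D (system_field I p) = F z))"

fun regular_in_chart :: "complex \<Rightarrow> point chart \<Rightarrow> c3 \<Rightarrow> bool" where
  "regular_in_chart I (V, \<psi>) z \<longleftrightarrow>
     (\<exists>N F. open N \<and> z \<in> N \<and> N \<subseteq> V \<and> holo3_map_on F N \<and> field_in_chart I (V, \<psi>) F N)"

text \<open>
  The coordinate that vanishes on the boundary divisor may be the first or the second one of the
  chart.  Points where the field is regular have to be excluded: there the form of the field
  below holds with \<open>a\<^sub>2\<close> vanishing on the whole divisor.
\<close>

fun accessible_in_chart :: "complex \<Rightarrow> point chart \<Rightarrow> c3 \<Rightarrow> bool" where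
  "accessible_in_chart I (V, \<psi>) z \<longleftrightarrow>
     z \<in> V \<and> \<psi> z \<notin> range original \<and> \<not> regular_in_chart I (V, \<psi>) z \<and>
     (\<exists>N a\<^sub>1 a\<^sub>2. open N \<and> z \<in> N \<and> N \<subseteq> V \<and> holo3_on a\<^sub>1 N \<and> holo3_on a\<^sub>2 N \<and> a\<^sub>2 z = 0 \<and>
        ((\<forall>w\<in>N. \<psi> w \<notin> range original \<longleftrightarrow> fst w = 0) \<and>
         field_in_chart I (V, \<psi>) (\<lambda>w. (a\<^sub>1 w, a\<^sub>2 w / fst w, 1)) N \<or>
         (\<forall>w\<in>N. \<psi> w \<notin> range original \<longleftrightarrow> fst (snd w) = 0) \<and>
         field_in_chart I (V, \<psi>) (\<lambda>w. (a\<^sub>2 w / fst (snd w), a\<^sub>1 w, 1)) N))"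

definition accessible_singularity :: "complex \<Rightarrow> point chart set \<Rightarrow> point \<Rightarrow> bool" where
  "accessible_singularity I A P \<longleftrightarrow>
     (\<exists>(V, \<psi>)\<in>A. \<exists>z\<in>V. \<psi> z = P \<and> accessible_in_chart I (V, \<psi>) z)"

text \<open>
  \<open>blow_up_sequence I cs A\<close>: starting from the plane, one arrives at \<open>A\<close> by blowing up
  successively the points \<open>cs ! 0\<close>, \<open>cs ! 1\<close>, \dots (depending on \<open>t\<close>), each of which is, for
  every \<open>t\<close>, an accessible singularity at its stage.
\<close>

inductive blow_up_sequence :: "complex \<Rightarrow> (complex \<Rightarrow> point) list \<Rightarrow> point chart set \<Rightarrow> bool"
  for I :: complex
where
  start: "blow_up_sequence I [] plane"
| step: "blow_up_sequence I (cs @ [\<lambda>t. \<psi> (a t, b t, t)]) (blow_up A (V, \<psi>) a b)"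
    if "blow_up_sequence I cs A" "(V, \<psi>) \<in> A"
       "a holomorphic_on UNIV" "b holomorphic_on UNIV" "\<forall>t. (a t, b t, t) \<in> V"
       "\<forall>t. accessible_singularity I A (\<psi> (a t, b t, t))"

definition resolution :: "complex \<Rightarrow> (complex \<Rightarrow> point) list \<Rightarrow> point chart set \<Rightarrow> bool" where
  "resolution I cs A \<longleftrightarrow>
     blow_up_sequence I cs A \<and> (\<forall>P. \<not> accessible_singularity I A P)"

text \<open>
  The final affine charts of a resolution \<open>A\<close> are those that are copies of the whole space of
  triples and on which the field has become regular; the original chart is one of them.
\<close>

definition phase_space :: "complex \<Rightarrow> point chart set \<Rightarrow> point chart set" where
  "phase_space I A = {(V, \<psi>) \<in> A. V = UNIV \<and> (\<forall>z. regular_in_chart I (V, \<psi>) z)}"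

definition polynomial_in_chart :: "complex \<Rightarrow> point chart \<Rightarrow> bool" where
  "polynomial_in_chart I c \<longleftrightarrow>
     (\<exists>(n :: nat) \<alpha> \<beta>.
        (\<forall>i j. \<alpha> i j holomorphic_on UNIV \<and> \<beta> i j holomorphic_on UNIV) \<and>
        field_in_chart I c
          (\<lambda>(x, y, t). (\<Sum>i\<le>n. \<Sum>j\<le>n. \<alpha> i j t * x ^ i * y ^ j,
                        \<Sum>i\<le>n. \<Sum>j\<le>n. \<beta> i j t * x ^ i * y ^ j, 1)) UNIV)"


section \<open>Gluing four copies\<close>

definition to_U1 :: "complex \<Rightarrow> c3 \<Rightarrow> c3" where
  "to_U1 I = (\<lambda>(x, y, t).
     (1 / x, ((y * x + I / 4 * exp (- 6 * t)) * x + I / 2 * exp (- 6 * t)) * x, t))"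

definition to_U2 :: "complex \<Rightarrow> c3 \<Rightarrow> c3" where
  "to_U2 I = (\<lambda>(x, y, t).
     (1 / x, (((y - 2 * x) * x - I / 4 * exp (- 6 * t)) * x + I / 2 * exp (- 6 * t)) * x, t))"

definition to_U3 :: "c3 \<Rightarrow> c3" where
  "to_U3 = (\<lambda>(x, y, t). (x * y, 1 / y, t))"

text \<open>
  A triple of the copy \<open>0\<close> is identified with its image in the copy \<open>j\<close> wherever the
  transformation is defined.  The transitions between the copies \<open>1, 2, 3\<close> have poles at all
  other points, so these identifications generate the whole gluing.
\<close>

definition identifications :: "complex \<Rightarrow> ((nat \<times> c3) \<times> (nat \<times> c3)) set" where
  "identifications I =
     {((0, (x, y, t)), (1, to_U1 I (x, y, t))) |x y t. x \<noteq> 0} \<union>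
     {((0, (x, y, t)), (2, to_U2 I (x, y, t))) |x y t. x \<noteq> 0} \<union>
     {((0, (x, y, t)), (3, to_U3 (x, y, t))) |x y t. y \<noteq> 0}"

definition glued_point :: "complex \<Rightarrow> nat \<Rightarrow> c3 \<Rightarrow> (nat \<times> c3) set" where
  "glued_point I j z = (identifications I \<union> (identifications I)\<inverse>)\<^sup>* `` {(j, z)}"

definition glued_space :: "complex \<Rightarrow> (nat \<times> c3) set chart set" where
  "glued_space I = {(UNIV, glued_point I j) |j. j < 4}"

text \<open>An isomorphism carries the charts of one space to the charts of the other.\<close>

definition chart_isomorphism :: "('p \<Rightarrow> 'q) \<Rightarrow> 'p chart set \<Rightarrow> 'q chart set \<Rightarrow> bool" where
  "chart_isomorphism \<Phi> A B \<longleftrightarrow>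
     bij_betw \<Phi> (points A) (points B) \<and> (\<lambda>(V, \<psi>). (V, \<Phi> \<circ> \<psi>)) ` A = B"

end

theory Submission
  imports Defs
begin

text \<open>
  The whole argument is a local computation with one kind of chart.  Near a boundary divisor
  \<open>x = 0\<close> the field has the form \<open>(p, q / x, 1)\<close> with entire \<open>p, q\<close>
  (\<open>polar_chart\<close> below), and its accessible singularities are the zeros of \<open>q\<close> on the
  divisor.  If \<open>(0, b, t)\<close> is such a zero and \<open>q = (y - b) \<kappa> + x h\<close>, then in the blow-up chart
  \<open>u = x\<close>, \<open>w = (y - b) / x\<close> the field is again \<open>(p, q' / u, 1)\<close>, now with
  \<open>q' = w (\<kappa> - p) + h - b'\<close>: on the exceptional curve \<open>q'\<close> is affine in \<open>w\<close>, so there is at most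
  one new singularity unless the pole disappears altogether.  The second blow-up chart contains
  the crossing of the two divisors; it sees nothing new, because its points with one vanishing
  coordinate lie either on the old divisor or in the first chart, and at the crossing the
  vector field cannot have the form demanded of an accessible point.  This step is the locale
  \<open>polar_blow_up\<close>.

  At infinity of the plane \<open>q\<close> has three zeros, \<open>y / x = 0\<close>, \<open>y / x = 2\<close> and the point
  \<open>x / y = 0\<close>.  With \<open>g = I / 4 * exp (- 6 t)\<close> and \<open>e = - 1\<close> or \<open>1\<close>, the singularity at
  \<open>y / x = 1 + e\<close> needs four blow-ups, with centres \<open>1 + e, 0, e g, - 2 g\<close> in the successive
  coordinates: on the divisors the leading coefficient of \<open>q\<close> in \<open>w\<close> runs through
  \<open>4 e, 3 e, 2 e, e, 0\<close>, and the last remainder vanishes because \<open>g\<close> solves \<open>g' = - 6 g\<close>.  The third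
  singularity needs two blow-ups.  The last coordinates of the three towers are those of the
  copies 1, 2 and 3, and the field is polynomial there.  Every other chart has lost a point or
  contains a pole, so the phase space consists of the original chart and these three
  (\<open>resolution_exists\<close>).

  The four charts are glued along the original one: off the boundary they differ by the given
  birational transformations, and the three boundary divisors are disjoint because they lie over
  different points of the line at infinity (\<open>final_chart_eq_iff\<close>).  This yields holomorphic
  transitions and the isomorphism with the gluing.  For the Hausdorff property, \<open>x\<close>, \<open>y\<close> and the
  slope \<open>y / x\<close> separate the points that have no chart in common.
\<close>

section \<open>Holomorphic functions of three variables\<close>

lemma holo3_isCont: "holo3_on f S \<Longrightarrow> z \<in> S \<Longrightarrow> isCont f z"
  unfolding holo3_on_def using has_derivative_continuous by blast

lemma holo3_on_continuous_on: "holo3_on f S \<Longrightarrow> continuous_on S f"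
  by (simp add: continuous_at_imp_continuous_on holo3_isCont)

lemma holo3_on_subset: "holo3_on f T \<Longrightarrow> S \<subseteq> T \<Longrightarrow> holo3_on f S"
  unfolding holo3_on_def by blast

lemma holo3_on_cong:
  assumes "holo3_on f S" "open S" "\<And>z. z \<in> S \<Longrightarrow> f z = g z"
  shows "holo3_on g S"
  using assms unfolding holo3_on_def by (meson has_derivative_transform_within_open)

lemma holo3_onI:
  assumes "\<And>z. z \<in> S \<Longrightarrow> (f has_derivative (\<lambda>(u, v, s). a z * u + b z * v + c z * s)) (at z)"
  shows "holo3_on f S"
  using assms unfolding holo3_on_def by blast

lemma holo3_onE:
  assumes "holo3_on f S"
  obtains a b c where
    "\<forall>z\<in>S. (f has_derivative (\<lambda>(u, v, s). a z * u + b z * v + c z * s)) (at z)"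
  using assms unfolding holo3_on_def by metis

lemma holo3_on_const: "holo3_on (\<lambda>z. k) S"
  by (rule holo3_onI[where a = "\<lambda>_. 0" and b = "\<lambda>_. 0" and c = "\<lambda>_. 0"],
      rule has_derivative_eq_rhs[OF has_derivative_const]) auto

lemma holo3_on_fst: "holo3_on fst S"
  by (rule holo3_onI[where a = "\<lambda>_. 1" and b = "\<lambda>_. 0" and c = "\<lambda>_. 0"],
      rule has_derivative_eq_rhs[OF has_derivative_fst[OF has_derivative_ident]]) auto

lemma holo3_on_snd: "holo3_on (\<lambda>z. fst (snd z)) S"
  by (rule holo3_onI[where a = "\<lambda>_. 0" and b = "\<lambda>_. 1" and c = "\<lambda>_. 0"],
      rule has_derivative_eq_rhs
        [OF has_derivative_fst[OF has_derivative_snd[OF has_derivative_ident]]]) auto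

lemma holo3_on_thd: "holo3_on (\<lambda>z. snd (snd z)) S"
  by (rule holo3_onI[where a = "\<lambda>_. 0" and b = "\<lambda>_. 0" and c = "\<lambda>_. 1"],
      rule has_derivative_eq_rhs
        [OF has_derivative_snd[OF has_derivative_snd[OF has_derivative_ident]]]) auto

lemma holo3_on_comp3:
  assumes f: "holo3_on f T" and "holo3_on \<alpha> S" "holo3_on \<beta> S" "holo3_on \<gamma> S"
    and T: "\<And>z. z \<in> S \<Longrightarrow> (\<alpha> z, \<beta> z, \<gamma> z) \<in> T"
  shows "holo3_on (\<lambda>z. f (\<alpha> z, \<beta> z, \<gamma> z)) S"
proof -
  obtain a b c where D: "\<forall>z\<in>T.
      (f has_derivative (\<lambda>(u, v, s). a z * u + b z * v + c z * s)) (at z)"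
    by (rule holo3_onE[OF f])
  obtain a1 b1 c1 where D1: "\<forall>z\<in>S.
      (\<alpha> has_derivative (\<lambda>(u, v, s). a1 z * u + b1 z * v + c1 z * s)) (at z)"
    by (rule holo3_onE[OF assms(2)])
  obtain a2 b2 c2 where D2: "\<forall>z\<in>S.
      (\<beta> has_derivative (\<lambda>(u, v, s). a2 z * u + b2 z * v + c2 z * s)) (at z)"
    by (rule holo3_onE[OF assms(3)])
  obtain a3 b3 c3 where D3: "\<forall>z\<in>S.
      (\<gamma> has_derivative (\<lambda>(u, v, s). a3 z * u + b3 z * v + c3 z * s)) (at z)"
    by (rule holo3_onE[OF assms(4)])
  let ?F = "\<lambda>z. (\<alpha> z, \<beta> z, \<gamma> z)"
  show ?thesis
  proof (rule holo3_onI)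
    fix z assume z: "z \<in> S"
    show "((\<lambda>z. f (?F z)) has_derivative
       (\<lambda>(u, v, s). (a (?F z) * a1 z + b (?F z) * a2 z + c (?F z) * a3 z) * u +
          (a (?F z) * b1 z + b (?F z) * b2 z + c (?F z) * b3 z) * v +
          (a (?F z) * c1 z + b (?F z) * c2 z + c (?F z) * c3 z) * s)) (at z)"
      by (rule has_derivative_eq_rhs[OF has_derivative_compose
            [OF has_derivative_Pair[OF bspec[OF D1 z] has_derivative_Pair[OF bspec[OF D2 z] bspec[OF D3 z]]]
              bspec[OF D T[OF z]]]])
        (auto simp: fun_eq_iff algebra_simps)
  qed
qed

lemma holo3_on_holomorphic:
  assumes h: "\<And>z. z \<in> S \<Longrightarrow> h field_differentiable (at (f z))" and f: "holo3_on f S"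
  shows "holo3_on (\<lambda>z. h (f z)) S"
proof -
  obtain a b c where D: "\<forall>z\<in>S.
      (f has_derivative (\<lambda>(u, v, s). a z * u + b z * v + c z * s)) (at z)"
    by (rule holo3_onE[OF f])
  show ?thesis
  proof (rule holo3_onI)
    fix z assume z: "z \<in> S"
    have k: "(h has_derivative (*) (deriv h (f z))) (at (f z))"
      using h[OF z] by (simp add: field_differentiable_derivI flip: has_field_derivative_def)
    show "((\<lambda>z. h (f z)) has_derivative (\<lambda>(u, v, s). (deriv h (f z) * a z) * u +
        (deriv h (f z) * b z) * v + (deriv h (f z) * c z) * s)) (at z)"
      by (rule has_derivative_eq_rhs[OF has_derivative_compose[OF bspec[OF D z] k]])
        (auto simp: fun_eq_iff algebra_simps)
  qed
qed

lemma
  assumes "holo3_on f S" "holo3_on g S"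
  shows holo3_on_add: "holo3_on (\<lambda>z. f z + g z) S"
    and holo3_on_mult: "holo3_on (\<lambda>z. f z * g z) S"
proof -
  obtain a b c where D: "\<forall>z\<in>S.
      (f has_derivative (\<lambda>(u, v, s). a z * u + b z * v + c z * s)) (at z)"
    by (rule holo3_onE[OF assms(1)])
  obtain a' b' c' where D': "\<forall>z\<in>S.
      (g has_derivative (\<lambda>(u, v, s). a' z * u + b' z * v + c' z * s)) (at z)"
    by (rule holo3_onE[OF assms(2)])
  show "holo3_on (\<lambda>z. f z + g z) S"
  proof (rule holo3_onI)
    fix z assume z: "z \<in> S"
    show "((\<lambda>z. f z + g z) has_derivative
        (\<lambda>(u, v, s). (a z + a' z) * u + (b z + b' z) * v + (c z + c' z) * s)) (at z)"
      by (rule has_derivative_eq_rhs[OF has_derivative_add[OF bspec[OF D z] bspec[OF D' z]]])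
        (auto simp: fun_eq_iff algebra_simps)
  qed
  show "holo3_on (\<lambda>z. f z * g z) S"
  proof (rule holo3_onI)
    fix z assume z: "z \<in> S"
    show "((\<lambda>z. f z * g z) has_derivative (\<lambda>(u, v, s). (f z * a' z + a z * g z) * u +
        (f z * b' z + b z * g z) * v + (f z * c' z + c z * g z) * s)) (at z)"
      by (rule has_derivative_eq_rhs[OF has_derivative_mult[OF bspec[OF D z] bspec[OF D' z]]])
        (auto simp: fun_eq_iff algebra_simps)
  qed
qed

lemma holo3_on_minus: "holo3_on f S \<Longrightarrow> holo3_on (\<lambda>z. - f z) S"
  using holo3_on_mult[OF holo3_on_const[of "-1"]] by fastforce

lemma holo3_on_diff: "holo3_on f S \<Longrightarrow> holo3_on g S \<Longrightarrow> holo3_on (\<lambda>z. f z - g z) S"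
  using holo3_on_add[OF _ holo3_on_minus] by fastforce

lemma holo3_on_power: "holo3_on f S \<Longrightarrow> holo3_on (\<lambda>z. f z ^ k) S"
  by (induction k) (auto intro: holo3_on_const holo3_on_mult)

lemma holo3_on_divide:
  assumes "holo3_on f S" "holo3_on g S" "\<And>z. z \<in> S \<Longrightarrow> g z \<noteq> 0"
  shows "holo3_on (\<lambda>z. f z / g z) S"
proof -
  have "holo3_on (\<lambda>z. inverse (g z)) S"
    by (rule holo3_on_holomorphic[OF _ assms(2), of inverse])
      (use assms(3) DERIV_inverse in \<open>unfold field_differentiable_def, blast\<close>)
  from holo3_on_mult[OF assms(1) this] show ?thesis by (simp add: divide_inverse)
qed

lemma holo3_on_exp: "holo3_on f S \<Longrightarrow> holo3_on (\<lambda>z. exp (f z)) S"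
  by (rule holo3_on_holomorphic[of _ exp]) (auto intro: field_differentiable_within_exp)

lemma holo3_on_entire:
  assumes "h holomorphic_on UNIV" "holo3_on f S"
  shows "holo3_on (\<lambda>z. h (f z)) S"
  by (rule holo3_on_holomorphic[of _ h])
    (use assms in \<open>auto simp: holomorphic_on_def\<close>)

lemmas holo3_intros = holo3_on_const holo3_on_fst holo3_on_snd holo3_on_thd holo3_on_add
  holo3_on_mult holo3_on_minus holo3_on_diff holo3_on_power holo3_on_divide holo3_on_exp

section \<open>Coordinates of the system in a chart\<close>

lemma ratio3_eq_iff:
  "ratio3 a b c = ratio3 a' b' c' \<longleftrightarrow> (\<exists>s. s \<noteq> 0 \<and> a' = s * a \<and> b' = s * b \<and> c' = s * c)"
proof
  assume *: "ratio3 a b c = ratio3 a' b' c'"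
  have "(a', b', c') \<in> ratio3 a' b' c'" unfolding ratio3_def by (auto intro: exI[of _ 1])
  then show "\<exists>s. s \<noteq> 0 \<and> a' = s * a \<and> b' = s * b \<and> c' = s * c"
    unfolding *[symmetric] unfolding ratio3_def by blast
next
  assume "\<exists>s. s \<noteq> 0 \<and> a' = s * a \<and> b' = s * b \<and> c' = s * c"
  then obtain s where s: "s \<noteq> 0" "a' = s * a" "b' = s * b" "c' = s * c" by blast
  have "(k * a, k * b, k * c) \<in> ratio3 a' b' c'" if "k \<noteq> 0" for k
    unfolding ratio3_def using s that by (auto intro!: exI[of _ "k / s"])
  moreover have "(k * a', k * b', k * c') \<in> ratio3 a b c" if "k \<noteq> 0" for k
    unfolding ratio3_def using s that by (auto intro!: exI[of _ "k * s"])
  ultimately show "ratio3 a b c = ratio3 a' b' c'"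
    unfolding ratio3_def by blast
qed

lemma ratio2_eq_iff:
  "ratio2 a b = ratio2 a' b' \<longleftrightarrow> (\<exists>s. s \<noteq> 0 \<and> a' = s * a \<and> b' = s * b)"
proof
  assume *: "ratio2 a b = ratio2 a' b'"
  have "(a', b') \<in> ratio2 a' b'" unfolding ratio2_def by (auto intro: exI[of _ 1])
  then show "\<exists>s. s \<noteq> 0 \<and> a' = s * a \<and> b' = s * b"
    unfolding *[symmetric] unfolding ratio2_def by blast
next
  assume "\<exists>s. s \<noteq> 0 \<and> a' = s * a \<and> b' = s * b"
  then obtain s where s: "s \<noteq> 0" "a' = s * a" "b' = s * b" by blast
  have "(k * a, k * b) \<in> ratio2 a' b'" if "k \<noteq> 0" for k
    unfolding ratio2_def using s that by (auto intro!: exI[of _ "k / s"])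
  moreover have "(k * a', k * b') \<in> ratio2 a b" if "k \<noteq> 0" for k
    unfolding ratio2_def using s that by (auto intro!: exI[of _ "k * s"])
  ultimately show "ratio2 a b = ratio2 a' b'"
    unfolding ratio2_def by blast
qed

lemma original_inj: "inj original"
proof (rule injI)
  fix p q assume "original p = original q"
  then show "p = q" by (cases p rule: prod_cases3; cases q rule: prod_cases3)
      (auto simp: ratio3_eq_iff)
qed

lemma Near_not_original: "Near P d \<notin> range original"
proof
  assume "Near P d \<in> range original"
  then obtain x y t where "Near P d = original (x, y, t)" by (metis imageE prod_cases3)
  then show False by simp
qed

lemma Proper_original_iff: "Proper (ratio3 a b c) t \<in> range original \<longleftrightarrow> a \<noteq> 0"
proof
  assume "Proper (ratio3 a b c) t \<in> range original"
  then obtain x y s where "Proper (ratio3 a b c) t = original (x, y, s)"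
    by (metis imageE prod_cases3)
  then show "a \<noteq> 0" by (auto simp: ratio3_eq_iff)
next
  assume "a \<noteq> 0"
  then have "Proper (ratio3 a b c) t = original (b / a, c / a, t)"
    by (auto simp: ratio3_eq_iff intro!: exI[of _ "1 / a"])
  then show "Proper (ratio3 a b c) t \<in> range original" by blast
qed

text \<open>
  \<open>G\<close> is the vector field of the system in the coordinates given by \<open>\<psi>\<close>, away from the set \<open>B\<close> of
  boundary points; \<open>n\<close> computes these coordinates from the original ones.  The parametrisation is
  taken on all triples: later blow-ups only shrink the chart at boundary points, so that one
  computation serves every stage.
\<close>

definition chart_field ::
  "complex \<Rightarrow> (c3 \<Rightarrow> point) \<Rightarrow> c3 set \<Rightarrow> (c3 \<Rightarrow> c3) \<Rightarrow> bool" where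
  "chart_field I \<psi> B G \<longleftrightarrow> (\<forall>z\<in>B. \<psi> z \<notin> range original) \<and>
     (\<exists>E n. open E \<and> n ` E = - B \<and> (\<forall>p\<in>E. \<psi> (n p) = original p) \<and>
        (\<forall>p\<in>E. \<exists>D. (n has_derivative D) (at p) \<and> D (system_field I p) = G (n p)))"

lemma chart_field_boundary:
  assumes "chart_field I \<psi> B G"
  shows "\<psi> z \<notin> range original \<longleftrightarrow> z \<in> B"
proof -
  obtain E n where "n ` E = - B" "\<forall>p\<in>E. \<psi> (n p) = original p"
    using assms unfolding chart_field_def by blast
  then have "\<psi> z \<in> range original" if "z \<notin> B" for z
    using that by (metis ComplI imageE rangeI)
  then show ?thesis using assms unfolding chart_field_def by blast
qed

lemma chart_field_original: "chart_field I original {} (system_field I)"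
  unfolding chart_field_def
  by (intro conjI exI[of _ UNIV] exI[of _ id]) (auto intro!: exI[of _ id] has_derivative_id)

lemma chart_field_cong:
  assumes "chart_field I \<psi> B G" "\<And>z. z \<notin> B \<Longrightarrow> G z = G' z"
  shows "chart_field I \<psi> B G'"
proof -
  obtain E n where E: "open E" "n ` E = - B" "\<forall>p\<in>E. \<psi> (n p) = original p"
     "\<forall>p\<in>E. \<exists>D. (n has_derivative D) (at p) \<and> D (system_field I p) = G (n p)"
    using assms(1) unfolding chart_field_def by blast
  have "\<forall>p\<in>E. G (n p) = G' (n p)" using E(2) assms(2) by blast
  then show ?thesis using assms(1) E unfolding chart_field_def by metis
qed

lemma image_Int_vimage: "f ` (A \<inter> f -` C) = f ` A \<inter> C"
  by auto

text \<open>
  The chain rule for a change of coordinates \<open>\<sigma>\<close>.  Charts at infinity, blow-ups and the exchange of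
  coordinates are all of this form.
\<close>

lemma chart_field_change:
  assumes cf: "chart_field I \<psi> B G" and \<Omega>: "open \<Omega>"
    and into: "\<And>z. z \<in> \<Omega> \<Longrightarrow> z \<notin> B \<Longrightarrow> \<sigma> z \<notin> B'"
    and onto: "\<And>z. z \<notin> B' \<Longrightarrow> \<exists>w\<in>\<Omega> - B. z = \<sigma> w"
    and eq: "\<And>z. z \<in> \<Omega> \<Longrightarrow> z \<notin> B \<Longrightarrow> \<psi>' (\<sigma> z) = \<psi> z"
    and bd: "\<And>z. z \<in> B' \<Longrightarrow> \<psi>' z \<notin> range original"
    and der: "\<And>z. z \<in> \<Omega> \<Longrightarrow> z \<notin> B \<Longrightarrow> \<exists>D. (\<sigma> has_derivative D) (at z) \<and> D (G z) = G' (\<sigma> z)"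
  shows "chart_field I \<psi>' B' G'"
proof -
  have im: "\<sigma> ` (\<Omega> - B) = - B'" using into onto by blast
  obtain E n where E: "open E" "n ` E = - B" "\<forall>p\<in>E. \<psi> (n p) = original p"
     "\<forall>p\<in>E. \<exists>D. (n has_derivative D) (at p) \<and> D (system_field I p) = G (n p)"
    using cf unfolding chart_field_def by blast
  have "continuous_on E n"
    using E(4) by (meson continuous_at_imp_continuous_on has_derivative_continuous)
  then have op: "open (E \<inter> n -` \<Omega>)"
    using E(1) \<Omega> by (simp add: continuous_open_preimage)
  have "n ` (E \<inter> n -` \<Omega>) = \<Omega> - B"
    unfolding image_Int_vimage E(2) by auto
  then have im': "(\<sigma> \<circ> n) ` (E \<inter> n -` \<Omega>) = - B'" using im by (metis image_comp)
  have "\<exists>D. ((\<sigma> \<circ> n) has_derivative D) (at p) \<and> D (system_field I p) = G' ((\<sigma> \<circ> n) p)"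
    if p: "p \<in> E \<inter> n -` \<Omega>" for p
  proof -
    have np: "n p \<in> \<Omega>" "n p \<notin> B" using p E(2) by auto
    obtain D where D: "(n has_derivative D) (at p)" "D (system_field I p) = G (n p)"
      using p E(4) by blast
    obtain D' where D': "(\<sigma> has_derivative D') (at (n p))" "D' (G (n p)) = G' (\<sigma> (n p))"
      using der[OF np] by blast
    have "((\<sigma> \<circ> n) has_derivative (D' \<circ> D)) (at p)"
      using diff_chain_at[OF D(1) D'(1)] by simp
    then show ?thesis using D(2) D'(2) by (intro exI[of _ "D' \<circ> D"]) (simp only: o_apply)
  qed
  moreover have "\<forall>p\<in>E \<inter> n -` \<Omega>. \<psi>' ((\<sigma> \<circ> n) p) = original p"
  proof
    fix p assume p: "p \<in> E \<inter> n -` \<Omega>"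
    then have np: "n p \<in> \<Omega>" "n p \<notin> B" "\<psi> (n p) = original p" using E(2,3) by blast+
    show "\<psi>' ((\<sigma> \<circ> n) p) = original p"
      unfolding o_apply eq[OF np(1,2)] by (rule np(3))
  qed
  ultimately show ?thesis
    unfolding chart_field_def using bd op im'
    by (intro conjI exI[of _ "E \<inter> n -` \<Omega>"] exI[of _ "\<sigma> \<circ> n"]) auto
qed

text \<open>
  The derivative that defines the field in a chart is unique, and near an original point the inverse
  of the parametrisation does not depend on the boundary points contained in the chart.
\<close>

lemma field_in_chart_iff:
  assumes cf: "chart_field I \<psi> B G" and V: "- B \<subseteq> V" and N: "N \<subseteq> V"
  shows "field_in_chart I (V, \<psi>) F N \<longleftrightarrow> (\<forall>z\<in>N - B. F z = G z)"
proof -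
  obtain E n where E: "open E" "n ` E = - B" "\<forall>p\<in>E. \<psi> (n p) = original p"
     "\<forall>p\<in>E. \<exists>D. (n has_derivative D) (at p) \<and> D (system_field I p) = G (n p)"
    using cf unfolding chart_field_def by blast
  have uniq: "p \<in> E \<and> z = n p" if "\<psi> z = original p" for z p
  proof -
    have "z \<notin> B" using that chart_field_boundary[OF cf] by (metis rangeI)
    then obtain p' where "p' \<in> E" "z = n p'" using E(2) by blast
    then show ?thesis using E(3) that original_inj by (metis injD)
  qed
  have inv: "inv_into V \<psi> (original q) = n q" if q: "q \<in> E" for q
  proof -
    have "n q \<in> V" using q E(2) V by blast
    then have "original q \<in> \<psi> ` V" using q E(3) by (metis image_eqI)
    then have "\<psi> (inv_into V \<psi> (original q)) = original q" by (rule f_inv_into_f)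
    then show ?thesis using uniq by blast
  qed
  have der: "((\<lambda>q. inv_into V \<psi> (original q)) has_derivative D) (at p) \<longleftrightarrow>
      (n has_derivative D) (at p)" if p: "p \<in> E" for p D
  proof
    show "(n has_derivative D) (at p)"
      if "((\<lambda>q. inv_into V \<psi> (original q)) has_derivative D) (at p)"
      by (rule has_derivative_transform_within_open[OF that E(1) p]) (rule inv)
    show "((\<lambda>q. inv_into V \<psi> (original q)) has_derivative D) (at p)"
      if "(n has_derivative D) (at p)"
      by (rule has_derivative_transform_within_open[OF that E(1) p]) (rule inv[symmetric])
  qed
  have val: "(\<exists>D. ((\<lambda>q. inv_into V \<psi> (original q)) has_derivative D) (at p) \<and>
        D (system_field I p) = k) \<longleftrightarrow> k = G (n p)" if p: "p \<in> E" for p k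
    using E(4) p der[OF p] has_derivative_unique by metis
  show ?thesis
  proof
    assume L: "field_in_chart I (V, \<psi>) F N"
    show "\<forall>z\<in>N - B. F z = G z"
    proof
      fix z assume z: "z \<in> N - B"
      then obtain p where p: "p \<in> E" "z = n p" using E(2) by blast
      then have "\<psi> z = original p" using E(3) by blast
      then have "\<exists>D. ((\<lambda>q. inv_into V \<psi> (original q)) has_derivative D) (at p) \<and>
          D (system_field I p) = F z" using L z unfolding field_in_chart.simps by blast
      then show "F z = G z" using val[OF p(1)] p(2) by blast
    qed
  next
    assume R: "\<forall>z\<in>N - B. F z = G z"
    have "\<exists>D. ((\<lambda>q. inv_into V \<psi> (original q)) has_derivative D) (at p) \<and>
        D (system_field I p) = F z" if z: "z \<in> N" and eq: "\<psi> z = original p" for z p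
    proof -
      have p: "p \<in> E" "z = n p" using uniq[OF eq] by auto
      then have "z \<notin> B" using E(2) by blast
      then have "F z = G (n p)" using R z p(2) by blast
      then show ?thesis using val[OF p(1)] by blast
    qed
    then show "field_in_chart I (V, \<psi>) F N" unfolding field_in_chart.simps by blast
  qed
qed

lemma eventually_shift_off:
  fixes x :: complex
  shows "\<forall>\<^sub>F s in at 0. x + s \<noteq> 0"
proof -
  have "\<forall>\<^sub>F s in at (0::complex). s \<noteq> - x" by (rule eventually_neq_at_within)
  then show ?thesis by eventually_elim (metis add_eq_0_iff)
qed

text \<open>
  Boundaries are nowhere dense, so continuous functions that agree off the boundary agree on it.
  The diagonal direction \<open>(1, 1, 0)\<close> is used since it leaves both coordinate axes at once.
\<close>

lemma agree_on_boundary: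
  fixes f g :: "c3 \<Rightarrow> complex"
  assumes f: "isCont f z" and g: "isCont g z" and N: "open N" "z \<in> N"
    and eq: "\<And>w. w \<in> N \<Longrightarrow> w \<notin> B \<Longrightarrow> f w = g w"
    and off: "\<forall>\<^sub>F s in at (0::complex). z + (s, s, 0) \<notin> B"
  shows "f z = g z"
proof -
  have "((\<lambda>s. z + (s, s, 0)) \<longlongrightarrow> z + (0, 0, 0)) (at (0::complex))"
    by (intro tendsto_intros)
  then have lim: "((\<lambda>s. z + (s, s, 0)) \<longlongrightarrow> z) (at (0::complex))"
    by (simp add: zero_prod_def[symmetric])
  have "\<forall>\<^sub>F s in at (0::complex). z + (s, s, 0) \<in> N"
    using topological_tendstoD[OF lim N] .
  with off have ev: "\<forall>\<^sub>F s in at (0::complex). f (z + (s, s, 0)) = g (z + (s, s, 0))"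
    by eventually_elim (use eq in blast)
  have "((\<lambda>s. f (z + (s, s, 0))) \<longlongrightarrow> f z) (at (0::complex))"
    by (rule isCont_tendsto_compose[OF f lim])
  then have 1: "((\<lambda>s. g (z + (s, s, 0))) \<longlongrightarrow> f z) (at (0::complex))"
    by (rule Lim_transform_eventually[OF _ ev])
  have 2: "((\<lambda>s. g (z + (s, s, 0))) \<longlongrightarrow> g z) (at (0::complex))"
    by (rule isCont_tendsto_compose[OF g lim])
  show ?thesis by (rule tendsto_unique[OF _ 1 2]) simp
qed

lemma regular_iff:
  assumes "chart_field I \<psi> B G"
  shows "regular_in_chart I (UNIV, \<psi>) z \<longleftrightarrow>
    (\<exists>N F. open N \<and> z \<in> N \<and> holo3_map_on F N \<and> (\<forall>w\<in>N - B. F w = G w))"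
  by (simp del: field_in_chart.simps add: field_in_chart_iff[OF assms])

text \<open>
  An accessible point is interior to its chart, so accessibility can be examined on the whole
  space of triples.
\<close>

lemma accessible_in_larger_chart:
  assumes cf: "chart_field I \<psi> B G" and V: "- B \<subseteq> V"
    and acc: "accessible_in_chart I (V, \<psi>) z"
  shows "accessible_in_chart I (UNIV, \<psi>) z"
proof -
  have tr: "field_in_chart I (V, \<psi>) F N = field_in_chart I (UNIV, \<psi>) F N" if "N \<subseteq> V" for F N
    using field_in_chart_iff[OF cf V that] field_in_chart_iff[OF cf subset_UNIV subset_UNIV]
    by simp
  have sub: "field_in_chart I (UNIV, \<psi>) F N'" if "field_in_chart I (UNIV, \<psi>) F N" "N' \<subseteq> N"
    for F N N' using that unfolding field_in_chart.simps by blast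
  obtain N a1 a2 where N: "open N" "z \<in> N" "N \<subseteq> V" "holo3_on a1 N" "holo3_on a2 N" "a2 z = 0"
    and alt: "(\<forall>w\<in>N. \<psi> w \<notin> range original \<longleftrightarrow> fst w = 0) \<and>
         field_in_chart I (V, \<psi>) (\<lambda>w. (a1 w, a2 w / fst w, 1)) N \<or>
         (\<forall>w\<in>N. \<psi> w \<notin> range original \<longleftrightarrow> fst (snd w) = 0) \<and>
         field_in_chart I (V, \<psi>) (\<lambda>w. (a2 w / fst (snd w), a1 w, 1)) N"
    and z: "\<psi> z \<notin> range original" "\<not> regular_in_chart I (V, \<psi>) z"
    using acc unfolding accessible_in_chart.simps by blast
  have "\<not> regular_in_chart I (UNIV, \<psi>) z"
  proof
    assume "regular_in_chart I (UNIV, \<psi>) z"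
    then obtain N' F where N': "open N'" "z \<in> N'" "holo3_map_on F N'"
        "field_in_chart I (UNIV, \<psi>) F N'" unfolding regular_in_chart.simps by blast
    have "holo3_map_on F (N \<inter> N')"
      using N'(3) holo3_on_subset unfolding holo3_map_on_def by (meson inf_le2)
    moreover have "field_in_chart I (V, \<psi>) F (N \<inter> N')"
      using tr[of "N \<inter> N'"] sub[OF N'(4)] N(3) by blast
    ultimately have "regular_in_chart I (V, \<psi>) z"
      unfolding regular_in_chart.simps using N N' by (intro exI[of _ "N \<inter> N'"] exI[of _ F]) auto
    with z show False by blast
  qed
  then show ?thesis
    unfolding accessible_in_chart.simps
    using z(1) N alt[unfolded tr[OF N(3)]] by (meson UNIV_I subset_UNIV)
qed

section \<open>Charts with a simple pole along the boundary\<close>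

text \<open>
  The normal forms met along the way: one boundary divisor with a pole of the second component, and
  two crossing divisors where each component has its pole along the divisor of the other coordinate.
\<close>

definition polar_chart ::
  "complex \<Rightarrow> (c3 \<Rightarrow> point) \<Rightarrow> (c3 \<Rightarrow> complex) \<Rightarrow> (c3 \<Rightarrow> complex) \<Rightarrow> bool" where
  "polar_chart I \<psi> p q \<longleftrightarrow>
     chart_field I \<psi> {z. fst z = 0} (\<lambda>z. (p z, q z / fst z, 1)) \<and>
     holo3_on p UNIV \<and> holo3_on q UNIV"

definition crossing_chart ::
  "complex \<Rightarrow> (c3 \<Rightarrow> point) \<Rightarrow> (c3 \<Rightarrow> complex) \<Rightarrow> (c3 \<Rightarrow> complex) \<Rightarrow> bool" where
  "crossing_chart I \<psi> p q \<longleftrightarrow>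
     chart_field I \<psi> {z. fst z * fst (snd z) = 0} (\<lambda>z. (p z / fst (snd z), q z / fst z, 1)) \<and>
     holo3_on p UNIV \<and> holo3_on q UNIV"

lemma off_axis: "\<forall>\<^sub>F s in at (0::complex). z + (s, s, 0) \<notin> {z :: c3. fst z = 0}"
  using eventually_shift_off[of "fst z"] by eventually_elim simp

lemma off_axes:
  "\<forall>\<^sub>F s in at (0::complex). z + (s, s, 0) \<notin> {z :: c3. fst z * fst (snd z) = 0}"
  using eventually_shift_off[of "fst z"] eventually_shift_off[of "fst (snd z)"]
  by eventually_elim simp

lemma axis_not_other_axis:
  fixes z :: c3
  assumes "open N" "z \<in> N"
  shows "fst (snd z) = 0 \<Longrightarrow> \<exists>w\<in>N. fst w \<noteq> 0 \<and> fst (snd w) = 0"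
    and "fst z = 0 \<Longrightarrow> \<exists>w\<in>N. fst w = 0 \<and> fst (snd w) \<noteq> 0"
proof -
  have "((\<lambda>s. z + (s, 0, 0)) \<longlongrightarrow> z + (0, 0, 0)) (at (0::complex))"
    by (intro tendsto_intros)
  then have "((\<lambda>s. z + (s, 0, 0)) \<longlongrightarrow> z) (at (0::complex))"
    by (simp add: zero_prod_def[symmetric])
  from topological_tendstoD[OF this assms] eventually_shift_off[of "fst z"]
  have "\<forall>\<^sub>F s in at (0::complex). z + (s, 0, 0) \<in> N \<and> fst z + s \<noteq> 0"
    by eventually_elim blast
  from eventually_happens'[OF at_neq_bot this]
  obtain s where s: "z + (s, 0, 0) \<in> N" "fst z + s \<noteq> 0" by blast
  show "\<exists>w\<in>N. fst w \<noteq> 0 \<and> fst (snd w) = 0" if "fst (snd z) = 0"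
    using s that by (intro bexI[of _ "z + (s, 0, 0)"]) auto
  have "((\<lambda>s. z + (0, s, 0)) \<longlongrightarrow> z + (0, 0, 0)) (at (0::complex))"
    by (intro tendsto_intros)
  then have "((\<lambda>s. z + (0, s, 0)) \<longlongrightarrow> z) (at (0::complex))"
    by (simp add: zero_prod_def[symmetric])
  from topological_tendstoD[OF this assms] eventually_shift_off[of "fst (snd z)"]
  have "\<forall>\<^sub>F s in at (0::complex). z + (0, s, 0) \<in> N \<and> fst (snd z) + s \<noteq> 0"
    by eventually_elim blast
  from eventually_happens'[OF at_neq_bot this]
  obtain s where s: "z + (0, s, 0) \<in> N" "fst (snd z) + s \<noteq> 0" by blast
  show "\<exists>w\<in>N. fst w = 0 \<and> fst (snd w) \<noteq> 0" if "fst z = 0"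
    using s that by (intro bexI[of _ "z + (0, s, 0)"]) auto
qed

text \<open>
  The numerator of the polar component is determined by the field, hence it is the \<open>a\<^sub>2\<close> of the
  definition.  The other alternative fails because the boundary is not the divisor of the second
  coordinate.
\<close>

lemma polar_accessible:
  assumes pc: "polar_chart I \<psi> p q" and acc: "accessible_in_chart I (UNIV, \<psi>) z"
  shows "fst z = 0 \<and> q z = 0"
proof -
  note cf = conjunct1[OF pc[unfolded polar_chart_def]]
  have bd: "\<psi> w \<notin> range original \<longleftrightarrow> fst w = 0" for w
    using chart_field_boundary[OF cf] by simp
  have q: "isCont q z" using pc unfolding polar_chart_def by (auto intro: holo3_isCont)
  obtain N a1 a2 where N: "open N" "z \<in> N" "holo3_on a1 N" "holo3_on a2 N" "a2 z = 0"
    and alt: "(\<forall>w\<in>N. \<psi> w \<notin> range original \<longleftrightarrow> fst w = 0) \<and>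
         field_in_chart I (UNIV, \<psi>) (\<lambda>w. (a1 w, a2 w / fst w, 1)) N \<or>
         (\<forall>w\<in>N. \<psi> w \<notin> range original \<longleftrightarrow> fst (snd w) = 0) \<and>
         field_in_chart I (UNIV, \<psi>) (\<lambda>w. (a2 w / fst (snd w), a1 w, 1)) N"
    and z: "\<psi> z \<notin> range original"
    using acc unfolding accessible_in_chart.simps by blast
  have z0: "fst z = 0" using z bd by blast
  have "\<not> (\<forall>w\<in>N. \<psi> w \<notin> range original \<longleftrightarrow> fst (snd w) = 0)"
    using axis_not_other_axis(2)[OF N(1,2) z0] bd by blast
  then have "field_in_chart I (UNIV, \<psi>) (\<lambda>w. (a1 w, a2 w / fst w, 1)) N" using alt by blast
  then have "\<forall>w\<in>N - {z. fst z = 0}. (a1 w, a2 w / fst w, 1) = (p w, q w / fst w, 1 :: complex)"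
    unfolding field_in_chart_iff[OF cf subset_UNIV subset_UNIV] .
  then have "a2 w = q w" if "w \<in> N" "w \<notin> {z. fst z = 0}" for w
    using that by auto
  then have "a2 z = q z"
    by (rule agree_on_boundary[OF holo3_isCont[OF N(4,2)] q N(1,2) _ off_axis])
  then show ?thesis using z0 N(5) by simp
qed

text \<open>
  A holomorphic extension \<open>F\<close> of the field satisfies \<open>q = x F\<^sub>2\<close> off the boundary, hence on it.
\<close>

lemma polar_regular_imp:
  assumes pc: "polar_chart I \<psi> p q" and reg: "regular_in_chart I (UNIV, \<psi>) z"
  shows "\<exists>N. open N \<and> z \<in> N \<and> (\<forall>w\<in>N. fst w = 0 \<longrightarrow> q w = 0)"
proof -
  note cf = conjunct1[OF pc[unfolded polar_chart_def]]
  have q: "isCont q w" for w using pc unfolding polar_chart_def by (auto intro: holo3_isCont)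
  obtain N F where N: "open N" "z \<in> N" "holo3_map_on F N"
    and F: "\<forall>w\<in>N - {z. fst z = 0}. F w = (p w, q w / fst w, 1 :: complex)"
    using reg unfolding regular_iff[OF cf] by blast
  have "q w = 0" if w: "w \<in> N" "fst w = 0" for w
  proof -
    have "holo3_on (\<lambda>z. fst (snd (F z)) * fst z) N"
      using N(3) unfolding holo3_map_on_def by (intro holo3_on_mult holo3_on_fst) auto
    then have c: "isCont (\<lambda>z. fst (snd (F z)) * fst z) w" using w(1) by (rule holo3_isCont)
    have "fst (snd (F w)) * fst w = q w"
      by (rule agree_on_boundary[OF c q N(1) w(1) _ off_axis]) (use F in auto)
    then show ?thesis using w(2) by simp
  qed
  then show ?thesis using N by blast
qed

lemma polar_regular:
  assumes pc: "polar_chart I \<psi> p q" and r: "holo3_on r UNIV" "\<And>z. q z = fst z * r z"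
  shows "regular_in_chart I (UNIV, \<psi>) z"
proof -
  note cf = conjunct1[OF pc[unfolded polar_chart_def]]
  have "holo3_map_on (\<lambda>z. (p z, r z, 1)) UNIV"
    using pc r unfolding polar_chart_def holo3_map_on_def by (auto intro: holo3_on_const)
  then show ?thesis unfolding regular_iff[OF cf]
    by (intro exI[of _ UNIV] exI[of _ "\<lambda>z. (p z, r z, 1)"]) (auto simp: r(2))
qed

text \<open>
  Since \<open>\<kappa>\<close> does not vanish at the centre, the numerator has nonzero values on the divisor arbitrarily
  near to the centre, so the field has no holomorphic extension there.
\<close>

lemma polar_centre_accessible:
  assumes pc: "polar_chart I \<psi> p (\<lambda>(x, y, t). (y - b t) * \<kappa> (x, y, t) + x * h (x, y, t))"
    and \<kappa>: "holo3_on \<kappa> UNIV" "\<kappa> (0, b t, t) \<noteq> 0"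
    and V: "open V" "- {z. fst z = 0} \<subseteq> V" "(0, b t, t) \<in> V"
  shows "accessible_in_chart I (V, \<psi>) (0, b t, t)"
proof -
  define q where "q = (\<lambda>(x, y, t). (y - b t) * \<kappa> (x, y, t) + x * h (x, y, t))"
  have pc': "polar_chart I \<psi> p q" using pc unfolding q_def .
  note cf = conjunct1[OF pc'[unfolded polar_chart_def]]
  have bd: "\<psi> w \<notin> range original \<longleftrightarrow> fst w = 0" for w
    using chart_field_boundary[OF cf] by simp
  have nreg: "\<not> regular_in_chart I (V, \<psi>) (0, b t, t)"
  proof
    assume "regular_in_chart I (V, \<psi>) (0, b t, t)"
    then have "regular_in_chart I (UNIV, \<psi>) (0, b t, t)"
      unfolding regular_in_chart.simps field_in_chart_iff[OF cf subset_UNIV subset_UNIV]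
      using field_in_chart_iff[OF cf V(2)] by (meson subset_UNIV)
    then obtain N where N: "open N" "(0, b t, t) \<in> N" "\<forall>w\<in>N. fst w = 0 \<longrightarrow> q w = 0"
      using polar_regular_imp[OF pc'] by blast
    \<comment> \<open>On the divisor, the numerator vanishes identically near the centre, which forces \<open>\<kappa> = 0\<close>
      where \<open>y \<noteq> b\<close> and by continuity at the centre.\<close>
    define f :: "c3 \<Rightarrow> complex" where "f = (\<lambda>w. \<kappa> (0, fst (snd w), t))"
    define M :: "c3 set" where "M = (\<lambda>w. (0, fst (snd w), t)) -` N"
    have M: "open M" "(0, b t, t) \<in> M" unfolding M_def
      using N(2) by (auto intro!: continuous_open_vimage N(1) continuous_intros)
    have "holo3_on f UNIV" unfolding f_def
      by (intro holo3_on_comp3[OF \<kappa>(1)] holo3_on_const holo3_on_snd) auto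
    then have f: "isCont f (0, b t, t)" by (rule holo3_isCont) simp
    have eq: "f w = 0" if "w \<in> M" "w \<notin> {w. fst (snd w) = b t}" for w
      using N(3) that unfolding M_def f_def q_def by fastforce
    have off: "\<forall>\<^sub>F s in at (0::complex).
        (0, b t, t) + (s, s, 0) \<notin> {w :: c3. fst (snd w) = b t}"
      using eventually_shift_off[of 0] by eventually_elim simp
    have "f (0, b t, t) = 0"
      by (rule agree_on_boundary[OF f continuous_const M eq off])
    then show False using \<kappa>(2) unfolding f_def by simp
  qed
  have "field_in_chart I (V, \<psi>) (\<lambda>w. (p w, q w / fst w, 1 :: complex)) V"
    using field_in_chart_iff[OF cf V(2) subset_refl] by simp
  moreover have "holo3_on p V" "holo3_on q V"
    using pc' unfolding polar_chart_def by (auto intro: holo3_on_subset)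
  moreover have "q (0, b t, t) = 0" unfolding q_def by simp
  moreover have "\<psi> (0, b t, t) \<notin> range original" using bd by simp
  ultimately show ?thesis
    unfolding accessible_in_chart.simps using V nreg bd by blast
qed

text \<open>
  The origin of the two divisors is excluded: near it the boundary is a pair of axes, never the
  zero set of a single coordinate.
\<close>

lemma crossing_accessible:
  assumes cc: "crossing_chart I \<psi> p q" and acc: "accessible_in_chart I (UNIV, \<psi>) (x, y, t)"
  shows "x = 0 \<and> y \<noteq> 0 \<and> q (x, y, t) = 0 \<or>
    x \<noteq> 0 \<and> y = 0 \<and> p (x, y, t) = 0 \<and> \<not> regular_in_chart I (UNIV, \<psi>) (x, y, t)"
proof -
  let ?z = "(x, y, t)" and ?B = "{z :: c3. fst z * fst (snd z) = 0}"
  note cf = conjunct1[OF cc[unfolded crossing_chart_def]]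
  have bd: "\<psi> w \<notin> range original \<longleftrightarrow> fst w = 0 \<or> fst (snd w) = 0" for w
    using chart_field_boundary[OF cf] by simp
  have c: "isCont p ?z" "isCont q ?z"
    using cc unfolding crossing_chart_def by (auto intro: holo3_isCont)
  obtain N a1 a2 where N: "open N" "?z \<in> N" "holo3_on a1 N" "holo3_on a2 N" "a2 ?z = 0"
    and alt: "(\<forall>w\<in>N. \<psi> w \<notin> range original \<longleftrightarrow> fst w = 0) \<and>
         field_in_chart I (UNIV, \<psi>) (\<lambda>w. (a1 w, a2 w / fst w, 1)) N \<or>
         (\<forall>w\<in>N. \<psi> w \<notin> range original \<longleftrightarrow> fst (snd w) = 0) \<and>
         field_in_chart I (UNIV, \<psi>) (\<lambda>w. (a2 w / fst (snd w), a1 w, 1)) N"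
    and z: "\<psi> ?z \<notin> range original" "\<not> regular_in_chart I (UNIV, \<psi>) ?z"
    using acc unfolding accessible_in_chart.simps by blast
  have xy: "x = 0 \<or> y = 0" using z bd by fastforce
  from alt show ?thesis
  proof
    assume A: "(\<forall>w\<in>N. \<psi> w \<notin> range original \<longleftrightarrow> fst w = 0) \<and>
         field_in_chart I (UNIV, \<psi>) (\<lambda>w. (a1 w, a2 w / fst w, 1)) N"
    then have y: "y \<noteq> 0" using axis_not_other_axis(1)[OF N(1,2)] bd by auto
    have "\<forall>w\<in>N - ?B. (a1 w, a2 w / fst w, 1) = (p w / fst (snd w), q w / fst w, 1 :: complex)"
      using A unfolding field_in_chart_iff[OF cf subset_UNIV subset_UNIV] by (rule conjunct2)
    then have "a2 w = q w" if "w \<in> N" "w \<notin> ?B" for w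
      using that by auto
    then have "a2 ?z = q ?z"
      by (rule agree_on_boundary[OF holo3_isCont[OF N(4,2)] c(2) N(1,2) _ off_axes])
    then show ?thesis using y xy N(5) by simp
  next
    assume A: "(\<forall>w\<in>N. \<psi> w \<notin> range original \<longleftrightarrow> fst (snd w) = 0) \<and>
         field_in_chart I (UNIV, \<psi>) (\<lambda>w. (a2 w / fst (snd w), a1 w, 1)) N"
    then have x: "x \<noteq> 0" using axis_not_other_axis(2)[OF N(1,2)] bd by auto
    have "\<forall>w\<in>N - ?B. (a2 w / fst (snd w), a1 w, 1) = (p w / fst (snd w), q w / fst w, 1 :: complex)"
      using A unfolding field_in_chart_iff[OF cf subset_UNIV subset_UNIV] by (rule conjunct2)
    then have "a2 w = p w" if "w \<in> N" "w \<notin> ?B" for w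
      using that by auto
    then have "a2 ?z = p ?z"
      by (rule agree_on_boundary[OF holo3_isCont[OF N(4,2)] c(1) N(1,2) _ off_axes])
    then show ?thesis using x xy N(5) z(2) by simp
  qed
qed

lemma crossing_regular_imp:
  assumes cc: "crossing_chart I \<psi> p q" and reg: "regular_in_chart I (UNIV, \<psi>) z"
    and z: "fst z = 0"
  shows "q z = 0"
proof -
  let ?B = "{z :: c3. fst z * fst (snd z) = 0}"
  note cf = conjunct1[OF cc[unfolded crossing_chart_def]]
  have q: "isCont q z" using cc unfolding crossing_chart_def by (auto intro: holo3_isCont)
  obtain N F where N: "open N" "z \<in> N" "holo3_map_on F N"
    and F: "\<forall>w\<in>N - ?B. F w = (p w / fst (snd w), q w / fst w, 1 :: complex)"
    using reg unfolding regular_iff[OF cf] by blast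
  have "holo3_on (\<lambda>z. fst (snd (F z)) * fst z) N"
    using N(3) unfolding holo3_map_on_def by (intro holo3_on_mult holo3_on_fst) auto
  then have c: "isCont (\<lambda>z. fst (snd (F z)) * fst z) z" using N(2) by (rule holo3_isCont)
  have "fst (snd (F z)) * fst z = q z"
    by (rule agree_on_boundary[OF c q N(1,2) _ off_axes]) (use F in auto)
  then show ?thesis using z by simp
qed

lemma crossing_regular:
  assumes cc: "crossing_chart I \<psi> p q"
    and r: "holo3_on r {z. fst z \<noteq> 0}" "\<And>z. fst z \<noteq> 0 \<Longrightarrow> p z = fst (snd z) * r z"
    and z: "fst z \<noteq> 0"
  shows "regular_in_chart I (UNIV, \<psi>) z"
proof -
  note cf = conjunct1[OF cc[unfolded crossing_chart_def]]
  let ?N = "{z :: c3. fst z \<noteq> 0}"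
  have "open ?N" by (intro open_Collect_neq continuous_intros)
  moreover have "holo3_on q ?N"
    using cc unfolding crossing_chart_def by (auto intro: holo3_on_subset)
  then have "holo3_map_on (\<lambda>z. (r z, q z / fst z, 1)) ?N"
    unfolding holo3_map_on_def fst_conv snd_conv using r(1)
    by (intro conjI holo3_on_divide holo3_on_fst holo3_on_const) auto
  ultimately show ?thesis unfolding regular_iff[OF cf] using z
    by (intro exI[of _ ?N] exI[of _ "\<lambda>z. (r z, q z / fst z, 1)"]) (auto simp: r(2))
qed

section \<open>Exchanging the two fibre coordinates\<close>

text \<open>
  The tower over the point at infinity of the y-axis has its boundary on the second coordinate.
  Exchanging the coordinates reduces it to the normal form above.
\<close>

definition swap :: "c3 \<Rightarrow> c3" where
  "swap = (\<lambda>(x, y, t). (y, x, t))"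

lemma swap_simps [simp]: "swap (x, y, t) = (y, x, t)" "swap (swap z) = z"
  by (auto simp: swap_def split: prod.split)

lemma fst_swap [simp]: "fst (swap z) = fst (snd z)" "fst (snd (swap z)) = fst z"
    "snd (snd (swap z)) = snd (snd z)"
  by (auto simp: swap_def split: prod.split)

lemma comp_swap_swap: "\<psi> \<circ> swap \<circ> swap = \<psi>"
  by (simp add: fun_eq_iff del: split_paired_All)

lemma swap_has_derivative: "(swap has_derivative swap) (at z)"
proof -
  have *: "swap = (\<lambda>z. (fst (snd z), fst z, snd (snd z)))"
    by (auto simp: swap_def)
  have "((\<lambda>z::c3. (fst (snd z), fst z, snd (snd z))) has_derivative
      (\<lambda>z. (fst (snd z), fst z, snd (snd z)))) (at z)"
    by (intro derivative_intros)
  then show ?thesis unfolding * .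
qed

lemma continuous_on_swap: "continuous_on S swap"
  by (meson continuous_at_imp_continuous_on has_derivative_continuous swap_has_derivative)

lemma open_swap: "open N \<Longrightarrow> open (swap -` N)"
  by (simp add: continuous_on_swap open_vimage)

lemma holo3_on_swap: 
  assumes "holo3_on f N" shows "holo3_on (\<lambda>z. f (swap z)) (swap -` N)"
proof -
  have *: "swap = (\<lambda>z. (fst (snd z), fst z, snd (snd z)))"
    by (auto simp: swap_def)
  show ?thesis unfolding *
    by (rule holo3_on_comp3[OF assms holo3_on_snd holo3_on_fst holo3_on_thd]) simp
qed

lemma chart_field_swap:
  assumes "chart_field I \<psi> B G"
  shows "chart_field I (\<psi> \<circ> swap) (swap -` B) (\<lambda>z. swap (G (swap z)))"
proof (rule chart_field_change[OF assms open_UNIV, of swap])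
  show "swap z \<notin> swap -` B" if "z \<notin> B" for z using that by simp
  show "\<exists>w\<in>UNIV - B. z = swap w" if "z \<notin> swap -` B" for z
    using that by (intro bexI[of _ "swap z"]) simp_all
  show "(\<psi> \<circ> swap) (swap z) = \<psi> z" for z by simp
  show "z \<in> swap -` B \<Longrightarrow> (\<psi> \<circ> swap) z \<notin> range original" for z
    using chart_field_boundary[OF assms] by simp
  show "\<exists>D. (swap has_derivative D) (at z) \<and> D (G z) = swap (G (swap (swap z)))" for z
    by (intro exI[of _ swap] conjI swap_has_derivative) simp
qed

lemma holo3_map_on_swap:
  assumes "holo3_map_on F N"
  shows "holo3_map_on (\<lambda>z. swap (F (swap z))) (swap -` N)"
  using assms unfolding holo3_map_on_def fst_swap
  by (auto dest: holo3_on_swap)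

lemma regular_swap_imp:
  assumes cf: "chart_field I \<psi> B G" and reg: "regular_in_chart I (UNIV, \<psi>) z"
  shows "regular_in_chart I (UNIV, \<psi> \<circ> swap) (swap z)"
proof -
  obtain N F where N: "open N" "z \<in> N" "holo3_map_on F N" "\<forall>w\<in>N - B. F w = G w"
    using reg unfolding regular_iff[OF cf] by blast
  have "\<forall>w\<in>swap -` N - swap -` B. swap (F (swap w)) = swap (G (swap w))"
    using N(4) by (metis DiffD1 DiffD2 DiffI vimageE vimageI2)
  then show ?thesis
    unfolding regular_iff[OF chart_field_swap[OF cf]]
    using open_swap[OF N(1)] N(2) holo3_map_on_swap[OF N(3)]
    by (intro exI[of _ "swap -` N"] exI[of _ "\<lambda>z. swap (F (swap z))"]) simp
qed

lemma regular_swap: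
  assumes cf: "chart_field I \<psi> B G"
  shows "regular_in_chart I (UNIV, \<psi> \<circ> swap) z \<longleftrightarrow> regular_in_chart I (UNIV, \<psi>) (swap z)"
  using regular_swap_imp[OF cf, of "swap z"] regular_swap_imp[OF chart_field_swap[OF cf], of z]
  unfolding comp_swap_swap swap_simps(2) by iprover

lemma accessible_swap_imp:
  assumes cf: "chart_field I \<psi> B G" and acc: "accessible_in_chart I (UNIV, \<psi>) z"
  shows "accessible_in_chart I (UNIV, \<psi> \<circ> swap) (swap z)"
proof -
  let ?s = "swap"
  obtain N a1 a2 where N: "open N" "z \<in> N" "holo3_on a1 N" "holo3_on a2 N" "a2 z = 0"
    and alt: "(\<forall>w\<in>N. \<psi> w \<notin> range original \<longleftrightarrow> fst w = 0) \<and>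
         field_in_chart I (UNIV, \<psi>) (\<lambda>w. (a1 w, a2 w / fst w, 1)) N \<or>
         (\<forall>w\<in>N. \<psi> w \<notin> range original \<longleftrightarrow> fst (snd w) = 0) \<and>
         field_in_chart I (UNIV, \<psi>) (\<lambda>w. (a2 w / fst (snd w), a1 w, 1)) N"
    and z: "\<psi> z \<notin> range original" "\<not> regular_in_chart I (UNIV, \<psi>) z"
    using acc unfolding accessible_in_chart.simps by blast
  have fld: "field_in_chart I (UNIV, \<psi> \<circ> swap) (\<lambda>w. swap (F (swap w))) (swap -` N)"
    if "field_in_chart I (UNIV, \<psi>) F N" for F
  proof -
    have "\<forall>w\<in>N - B. F w = G w"
      using that field_in_chart_iff[OF cf subset_UNIV subset_UNIV] by blast
    then have "\<forall>w\<in>swap -` N - swap -` B. swap (F (swap w)) = swap (G (swap w))"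
      by (metis DiffD1 DiffD2 DiffI vimageE vimageI2)
    then show ?thesis
      unfolding field_in_chart_iff[OF chart_field_swap[OF cf] subset_UNIV subset_UNIV] .
  qed
  have "(\<forall>w\<in>swap -` N. (\<psi> \<circ> swap) w \<notin> range original \<longleftrightarrow> fst (snd w) = 0) \<and>
       field_in_chart I (UNIV, \<psi> \<circ> swap)
         (\<lambda>w. (a2 (swap w) / fst (snd w), a1 (swap w), 1)) (swap -` N) \<or>
     (\<forall>w\<in>swap -` N. (\<psi> \<circ> swap) w \<notin> range original \<longleftrightarrow> fst w = 0) \<and>
       field_in_chart I (UNIV, \<psi> \<circ> swap)
         (\<lambda>w. (a1 (swap w), a2 (swap w) / fst w, 1)) (swap -` N)"
    using alt
  proof (elim disj_forward conj_forward)
    assume A: "\<forall>w\<in>N. \<psi> w \<notin> range original \<longleftrightarrow> fst w = 0"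
    show "\<forall>w\<in>swap -` N. (\<psi> \<circ> swap) w \<notin> range original \<longleftrightarrow> fst (snd w) = 0"
    proof
      fix w assume "w \<in> swap -` N"
      then show "(\<psi> \<circ> swap) w \<notin> range original \<longleftrightarrow> fst (snd w) = 0"
        using bspec[OF A, of "swap w"] by (simp only: o_apply fst_swap vimage_eq)
    qed
  next
    assume A: "\<forall>w\<in>N. \<psi> w \<notin> range original \<longleftrightarrow> fst (snd w) = 0"
    show "\<forall>w\<in>swap -` N. (\<psi> \<circ> swap) w \<notin> range original \<longleftrightarrow> fst w = 0"
    proof
      fix w assume "w \<in> swap -` N"
      then show "(\<psi> \<circ> swap) w \<notin> range original \<longleftrightarrow> fst w = 0"
        using bspec[OF A, of "swap w"] by (simp only: o_apply fst_swap vimage_eq)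
    qed
  next
    assume "field_in_chart I (UNIV, \<psi>) (\<lambda>w. (a1 w, a2 w / fst w, 1)) N"
    from fld[OF this] show "field_in_chart I (UNIV, \<psi> \<circ> swap)
         (\<lambda>w. (a2 (swap w) / fst (snd w), a1 (swap w), 1)) (swap -` N)"
      by (simp only: swap_simps fst_swap)
  next
    assume "field_in_chart I (UNIV, \<psi>) (\<lambda>w. (a2 w / fst (snd w), a1 w, 1)) N"
    from fld[OF this] show "field_in_chart I (UNIV, \<psi> \<circ> swap)
         (\<lambda>w. (a1 (swap w), a2 (swap w) / fst w, 1)) (swap -` N)"
      by (simp only: swap_simps fst_swap)
  qed
  then have alt': "(\<forall>w\<in>swap -` N. (\<psi> \<circ> swap) w \<notin> range original \<longleftrightarrow> fst w = 0) \<and>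
       field_in_chart I (UNIV, \<psi> \<circ> swap)
         (\<lambda>w. (a1 (swap w), a2 (swap w) / fst w, 1)) (swap -` N) \<or>
     (\<forall>w\<in>swap -` N. (\<psi> \<circ> swap) w \<notin> range original \<longleftrightarrow> fst (snd w) = 0) \<and>
       field_in_chart I (UNIV, \<psi> \<circ> swap)
         (\<lambda>w. (a2 (swap w) / fst (snd w), a1 (swap w), 1)) (swap -` N)"
    by (rule disj_commute[THEN iffD1])
  have nreg: "\<not> regular_in_chart I (UNIV, \<psi> \<circ> swap) (swap z)"
    using z(2) regular_swap[OF cf] by simp
  show ?thesis unfolding accessible_in_chart.simps
    by (intro conjI exI[of _ "swap -` N"] exI[of _ "\<lambda>w. a1 (swap w)"]
        exI[of _ "\<lambda>w. a2 (swap w)"] alt' nreg open_swap holo3_on_swap)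
      (use N z(1) in \<open>simp_all del: split_paired_All\<close>)
qed

lemma accessible_swap:
  assumes cf: "chart_field I \<psi> B G"
  shows "accessible_in_chart I (UNIV, \<psi> \<circ> swap) z \<longleftrightarrow>
    accessible_in_chart I (UNIV, \<psi>) (swap z)"
  using accessible_swap_imp[OF cf, of "swap z"] accessible_swap_imp[OF chart_field_swap[OF cf], of z]
  unfolding comp_swap_swap swap_simps(2) by iprover

section \<open>Blowing up a point of the boundary\<close>

text \<open>
  Blow-up of a polar chart \<open>\<psi>\<close> at \<open>(0, b t, t)\<close>: \<open>\<psi>\<^sub>1\<close> has coordinates \<open>(x, (y - b) / x)\<close> and continues
  the tower, \<open>\<psi>\<^sub>2\<close> has coordinates \<open>(x / (y - b), y - b)\<close>.  The points of the exceptional curve are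
  left arbitrary up to the overlap of the two charts, so that the locale also applies to exchanged
  coordinates, where these points carry different names.
\<close>

locale polar_blow_up =
  fixes I :: complex and \<psi> \<psi>\<^sub>1 \<psi>\<^sub>2 :: "c3 \<Rightarrow> point" and p \<kappa> h :: "c3 \<Rightarrow> complex"
    and b b' :: "complex \<Rightarrow> complex"
  assumes polar: "polar_chart I \<psi> p (\<lambda>(x, y, t). (y - b t) * \<kappa> (x, y, t) + x * h (x, y, t))"
    and holo: "holo3_on \<kappa> UNIV" "holo3_on h UNIV" "b' holomorphic_on UNIV"
    and b: "\<And>t. (b has_field_derivative b' t) (at t)"
    and nonzero: "\<And>t. \<kappa> (0, b t, t) \<noteq> 0"
    and main_off: "\<And>u w t. u \<noteq> 0 \<Longrightarrow> \<psi>\<^sub>1 (u, w, t) = \<psi> (u, b t + u * w, t)"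
    and main_on: "\<And>w t. \<psi>\<^sub>1 (0, w, t) \<notin> range original"
    and side_off: "\<And>s v t. v \<noteq> 0 \<Longrightarrow> \<psi>\<^sub>2 (s, v, t) = \<psi> (s * v, b t + v, t)"
    and side_on: "\<And>s t. \<psi>\<^sub>2 (s, 0, t) \<notin> range original"
    and overlap: "\<And>s t. s \<noteq> 0 \<Longrightarrow> \<psi>\<^sub>2 (s, 0, t) = \<psi>\<^sub>1 (0, 1 / s, t)"
begin

lemma b_holomorphic: "b holomorphic_on UNIV"
  using b by (auto simp: holomorphic_on_def field_differentiable_def)

lemma p_holo: "holo3_on p UNIV"
  using polar unfolding polar_chart_def by simp

lemma psi_boundary: "\<psi> z \<notin> range original \<longleftrightarrow> fst z = 0"
  using polar chart_field_boundary unfolding polar_chart_def by blast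

lemma b_has_derivative: "((\<lambda>z::c3. b (snd (snd z))) has_derivative
    (\<lambda>h. b' (snd (snd z)) * snd (snd h))) (at z)"
proof -
  have 1: "((\<lambda>z::c3. snd (snd z)) has_derivative (\<lambda>h. snd (snd h))) (at z)"
    by (intro derivative_intros)
  have 2: "(b has_derivative (*) (b' (snd (snd z)))) (at (snd (snd z)))"
    using b by (simp add: has_field_derivative_def)
  show ?thesis using has_derivative_compose[OF 1 2] .
qed

text \<open>
  The numerators of the poles after the blow-up.  With \<open>q = (y - b) \<kappa> + x h\<close>, the derivative of
  \<open>w = (y - b) / x\<close> is \<open>(w (\<kappa> - p) + h - b') / x\<close>, and that of \<open>v = y - b\<close> is \<open>(\<kappa> + s (h - b')) / s\<close>
  with \<open>s = x / v\<close>.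
\<close>

definition main_pole :: "c3 \<Rightarrow> complex" where
  "main_pole = (\<lambda>(u, w, t). w * (\<kappa> (u, b t + u * w, t) - p (u, b t + u * w, t)) +
     h (u, b t + u * w, t) - b' t)"

definition side_pole :: "c3 \<Rightarrow> complex" where
  "side_pole = (\<lambda>(s, v, t). \<kappa> (s * v, b t + v, t) + s * (h (s * v, b t + v, t) - b' t))"

theorem main_chart: "polar_chart I \<psi>\<^sub>1 (\<lambda>(u, w, t). p (u, b t + u * w, t)) main_pole"
proof -
  let ?B = "{z :: c3. fst z = 0}"
  let ?G = "\<lambda>z. (p z, (\<lambda>(x, y, t). (y - b t) * \<kappa> (x, y, t) + x * h (x, y, t)) z / fst z, 1)"
  have cf: "chart_field I \<psi> ?B ?G"
    using polar unfolding polar_chart_def by simp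
  define \<sigma> :: "c3 \<Rightarrow> c3" where
    "\<sigma> = (\<lambda>z. (fst z, (fst (snd z) - b (snd (snd z))) / fst z, snd (snd z)))"
  have "chart_field I \<psi>\<^sub>1 ?B
      (\<lambda>z. ((\<lambda>(u, w, t). p (u, b t + u * w, t)) z, main_pole z / fst z, 1))"
  proof (rule chart_field_change[OF cf open_UNIV, of \<sigma>])
    show "\<sigma> z \<notin> ?B" if "z \<in> UNIV" "z \<notin> ?B" for z using that by (simp add: \<sigma>_def)
    show "\<exists>w\<in>UNIV - ?B. z = \<sigma> w" if z: "z \<notin> ?B" for z
    proof -
      obtain x y t where zz: "z = (x, y, t)" by (rule prod_cases3)
      show ?thesis using z unfolding zz
        by (intro bexI[of _ "(x, b t + x * y, t)"]) (simp_all add: \<sigma>_def)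
    qed
    show "\<psi>\<^sub>1 (\<sigma> z) = \<psi> z" if "z \<notin> ?B" for z
      using that by (cases z rule: prod_cases3) (simp add: \<sigma>_def main_off)
    show "\<psi>\<^sub>1 z \<notin> range original" if "z \<in> ?B" for z
    proof -
      obtain u w t where "z = (u, w, t)" by (rule prod_cases3)
      then have "z = (0, w, t)" using that by simp
      then show ?thesis using main_on by (simp only: not_False_eq_True)
    qed
    show "\<exists>D. (\<sigma> has_derivative D) (at z) \<and> D (?G z) =
        ((\<lambda>(u, w, t). p (u, b t + u * w, t)) (\<sigma> z), main_pole (\<sigma> z) / fst (\<sigma> z), 1)"
      if "z \<notin> ?B" for z
    proof -
      obtain x y t where z: "z = (x, y, t)" by (rule prod_cases3)
      have x: "x \<noteq> 0" using that z by simp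
      define D :: "c3 \<Rightarrow> c3" where "D = (\<lambda>d. (fst d,
         ((fst (snd d) - b' t * snd (snd d)) * x - (y - b t) * fst d) / (x * x), snd (snd d)))"
      have "(\<sigma> has_derivative D) (at z)"
        unfolding \<sigma>_def D_def
        by (rule has_derivative_eq_rhs,
            (rule has_derivative_Pair has_derivative_fst has_derivative_snd
              has_derivative_ident has_derivative_divide' has_derivative_diff b_has_derivative
             | use x z in simp)+)
      moreover have "D (?G z) =
        ((\<lambda>(u, w, t). p (u, b t + u * w, t)) (\<sigma> z), main_pole (\<sigma> z) / fst (\<sigma> z), 1)"
        using x unfolding D_def \<sigma>_def main_pole_def z by (simp add: field_simps)
      ultimately show ?thesis by blast
    qed
  qed
  moreover have "holo3_on (\<lambda>(u, w, t). p (u, b t + u * w, t)) UNIV" "holo3_on main_pole UNIV"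
    unfolding main_pole_def case_prod_beta
    by (intro holo3_intros holo3_on_comp3[OF p_holo] holo3_on_comp3[OF holo(1)]
        holo3_on_comp3[OF holo(2)] holo3_on_entire[OF b_holomorphic] holo3_on_entire[OF holo(3)]
        UNIV_I)+
  ultimately show ?thesis unfolding polar_chart_def by blast
qed

theorem side_chart:
  "crossing_chart I \<psi>\<^sub>2 (\<lambda>(s, v, t). p (s * v, b t + v, t) - side_pole (s, v, t)) side_pole"
proof -
  let ?B = "{z :: c3. fst z = 0}" and ?B' = "{z :: c3. fst z * fst (snd z) = 0}"
  let ?G = "\<lambda>z. (p z, (\<lambda>(x, y, t). (y - b t) * \<kappa> (x, y, t) + x * h (x, y, t)) z / fst z, 1)"
  let ?G' = "\<lambda>z. ((\<lambda>(s, v, t). p (s * v, b t + v, t) - side_pole (s, v, t)) z / fst (snd z),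
      side_pole z / fst z, 1)"
  let ?\<Omega> = "{z :: c3. fst (snd z) \<noteq> b (snd (snd z))}"
  have cf: "chart_field I \<psi> ?B ?G"
    using polar unfolding polar_chart_def by simp
  have "continuous_on UNIV (\<lambda>z::c3. b (snd (snd z)))"
    by (intro continuous_at_imp_continuous_on ballI has_derivative_continuous[OF b_has_derivative])
  then have op: "open ?\<Omega>"
    by (intro open_Collect_neq continuous_on_fst continuous_on_snd continuous_on_id)
  define \<sigma> :: "c3 \<Rightarrow> c3" where
    "\<sigma> = (\<lambda>z. (fst z / (fst (snd z) - b (snd (snd z))),
        fst (snd z) - b (snd (snd z)), snd (snd z)))"
  have "chart_field I \<psi>\<^sub>2 ?B' ?G'"
  proof (rule chart_field_change[OF cf op, of \<sigma>])
    show "\<sigma> z \<notin> ?B'" if "z \<in> ?\<Omega>" "z \<notin> ?B" for z using that by (simp add: \<sigma>_def)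
    show "\<exists>w\<in>?\<Omega> - ?B. z = \<sigma> w" if z: "z \<notin> ?B'" for z
    proof -
      obtain x y t where zz: "z = (x, y, t)" by (rule prod_cases3)
      show ?thesis using z unfolding zz
        by (intro bexI[of _ "(x * y, b t + y, t)"]) (simp_all add: \<sigma>_def)
    qed
    show "\<psi>\<^sub>2 (\<sigma> z) = \<psi> z" if "z \<in> ?\<Omega>" "z \<notin> ?B" for z
      using that by (cases z rule: prod_cases3) (simp add: \<sigma>_def side_off)
    show "\<psi>\<^sub>2 z \<notin> range original" if "z \<in> ?B'" for z
    proof -
      obtain s v t where zz: "z = (s, v, t)" by (rule prod_cases3)
      show ?thesis
      proof (cases "v = 0")
        case True then show ?thesis using side_on zz by (simp only: not_False_eq_True)
      next
        case False
        then have "s = 0" using that zz by simp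
        then show ?thesis using False zz side_off psi_boundary[of "(s * v, b t + v, t)"]
          by (simp only: mult_zero_left fst_conv simp_thms)
      qed
    qed
    show "\<exists>D. (\<sigma> has_derivative D) (at z) \<and> D (?G z) = ?G' (\<sigma> z)"
      if "z \<in> ?\<Omega>" "z \<notin> ?B" for z
    proof -
      obtain x y t where z: "z = (x, y, t)" by (rule prod_cases3)
      define v where "v = y - b t"
      have y: "y = b t + v" by (simp add: v_def)
      have x: "x \<noteq> 0" and v: "v \<noteq> 0" using that z by (auto simp: v_def)
      define D :: "c3 \<Rightarrow> c3" where "D = (\<lambda>d.
         ((fst d * v - x * (fst (snd d) - b' t * snd (snd d))) / (v * v),
         fst (snd d) - b' t * snd (snd d), snd (snd d)))"
      have "(\<sigma> has_derivative D) (at z)"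
        unfolding \<sigma>_def D_def
        by (rule has_derivative_eq_rhs,
            (rule has_derivative_Pair has_derivative_fst has_derivative_snd
              has_derivative_ident has_derivative_divide' has_derivative_diff b_has_derivative
             | use x v z in \<open>simp add: v_def\<close>)+)
      moreover have "D (?G z) = ?G' (\<sigma> z)"
        using x v unfolding D_def \<sigma>_def side_pole_def z y by (simp add: field_simps)
      ultimately show ?thesis by blast
    qed
  qed
  moreover have "holo3_on side_pole UNIV"
    unfolding side_pole_def case_prod_beta
    by (intro holo3_intros holo3_on_comp3[OF p_holo] holo3_on_comp3[OF holo(1)]
        holo3_on_comp3[OF holo(2)] holo3_on_entire[OF b_holomorphic] holo3_on_entire[OF holo(3)]
        UNIV_I)+
  moreover have "holo3_on (\<lambda>(s, v, t). p (s * v, b t + v, t) - side_pole (s, v, t)) UNIV"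
    unfolding side_pole_def case_prod_beta fst_conv snd_conv
    by (intro holo3_intros holo3_on_comp3[OF p_holo] holo3_on_comp3[OF holo(1)]
        holo3_on_comp3[OF holo(2)] holo3_on_entire[OF b_holomorphic] holo3_on_entire[OF holo(3)]
        UNIV_I)+
  ultimately show ?thesis unfolding crossing_chart_def by blast
qed

text \<open>
  Along \<open>v = 0\<close> the second chart sees the first one through \<open>w = 1 / s\<close>; its pole there is the pole
  of the first chart.
\<close>

lemma side_first_component:
  assumes "s \<noteq> 0"
  shows "p (s * v, b t + v, t) - side_pole (s, v, t) = - s * main_pole (s * v, 1 / s, t)"
  using assms unfolding side_pole_def main_pole_def by (simp add: field_simps)

lemma main_accessible:
  assumes "accessible_in_chart I (UNIV, \<psi>\<^sub>1) (u, w, t)"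
  shows "u = 0 \<and> main_pole (0, w, t) = 0"
  using polar_accessible[OF main_chart assms] by auto

lemma side_accessible:
  assumes "accessible_in_chart I (UNIV, \<psi>\<^sub>2) (s, v, t)"
  shows "(s = 0 \<and> v \<noteq> 0 \<and> \<kappa> (0, b t + v, t) = 0 \<and> \<psi>\<^sub>2 (s, v, t) = \<psi> (0, b t + v, t)) \<or>
    (s \<noteq> 0 \<and> v = 0 \<and> main_pole (0, 1 / s, t) = 0 \<and> \<psi>\<^sub>2 (s, v, t) = \<psi>\<^sub>1 (0, 1 / s, t) \<and>
     \<not> regular_in_chart I (UNIV, \<psi>\<^sub>2) (s, v, t))"
proof -
  have "s = 0 \<and> v \<noteq> 0 \<and> side_pole (s, v, t) = 0 \<or>
      s \<noteq> 0 \<and> v = 0 \<and> p (s * v, b t + v, t) - side_pole (s, v, t) = 0 \<and>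
      \<not> regular_in_chart I (UNIV, \<psi>\<^sub>2) (s, v, t)"
    using crossing_accessible[OF side_chart assms] by (simp only: prod.case)
  then show ?thesis
  proof (elim disjE conjE)
    assume "s = 0" "v \<noteq> 0" "side_pole (s, v, t) = 0"
    then show ?thesis using side_off[of v s t] by (simp add: side_pole_def)
  next
    assume A: "s \<noteq> 0" "v = 0" "p (s * v, b t + v, t) - side_pole (s, v, t) = 0"
      "\<not> regular_in_chart I (UNIV, \<psi>\<^sub>2) (s, v, t)"
    then have "main_pole (0, 1 / s, t) = 0"
      using side_first_component[OF A(1), of v t] by (metis mult_eq_0_iff mult_zero_right
          neg_equal_0_iff_equal)
    then show ?thesis using A overlap[OF A(1), of t] by blast
  qed
qed

lemma main_regular:
  assumes "holo3_on r UNIV" "\<And>z. main_pole z = fst z * r z"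
  shows "regular_in_chart I (UNIV, \<psi>\<^sub>1) z"
  by (rule polar_regular[OF main_chart assms])

text \<open>
  If the first chart has become regular, so has the second one along the exceptional curve, away
  from the crossing with the old divisor.
\<close>

lemma side_regular:
  assumes r: "holo3_on r UNIV" "\<And>z. main_pole z = fst z * r z" and s: "s \<noteq> 0"
  shows "regular_in_chart I (UNIV, \<psi>\<^sub>2) (s, v, t)"
proof (rule crossing_regular[OF side_chart])
  let ?r = "\<lambda>z. - fst z * fst z * r (fst z * fst (snd z), 1 / fst z, snd (snd z))"
  show "holo3_on ?r {z. fst z \<noteq> 0}"
    by (intro holo3_on_mult holo3_on_minus holo3_on_comp3[OF r(1)] holo3_on_divide
        holo3_on_const holo3_on_fst holo3_on_snd holo3_on_thd) simp_all
  fix z :: c3 assume z: "fst z \<noteq> 0"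
  obtain s v t where zz: "z = (s, v, t)" by (rule prod_cases3)
  show "(\<lambda>(s, v, t). p (s * v, b t + v, t) - side_pole (s, v, t)) z = fst (snd z) * ?r z"
    using z side_first_component[of s v t] unfolding zz by (simp add: r(2))
qed (use s in simp)

text \<open>
  The old divisor \<open>s = 0\<close> still carries its pole, since \<open>\<kappa>\<close> does not vanish near the centre.  Hence
  \<open>\<psi>\<^sub>2\<close> never belongs to the phase space.
\<close>

lemma side_singular: "\<exists>z. \<not> regular_in_chart I (UNIV, \<psi>\<^sub>2) z"
proof (rule ccontr)
  assume "\<not> ?thesis"
  then have reg: "regular_in_chart I (UNIV, \<psi>\<^sub>2) z" for z by blast
  have "side_pole (0, v, t) = 0" for v t
    using crossing_regular_imp[OF side_chart reg, of "(0, v, t)"] by simp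
  then have "\<kappa> (0, b 0 + v, 0) = 0" for v unfolding side_pole_def by simp
  then have "\<kappa> (0, b 0, 0) = 0" by (metis add.right_neutral)
  then show False using nonzero by blast
qed

lemma centre_accessible:
  assumes "open V" "- {z. fst z = 0} \<subseteq> V" "(0, b t, t) \<in> V"
  shows "accessible_in_chart I (V, \<psi>) (0, b t, t)"
  by (rule polar_centre_accessible[OF polar holo(1) nonzero assms])

end

declare regular_in_chart.simps [simp del] accessible_in_chart.simps [simp del]
  field_in_chart.simps [simp del]

section \<open>Following a sequence of blow-ups\<close>

definition first_chart ::
  "(c3 \<Rightarrow> point) \<Rightarrow> (complex \<Rightarrow> complex) \<Rightarrow> (complex \<Rightarrow> complex) \<Rightarrow> c3 \<Rightarrow> point" where
  "first_chart \<psi> a b = (\<lambda>(u, w, t). if u = 0 then Near (\<psi> (a t, b t, t)) (ratio2 1 w)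
                   else \<psi> (a t + u, b t + u * w, t))"

definition second_chart ::
  "(c3 \<Rightarrow> point) \<Rightarrow> (complex \<Rightarrow> complex) \<Rightarrow> (complex \<Rightarrow> complex) \<Rightarrow> c3 \<Rightarrow> point" where
  "second_chart \<psi> a b = (\<lambda>(w, v, t). if v = 0 then Near (\<psi> (a t, b t, t)) (ratio2 w 1)
                   else \<psi> (a t + w * v, b t + v, t))"

text \<open>
  What a blow-up does to the charts that are already present.
\<close>

definition avoiding :: "point set \<Rightarrow> point chart \<Rightarrow> point chart" where
  "avoiding C = (\<lambda>(W, \<phi>). ({z \<in> W. \<phi> z \<notin> C}, \<phi>))"

lemma avoiding_avoiding: "avoiding C ` avoiding C' ` T = avoiding (C \<union> C') ` T"
  by (auto simp: avoiding_def image_iff split: prod.splits intro!: bexI)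

lemma avoiding_id: "(\<And>z. \<phi> z \<notin> C) \<Longrightarrow> avoiding C (UNIV, \<phi>) = (UNIV, \<phi>)"
  by (simp add: avoiding_def)

lemma blow_up_eq:
  "blow_up A (V, \<psi>) a b = avoiding (range (\<lambda>t. \<psi> (a t, b t, t))) ` A \<union>
     {({(u, w, t). (a t + u, b t + u * w, t) \<in> V}, first_chart \<psi> a b),
      ({(w, v, t). (a t + w * v, b t + v, t) \<in> V}, second_chart \<psi> a b)}"
proof -
  have "avoiding (range (\<lambda>t. \<psi> (a t, b t, t))) =
      (\<lambda>(W, \<phi>). ({z \<in> W. \<forall>t. \<phi> z \<noteq> \<psi> (a t, b t, t)}, \<phi>))"
    by (auto simp: avoiding_def fun_eq_iff)
  then show ?thesis by (simp add: first_chart_def second_chart_def)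
qed

text \<open>
  \<open>S\<close> collects the singularities that are still to be blown up.  Accessibility is tested on all
  triples, which makes the property stable under the removal of boundary points.
\<close>

fun tame :: "complex \<Rightarrow> point set \<Rightarrow> point chart \<Rightarrow> bool" where
  "tame I S (V, \<psi>) \<longleftrightarrow> (\<exists>B G. chart_field I \<psi> B G \<and> - B \<subseteq> V) \<and>
     (\<forall>z\<in>V. accessible_in_chart I (UNIV, \<psi>) z \<longrightarrow> \<psi> z \<in> S)"

text \<open>
  The negation of the condition for being a chart of the phase space.  Once a chart is unfinished, it
  remains so, since a removed point is never restored.
\<close>

fun unfinished :: "complex \<Rightarrow> point chart \<Rightarrow> bool" where
  "unfinished I (V, \<psi>) \<longleftrightarrow> V \<noteq> UNIV \<or> (\<exists>z. \<not> regular_in_chart I (UNIV, \<psi>) z)"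

text \<open>
  The invariant of the resolution: \<open>S\<close> contains all accessible singularities, and \<open>T\<close> contains every
  chart that may still belong to the phase space.
\<close>

definition stage ::
  "complex \<Rightarrow> (complex \<Rightarrow> point) list \<Rightarrow> point chart set \<Rightarrow> point set \<Rightarrow> point chart set \<Rightarrow> bool" where
  "stage I cs A S T \<longleftrightarrow> blow_up_sequence I cs A \<and> (\<forall>c\<in>A. tame I S c) \<and> T \<subseteq> A \<and>
     (\<forall>c\<in>A - T. unfinished I c)"

lemma tame_avoiding:
  assumes t: "tame I (C \<union> S) c" and C: "C \<inter> range original = {}" and S: "S \<subseteq> S'"
  shows "tame I S' (avoiding C c)"
proof (cases c)
  case (Pair W \<phi>)
  obtain B G where B: "chart_field I \<phi> B G" "- B \<subseteq> W" using t Pair by auto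
  have "- B \<subseteq> {z \<in> W. \<phi> z \<notin> C}"
  proof
    fix z assume "z \<in> - B"
    then have "z \<in> W" "\<phi> z \<in> range original" using B(2) chart_field_boundary[OF B(1), of z] by blast+
    then show "z \<in> {z \<in> W. \<phi> z \<notin> C}" using C by blast
  qed
  moreover have "\<phi> z \<in> S'"
    if "z \<in> W" "\<phi> z \<notin> C" "accessible_in_chart I (UNIV, \<phi>) z" for z
    using t[unfolded Pair tame.simps] that S by blast
  ultimately show ?thesis
    unfolding Pair avoiding_def prod.case tame.simps using B(1) by blast
qed

lemma unfinished_avoiding: "unfinished I c \<Longrightarrow> unfinished I (avoiding C c)"
  by (cases c) (auto simp: avoiding_def simp del: split_paired_Ex split_paired_All)

lemma accessible_singularity_tame:
  assumes "\<forall>c\<in>A. tame I S c" "accessible_singularity I A P"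
  shows "P \<in> S"
proof -
  obtain V \<psi> z where c: "(V, \<psi>) \<in> A" "z \<in> V" "\<psi> z = P" "accessible_in_chart I (V, \<psi>) z"
    using assms(2) unfolding accessible_singularity_def by blast
  have t: "tame I S (V, \<psi>)" using assms(1) c(1) by blast
  then obtain B G where "chart_field I \<psi> B G" "- B \<subseteq> V" unfolding tame.simps by blast
  then have "accessible_in_chart I (UNIV, \<psi>) z"
    using accessible_in_larger_chart c(4) by blast
  then show ?thesis using t c(2,3) unfolding tame.simps by blast
qed

text \<open>
  The centre \<open>c\<close> disappears from the set of singularities, at the price of those that the two
  new charts contribute; \<open>L\<close> lists the new charts to be kept.
\<close>

lemma stage_step:
  assumes st: "stage I cs A (range c \<union> S) T"
    and c: "c = (\<lambda>t. \<psi> (a t, b t, t))" and V: "(V, \<psi>) \<in> A"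
    and ab: "a holomorphic_on UNIV" "b holomorphic_on UNIV"
    and acc: "\<And>t. accessible_in_chart I (V, \<psi>) (a t, b t, t)"
    and V1: "V\<^sub>1 = {(u, w, t). (a t + u, b t + u * w, t) \<in> V}"
    and V2: "V\<^sub>2 = {(w, v, t). (a t + w * v, b t + v, t) \<in> V}"
    and tame: "tame I S' (V\<^sub>1, first_chart \<psi> a b)" "tame I S' (V\<^sub>2, second_chart \<psi> a b)"
    and S: "S \<subseteq> S'"
    and L: "L \<subseteq> {(V\<^sub>1, first_chart \<psi> a b), (V\<^sub>2, second_chart \<psi> a b)}"
    and unf: "\<And>d. d \<in> {(V\<^sub>1, first_chart \<psi> a b), (V\<^sub>2, second_chart \<psi> a b)} - L \<Longrightarrow>
      unfinished I d"
  shows "stage I (cs @ [c]) (blow_up A (V, \<psi>) a b) S' (avoiding (range c) ` T \<union> L)"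
proof -
  have in_V: "(a t, b t, t) \<in> V" and bd: "c t \<notin> range original" for t
    using acc[of t] unfolding accessible_in_chart.simps c by blast+
  have "accessible_singularity I A (\<psi> (a t, b t, t))" for t
    unfolding accessible_singularity_def using V in_V acc by blast
  then have seq: "blow_up_sequence I (cs @ [c]) (blow_up A (V, \<psi>) a b)"
    unfolding c using st[unfolded stage_def] V ab in_V by (intro blow_up_sequence.step) auto
  have eq: "blow_up A (V, \<psi>) a b = avoiding (range c) ` A \<union>
      {(V\<^sub>1, first_chart \<psi> a b), (V\<^sub>2, second_chart \<psi> a b)}"
    unfolding blow_up_eq V1 V2 c ..
  have "tame I S' (avoiding (range c) d)" if "d \<in> A" for d
    using st that bd unfolding stage_def by (intro tame_avoiding[OF _ _ S]) auto
  then have "\<forall>d\<in>blow_up A (V, \<psi>) a b. tame I S' d"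
    unfolding eq using tame by blast
  moreover have "avoiding (range c) ` T \<union> L \<subseteq> blow_up A (V, \<psi>) a b"
    unfolding eq using L st unfolding stage_def by blast
  moreover have "unfinished I d"
    if d: "d \<in> blow_up A (V, \<psi>) a b - (avoiding (range c) ` T \<union> L)" for d
  proof (cases "d \<in> avoiding (range c) ` A")
    case True
    then obtain d' where d': "d' \<in> A" "d = avoiding (range c) d'" by blast
    then have "d' \<in> A - T" using d by blast
    then show ?thesis
      using st d'(2) unfinished_avoiding unfolding stage_def by blast
  next
    case False
    then show ?thesis using d unf unfolding eq by blast
  qed
  ultimately show ?thesis using seq unfolding stage_def by blast
qed

lemma stage_phase_space:
  assumes "stage I cs A S T"
  shows "phase_space I A = {c \<in> T. \<not> unfinished I c}"
proof -
  have "(V, \<psi>) \<in> phase_space I A \<longleftrightarrow> (V, \<psi>) \<in> A \<and> \<not> unfinished I (V, \<psi>)" for V \<psi>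
    unfolding phase_space_def unfinished.simps by blast
  then have "c \<in> phase_space I A \<longleftrightarrow> c \<in> A \<and> \<not> unfinished I c" for c
    by (metis surj_pair)
  then show ?thesis using assms unfolding stage_def by blast
qed

lemma stage_resolution: "stage I cs A {} T \<Longrightarrow> resolution I cs A"
  unfolding stage_def resolution_def using accessible_singularity_tame by blast

lemma ratio2_inverse: "s \<noteq> 0 \<Longrightarrow> ratio2 s 1 = ratio2 1 (1 / s)"
  by (auto simp: ratio2_eq_iff intro!: exI[of _ "1 / s"])

lemma polar_blow_up_charts:
  assumes "polar_chart I \<psi> p (\<lambda>(x, y, t). (y - b t) * \<kappa> (x, y, t) + x * h (x, y, t))"
    "holo3_on \<kappa> UNIV" "holo3_on h UNIV" "b' holomorphic_on UNIV"
    "\<And>t. (b has_field_derivative b' t) (at t)" "\<And>t. \<kappa> (0, b t, t) \<noteq> 0"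
  shows "polar_blow_up I \<psi> (first_chart \<psi> (\<lambda>_. 0) b) (second_chart \<psi> (\<lambda>_. 0) b) p \<kappa> h b b'"
  by (unfold_locales)
    (use assms Near_not_original in \<open>auto simp: first_chart_def second_chart_def ratio2_inverse\<close>)

lemma polar_blow_up_swapped_charts:
  assumes "polar_chart I (\<psi> \<circ> swap) p (\<lambda>(x, y, t). y * \<kappa> (x, y, t) + x * h (x, y, t))"
    "holo3_on \<kappa> UNIV" "holo3_on h UNIV" "\<And>t. \<kappa> (0, 0, t) \<noteq> 0"
  shows "polar_blow_up I (\<psi> \<circ> swap) (second_chart \<psi> (\<lambda>_. 0) (\<lambda>_. 0) \<circ> swap)
    (first_chart \<psi> (\<lambda>_. 0) (\<lambda>_. 0) \<circ> swap) p \<kappa> h (\<lambda>_. 0) (\<lambda>_. 0)"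
  by (unfold_locales)
    (use assms Near_not_original in
      \<open>auto simp: first_chart_def second_chart_def ratio2_inverse mult.commute\<close>)

context polar_blow_up
begin

lemma tame_main:
  assumes "\<And>w t. main_pole (0, w, t) = 0 \<Longrightarrow> \<psi>\<^sub>1 (0, w, t) \<in> S"
  shows "tame I S (UNIV, \<psi>\<^sub>1)"
proof -
  have "\<psi>\<^sub>1 z \<in> S" if "accessible_in_chart I (UNIV, \<psi>\<^sub>1) z" for z
  proof -
    obtain u w t where z: "z = (u, w, t)" by (rule prod_cases3)
    show ?thesis using main_accessible[OF that[unfolded z]] assms unfolding z by blast
  qed
  moreover have "\<exists>B G. chart_field I \<psi>\<^sub>1 B G \<and> - B \<subseteq> UNIV"
    using main_chart unfolding polar_chart_def by blast
  ultimately show ?thesis unfolding tame.simps by blast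
qed

text \<open>
  The singularities of the second chart are those of the old divisor other than the centre, and those
  of the first chart.
\<close>

lemma tame_side:
  assumes V: "- {z. fst z = 0} \<subseteq> V"
    and old: "\<And>y t. (0, y, t) \<in> V \<Longrightarrow> y \<noteq> b t \<Longrightarrow> \<kappa> (0, y, t) = 0 \<Longrightarrow> \<psi> (0, y, t) \<in> S"
    and new: "\<And>s t. s \<noteq> 0 \<Longrightarrow> main_pole (0, 1 / s, t) = 0 \<Longrightarrow>
      \<psi>\<^sub>1 (0, 1 / s, t) \<in> S \<or> regular_in_chart I (UNIV, \<psi>\<^sub>2) (s, 0, t)"
  shows "tame I S ({(s, v, t). (s * v, b t + v, t) \<in> V}, \<psi>\<^sub>2)"
proof -
  let ?V = "{(s, v, t). (s * v, b t + v, t) \<in> V}"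
  have "\<psi>\<^sub>2 z \<in> S" if zV: "z \<in> ?V" and acc: "accessible_in_chart I (UNIV, \<psi>\<^sub>2) z" for z
  proof -
    obtain s v t where z: "z = (s, v, t)" by (rule prod_cases3)
    have V: "(s * v, b t + v, t) \<in> V" using zV z by simp
    from side_accessible[OF acc[unfolded z]] show ?thesis
    proof (elim disjE conjE)
      assume A: "s = 0" "v \<noteq> 0" "\<kappa> (0, b t + v, t) = 0" "\<psi>\<^sub>2 (s, v, t) = \<psi> (0, b t + v, t)"
      have "(0, b t + v, t) \<in> V" using V A(1) by simp
      then show ?thesis using old A unfolding z by simp
    next
      assume A: "s \<noteq> 0" "v = 0" "main_pole (0, 1 / s, t) = 0" "\<psi>\<^sub>2 (s, v, t) = \<psi>\<^sub>1 (0, 1 / s, t)"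
        "\<not> regular_in_chart I (UNIV, \<psi>\<^sub>2) (s, v, t)"
      show ?thesis using new[OF A(1,3)] A(2,4,5) unfolding z by metis
    qed
  qed
  moreover have "- {z. fst z * fst (snd z) = 0} \<subseteq> ?V"
  proof
    fix z :: c3 assume A: "z \<in> - {z. fst z * fst (snd z) = 0}"
    obtain s v t where z: "z = (s, v, t)" by (rule prod_cases3)
    have "(s * v, b t + v, t) \<in> - {z. fst z = 0}" using A unfolding z by simp
    then have "(s * v, b t + v, t) \<in> V" using V by blast
    then show "z \<in> ?V" unfolding z by simp
  qed
  then have "\<exists>B G. chart_field I \<psi>\<^sub>2 B G \<and> - B \<subseteq> ?V"
    using side_chart unfolding crossing_chart_def by blast
  ultimately show ?thesis unfolding tame.simps by blast
qed

lemma unfinished_side: "unfinished I (V, \<psi>\<^sub>2)"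
  using side_singular unfolding unfinished.simps by blast

lemma unfinished_old: "unfinished I (UNIV, \<psi>)"
proof -
  have "open (UNIV :: c3 set)" by simp
  from centre_accessible[OF this subset_UNIV UNIV_I]
  show ?thesis unfolding unfinished.simps accessible_in_chart.simps by blast
qed

end

lemma tame_swap:
  assumes "tame I S (swap -` V, \<psi> \<circ> swap)"
  shows "tame I S (V, \<psi>)"
proof -
  obtain B G where B: "chart_field I (\<psi> \<circ> swap) B G" "- B \<subseteq> swap -` V"
    using assms unfolding tame.simps by blast
  have cf: "chart_field I \<psi> (swap -` B) (\<lambda>z. swap (G (swap z)))"
    using chart_field_swap[OF B(1)] unfolding comp_swap_swap .
  have "- (swap -` B) \<subseteq> V"
  proof
    fix z assume "z \<in> - (swap -` B)"
    then have "swap z \<in> swap -` V" using B(2) by blast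
    then show "z \<in> V" by simp
  qed
  moreover have "\<psi> z \<in> S" if z: "z \<in> V" "accessible_in_chart I (UNIV, \<psi>) z" for z
  proof -
    have "accessible_in_chart I (UNIV, \<psi> \<circ> swap) (swap z)" "swap z \<in> swap -` V"
      using z accessible_swap[OF cf] by simp_all
    then have "(\<psi> \<circ> swap) (swap z) \<in> S" using assms unfolding tame.simps by blast
    then show ?thesis by simp
  qed
  ultimately show ?thesis using cf unfolding tame.simps by blast
qed

lemma unfinished_swap:
  assumes "tame I S (V, \<psi>)" "unfinished I (swap -` V, \<psi> \<circ> swap)"
  shows "unfinished I (V, \<psi>)"
proof (cases "V = UNIV")
  case True
  obtain B G where cf: "chart_field I \<psi> B G" using assms unfolding tame.simps by blast
  obtain z where "\<not> regular_in_chart I (UNIV, \<psi> \<circ> swap) z"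
    using assms(2) True unfolding unfinished.simps by auto
  then show ?thesis using regular_swap[OF cf] unfolding unfinished.simps by blast
qed simp

context polar_blow_up
begin

text \<open>
  The first chart is either regular, or the zeros of its pole are among the remaining singularities.
\<close>

lemma stage_blow_up:
  assumes psi1: "\<psi>\<^sub>1 = first_chart \<psi> (\<lambda>_. 0) b" and psi2: "\<psi>\<^sub>2 = second_chart \<psi> (\<lambda>_. 0) b"
    and c: "c = (\<lambda>t. \<psi> (0, b t, t))"
    and st: "stage I cs A (range c \<union> S) T" and A: "(V, \<psi>) \<in> A"
    and V: "open V" "- {z. fst z = 0} \<subseteq> V" "\<And>u w t. (u, b t + u * w, t) \<in> V"
    and S: "S \<subseteq> S'"
    and old: "\<And>y t. (0, y, t) \<in> V \<Longrightarrow> y \<noteq> b t \<Longrightarrow> \<kappa> (0, y, t) = 0 \<Longrightarrow> \<psi> (0, y, t) \<in> S'"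
    and new: "(\<exists>r. holo3_on r UNIV \<and> (\<forall>z. main_pole z = fst z * r z)) \<or>
      (\<forall>w t. main_pole (0, w, t) = 0 \<longrightarrow> \<psi>\<^sub>1 (0, w, t) \<in> S')"
    and L: "L = {(UNIV, \<psi>\<^sub>1)} \<or> L = {} \<and> unfinished I (UNIV, \<psi>\<^sub>1)"
  shows "\<exists>A'. stage I (cs @ [c]) A' S' (avoiding (range c) ` T \<union> L) \<and> (UNIV, \<psi>\<^sub>1) \<in> A'"
proof -
  define V2 where "V2 = {(s, v, t). (s * v, b t + v, t) \<in> V}"
  have V1: "(UNIV :: c3 set) = {(u, w, t). ((\<lambda>_. 0) t + u, b t + u * w, t) \<in> V}"
    using V(3) by auto
  have V2: "V2 = {(w, v, t). ((\<lambda>_. 0) t + w * v, b t + v, t) \<in> V}"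
    unfolding V2_def by simp
  have cV: "(0, b t, t) \<in> V" for t using V(3)[of 0 t 0] by simp
  have cf: "\<exists>B G. chart_field I \<psi>\<^sub>1 B G \<and> - B \<subseteq> UNIV"
    using main_chart unfolding polar_chart_def by blast
  have t: "tame I S' (UNIV, \<psi>\<^sub>1) \<and> tame I S' (V2, \<psi>\<^sub>2)"
    using new
  proof
    assume "\<exists>r. holo3_on r UNIV \<and> (\<forall>z. main_pole z = fst z * r z)"
    then obtain r where r: "holo3_on r UNIV" "\<And>z. main_pole z = fst z * r z" by blast
    have "\<not> accessible_in_chart I (UNIV, \<psi>\<^sub>1) z" for z
      using main_regular[OF r, of z] unfolding accessible_in_chart.simps by blast
    then have "tame I S' (UNIV, \<psi>\<^sub>1)" using cf unfolding tame.simps by blast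
    moreover have "tame I S' (V2, \<psi>\<^sub>2)"
      unfolding V2_def by (rule tame_side[OF V(2) old]) (use side_regular[OF r] in blast)+
    ultimately show ?thesis by blast
  next
    assume z: "\<forall>w t. main_pole (0, w, t) = 0 \<longrightarrow> \<psi>\<^sub>1 (0, w, t) \<in> S'"
    have "tame I S' (UNIV, \<psi>\<^sub>1)" by (rule tame_main) (use z in blast)
    moreover have "tame I S' (V2, \<psi>\<^sub>2)"
      unfolding V2_def by (rule tame_side[OF V(2) old]) (use z in blast)+
    ultimately show ?thesis by blast
  qed
  have "stage I (cs @ [c]) (blow_up A (V, \<psi>) (\<lambda>_. 0) b) S' (avoiding (range c) ` T \<union> L)"
  proof (rule stage_step[OF st _ A _ b_holomorphic _ V1 V2 _ _ S])
    show "c = (\<lambda>t. \<psi> ((\<lambda>_. 0) t, b t, t))" unfolding c ..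
    show "(\<lambda>_. 0) holomorphic_on UNIV" by simp
    show "accessible_in_chart I (V, \<psi>) ((\<lambda>_. 0) t, b t, t)" for t
      using centre_accessible[OF V(1,2) cV] by simp
    show "tame I S' (UNIV, first_chart \<psi> (\<lambda>_. 0) b)" "tame I S' (V2, second_chart \<psi> (\<lambda>_. 0) b)"
      using t unfolding psi1 psi2 by blast+
    show "L \<subseteq> {(UNIV, first_chart \<psi> (\<lambda>_. 0) b), (V2, second_chart \<psi> (\<lambda>_. 0) b)}"
      using L unfolding psi1 by blast
    show "unfinished I d"
      if "d \<in> {(UNIV, first_chart \<psi> (\<lambda>_. 0) b), (V2, second_chart \<psi> (\<lambda>_. 0) b)} - L" for d
      using that L unfinished_side[of V2] unfolding psi1 psi2 by blast
  qed
  moreover have "(UNIV, \<psi>\<^sub>1) \<in> blow_up A (V, \<psi>) (\<lambda>_. 0) b"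
    unfolding blow_up_eq V1[symmetric] psi1 by blast
  ultimately show ?thesis by blast
qed

end

text \<open>
  The same step when the boundary is the divisor of the second coordinate, so that the roles of the two
  charts of the blow-up are exchanged.
\<close>

lemma stage_blow_up_swapped:
  assumes pb: "polar_blow_up I (\<psi> \<circ> swap) (second_chart \<psi> (\<lambda>_. 0) (\<lambda>_. 0) \<circ> swap)
      (first_chart \<psi> (\<lambda>_. 0) (\<lambda>_. 0) \<circ> swap) p \<kappa> h (\<lambda>_. 0) (\<lambda>_. 0)"
    and psi1: "\<psi>\<^sub>1 = second_chart \<psi> (\<lambda>_. 0) (\<lambda>_. 0)"
    and c: "c = (\<lambda>t. \<psi> (0, 0, t))"
    and st: "stage I cs A (range c \<union> S) T" and A: "(UNIV, \<psi>) \<in> A"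
    and S: "S \<subseteq> S'"
    and old: "\<And>y t. y \<noteq> 0 \<Longrightarrow> \<kappa> (0, y, t) = 0 \<Longrightarrow> \<psi> (y, 0, t) \<in> S'"
    and new: "(\<exists>r. holo3_on r UNIV \<and>
        (\<forall>z. polar_blow_up.main_pole p \<kappa> h (\<lambda>_. 0) (\<lambda>_. 0) z = fst z * r z)) \<or>
      (\<forall>w t. polar_blow_up.main_pole p \<kappa> h (\<lambda>_. 0) (\<lambda>_. 0) (0, w, t) = 0 \<longrightarrow>
        \<psi>\<^sub>1 (w, 0, t) \<in> S')"
    and L: "L = {(UNIV, \<psi>\<^sub>1)} \<or> L = {} \<and> unfinished I (UNIV, \<psi>\<^sub>1)"
  shows "\<exists>A'. stage I (cs @ [c]) A' S' (avoiding (range c) ` T \<union> L) \<and> (UNIV, \<psi>\<^sub>1) \<in> A'"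
proof -
  interpret polar_blow_up I "\<psi> \<circ> swap" "second_chart \<psi> (\<lambda>_. 0) (\<lambda>_. 0) \<circ> swap"
    "first_chart \<psi> (\<lambda>_. 0) (\<lambda>_. 0) \<circ> swap" p \<kappa> h "\<lambda>_. 0" "\<lambda>_. 0" by (rule pb)
  let ?main = "second_chart \<psi> (\<lambda>_. 0) (\<lambda>_. 0)" and ?side = "first_chart \<psi> (\<lambda>_. 0) (\<lambda>_. 0)"
  have cf: "\<exists>B G. chart_field I (?main \<circ> swap) B G \<and> - B \<subseteq> UNIV"
    using main_chart unfolding polar_chart_def by blast
  have old': "(\<psi> \<circ> swap) (0, y, t) \<in> S'" if "y \<noteq> 0" "\<kappa> (0, y, t) = 0" for y t
    using old that by simp
  have t: "tame I S' (UNIV, ?main \<circ> swap) \<and>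
      tame I S' ({(s, v, t). (s * v, 0 + v, t) \<in> (UNIV :: c3 set)}, ?side \<circ> swap)"
    using new
  proof
    assume "\<exists>r. holo3_on r UNIV \<and> (\<forall>z. main_pole z = fst z * r z)"
    then obtain r where r: "holo3_on r UNIV" "\<And>z. main_pole z = fst z * r z" by blast
    have "\<not> accessible_in_chart I (UNIV, ?main \<circ> swap) z" for z
      using main_regular[OF r, of z] unfolding accessible_in_chart.simps by blast
    then have "tame I S' (UNIV, ?main \<circ> swap)" using cf unfolding tame.simps by blast
    moreover have "tame I S' ({(s, v, t). (s * v, 0 + v, t) \<in> (UNIV :: c3 set)}, ?side \<circ> swap)"
      by (rule tame_side[OF subset_UNIV]) (use side_regular[OF r] old' in blast)+
    ultimately show ?thesis by blast
  next
    assume z: "\<forall>w t. main_pole (0, w, t) = 0 \<longrightarrow> \<psi>\<^sub>1 (w, 0, t) \<in> S'"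
    have z': "\<forall>w t. main_pole (0, w, t) = 0 \<longrightarrow> (?main \<circ> swap) (0, w, t) \<in> S'"
      using z unfolding psi1 by simp
    have "tame I S' (UNIV, ?main \<circ> swap)" by (rule tame_main) (use z' in blast)
    moreover have "tame I S' ({(s, v, t). (s * v, 0 + v, t) \<in> (UNIV :: c3 set)}, ?side \<circ> swap)"
      by (rule tame_side[OF subset_UNIV]) (use z' old' in blast)+
    ultimately show ?thesis by blast
  qed
  have UN: "{(s, v, t). (s * v, 0 + v, t) \<in> (UNIV :: c3 set)} = UNIV" by auto
  have main: "tame I S' (UNIV, ?main)"
    by (rule tame_swap) (unfold vimage_UNIV, rule conjunct1[OF t])
  have side: "tame I S' (UNIV, ?side)"
    by (rule tame_swap) (unfold vimage_UNIV, rule conjunct2[OF t, unfolded UN])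
  have unf: "unfinished I (UNIV, ?side)"
    using unfinished_swap[OF side] unfinished_side by simp
  have acc: "accessible_in_chart I (UNIV, \<psi>) (0, 0, t)" for t
  proof -
    have "accessible_in_chart I (UNIV, \<psi> \<circ> swap) (0, 0, t)"
      using centre_accessible[of UNIV t] by simp
    moreover obtain B G where "chart_field I (\<psi> \<circ> swap) B G"
      using polar unfolding polar_chart_def by blast
    ultimately show ?thesis
      using accessible_swap_imp[of I "\<psi> \<circ> swap" B G "(0, 0, t)"] unfolding comp_swap_swap
      by simp
  qed
  have "stage I (cs @ [c]) (blow_up A (UNIV, \<psi>) (\<lambda>_. 0) (\<lambda>_. 0)) S'
      (avoiding (range c) ` T \<union> L)"
  proof (rule stage_step[OF st _ A, of "\<lambda>_. 0" "\<lambda>_. 0" UNIV UNIV])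
    show "accessible_in_chart I (UNIV, \<psi>) ((\<lambda>_. 0) t, (\<lambda>_. 0) t, t)" for t
      using acc by simp
    show "L \<subseteq> {(UNIV, ?side), (UNIV, ?main)}" using L psi1 by blast
    show "unfinished I d" if "d \<in> {(UNIV, ?side), (UNIV, ?main)} - L" for d
      using that L unf unfolding psi1 by blast
    show "(UNIV :: c3 set) = {(u, w, t). (0 + u, 0 + u * w, t) \<in> UNIV}"
      "(UNIV :: c3 set) = {(w, v, t). (0 + w * v, 0 + v, t) \<in> UNIV}" by auto
    show "c = (\<lambda>t. \<psi> (0, 0, t))" by (rule c)
    show "tame I S' (UNIV, ?side)" "tame I S' (UNIV, ?main)" "S \<subseteq> S'" by (fact side main S)+
  qed simp_all
  moreover have "{(w, v, t). (0 + w * v, 0 + v, t) \<in> (UNIV :: c3 set)} = UNIV" by auto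
  then have "(UNIV, \<psi>\<^sub>1) \<in> blow_up A (UNIV, \<psi>) (\<lambda>_. 0) (\<lambda>_. 0)"
    unfolding blow_up_eq psi1 by simp
  ultimately show ?thesis by blast
qed

section \<open>The system near the line at infinity\<close>

text \<open>
  The factor of the infinitely near centres that depends on \<open>t\<close>.  The inhomogeneity of the system is
  \<open>- 2 g\<close>.
\<close>

definition g :: "complex \<Rightarrow> complex \<Rightarrow> complex" where
  "g I t = I / 4 * exp (- 6 * t)"

lemma g_has_field_derivative: "(g I has_field_derivative - 6 * g I t) (at t)"
  unfolding g_def by (auto intro!: derivative_eq_intros)

lemma g_holomorphic: "g I holomorphic_on UNIV"
  using g_has_field_derivative by (auto simp: holomorphic_on_def field_differentiable_def)

lemma holo3_on_g: "holo3_on f S \<Longrightarrow> holo3_on (\<lambda>z. g I (f z)) S"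
  by (rule holo3_on_entire[OF g_holomorphic])

lemma system_field_g:
  "system_field I (x, y, t) = (x\<^sup>2 - x * y - 2 * x, y\<^sup>2 - 3 * x * y - 2 * y - 2 * g I t, 1)"
  by (simp add: g_def)

text \<open>
  The charts at infinity, with \<open>X = 1 / x, Y = y / x\<close> in the first and \<open>Z = x / y, X = 1 / y\<close> in the
  second.
\<close>

definition affine_x :: "c3 \<Rightarrow> point" where
  "affine_x = (\<lambda>(X, Y, t). Proper (ratio3 X 1 Y) t)"

definition affine_y :: "c3 \<Rightarrow> point" where
  "affine_y = (\<lambda>(Z, X, t). Proper (ratio3 X Z 1) t)"

lemma polar_affine_x:
  "polar_chart I affine_x (\<lambda>(x, y, t). - 1 + y + 2 * x)
     (\<lambda>(x, y, t). 2 * y\<^sup>2 - 4 * y - 2 * g I t * x\<^sup>2)"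
proof -
  let ?B = "{z :: c3. fst z = 0}" and ?\<Omega> = "{z :: c3. fst z \<noteq> 0}"
  let ?G = "\<lambda>z. ((\<lambda>(x, y, t). - 1 + y + 2 * x) z,
     (\<lambda>(x, y, t). 2 * y\<^sup>2 - 4 * y - 2 * g I t * x\<^sup>2) z / fst z, 1)"
  define \<sigma> :: "c3 \<Rightarrow> c3" where "\<sigma> = (\<lambda>z. (1 / fst z, fst (snd z) / fst z, snd (snd z)))"
  have op: "open ?\<Omega>" by (intro open_Collect_neq continuous_intros)
  have "chart_field I affine_x ?B ?G"
  proof (rule chart_field_change[OF chart_field_original op, of \<sigma>])
    show "\<sigma> z \<notin> ?B" if "z \<in> ?\<Omega>" "z \<notin> {}" for z using that by (simp add: \<sigma>_def)
    show "\<exists>w\<in>?\<Omega> - {}. z = \<sigma> w" if z: "z \<notin> ?B" for z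
    proof -
      obtain x y t where zz: "z = (x, y, t)" by (rule prod_cases3)
      show ?thesis using z unfolding zz
        by (intro bexI[of _ "(1 / x, y / x, t)"]) (simp_all add: \<sigma>_def)
    qed
    show "affine_x (\<sigma> z) = original z" if "z \<in> ?\<Omega>" for z
      using that by (cases z rule: prod_cases3)
        (auto simp: \<sigma>_def affine_x_def ratio3_eq_iff)
    show "affine_x z \<notin> range original" if "z \<in> ?B" for z
      using that by (cases z rule: prod_cases3)
        (simp add: affine_x_def Proper_original_iff)
    show "\<exists>D. (\<sigma> has_derivative D) (at z) \<and> D (system_field I z) = ?G (\<sigma> z)"
      if "z \<in> ?\<Omega>" for z
    proof -
      obtain x y t where z: "z = (x, y, t)" by (rule prod_cases3)
      have x: "x \<noteq> 0" using that z by simp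
      define D :: "c3 \<Rightarrow> c3" where "D = (\<lambda>d. (- fst d / (x * x),
         (fst (snd d) * x - y * fst d) / (x * x), snd (snd d)))"
      have "(\<sigma> has_derivative D) (at z)"
        unfolding \<sigma>_def D_def
        by (rule has_derivative_eq_rhs,
            (rule has_derivative_Pair has_derivative_fst has_derivative_snd has_derivative_const
              has_derivative_ident has_derivative_divide' | use x z in simp)+)
      moreover have "D (system_field I z) = ?G (\<sigma> z)"
        using x unfolding D_def \<sigma>_def z system_field_g
        by (simp add: field_simps power2_eq_square)
      ultimately show ?thesis by blast
    qed
  qed
  moreover have "holo3_on (\<lambda>(x, y, t). - 1 + y + 2 * x) UNIV"
    "holo3_on (\<lambda>(x, y, t). 2 * y\<^sup>2 - 4 * y - 2 * g I t * x\<^sup>2) UNIV"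
    unfolding case_prod_beta by (intro holo3_intros holo3_on_g)+
  ultimately show ?thesis unfolding polar_chart_def by blast
qed

lemma polar_affine_y:
  "polar_chart I (affine_y \<circ> swap) (\<lambda>(x, y, t). - 1 + 3 * y + 2 * x + 2 * g I t * x\<^sup>2)
     (\<lambda>(x, y, t). 4 * y\<^sup>2 - 2 * y + 2 * g I t * x\<^sup>2 * y)"
proof -
  let ?B = "{z :: c3. fst z = 0}" and ?\<Omega> = "{z :: c3. fst (snd z) \<noteq> 0}"
  let ?G = "\<lambda>z. ((\<lambda>(x, y, t). - 1 + 3 * y + 2 * x + 2 * g I t * x\<^sup>2) z,
     (\<lambda>(x, y, t). 4 * y\<^sup>2 - 2 * y + 2 * g I t * x\<^sup>2 * y) z / fst z, 1)"
  define \<sigma> :: "c3 \<Rightarrow> c3" where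
    "\<sigma> = (\<lambda>z. (1 / fst (snd z), fst z / fst (snd z), snd (snd z)))"
  have op: "open ?\<Omega>" by (intro open_Collect_neq continuous_intros)
  have "chart_field I (affine_y \<circ> swap) ?B ?G"
  proof (rule chart_field_change[OF chart_field_original op, of \<sigma>])
    show "\<sigma> z \<notin> ?B" if "z \<in> ?\<Omega>" "z \<notin> {}" for z using that by (simp add: \<sigma>_def)
    show "\<exists>w\<in>?\<Omega> - {}. z = \<sigma> w" if z: "z \<notin> ?B" for z
    proof -
      obtain x y t where zz: "z = (x, y, t)" by (rule prod_cases3)
      show ?thesis using z unfolding zz
        by (intro bexI[of _ "(y / x, 1 / x, t)"]) (simp_all add: \<sigma>_def)
    qed
    show "(affine_y \<circ> swap) (\<sigma> z) = original z" if "z \<in> ?\<Omega>" for z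
      using that by (cases z rule: prod_cases3)
        (auto simp: \<sigma>_def affine_y_def ratio3_eq_iff)
    show "(affine_y \<circ> swap) z \<notin> range original" if "z \<in> ?B" for z
      using that by (cases z rule: prod_cases3)
        (simp add: affine_y_def Proper_original_iff)
    show "\<exists>D. (\<sigma> has_derivative D) (at z) \<and> D (system_field I z) = ?G (\<sigma> z)"
      if "z \<in> ?\<Omega>" for z
    proof -
      obtain x y t where z: "z = (x, y, t)" by (rule prod_cases3)
      have y: "y \<noteq> 0" using that z by simp
      define D :: "c3 \<Rightarrow> c3" where "D = (\<lambda>d. (- fst (snd d) / (y * y),
         (fst d * y - x * fst (snd d)) / (y * y), snd (snd d)))"
      have "(\<sigma> has_derivative D) (at z)"
        unfolding \<sigma>_def D_def
        by (rule has_derivative_eq_rhs,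
            (rule has_derivative_Pair has_derivative_fst has_derivative_snd has_derivative_const
              has_derivative_ident has_derivative_divide' | use y z in simp)+)
      moreover have "D (system_field I z) = ?G (\<sigma> z)"
        using y unfolding D_def \<sigma>_def z system_field_g
        by (simp add: field_simps power2_eq_square)
      ultimately show ?thesis by blast
    qed
  qed
  moreover have "holo3_on (\<lambda>(x, y, t). - 1 + 3 * y + 2 * x + 2 * g I t * x\<^sup>2) UNIV"
    "holo3_on (\<lambda>(x, y, t). 4 * y\<^sup>2 - 2 * y + 2 * g I t * x\<^sup>2 * y) UNIV"
    unfolding case_prod_beta by (intro holo3_intros holo3_on_g)+
  ultimately show ?thesis unfolding polar_chart_def by blast
qed

section \<open>Resolving the three singularities\<close>

text \<open>
  The tower over \<open>y / x = 1 + e\<close>, for \<open>e = - 1\<close> and \<open>e = 1\<close> simultaneously.  After \<open>n\<close> blow-ups the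
  chart \<open>branch_chart I e n\<close> carries the field \<open>(p, ((y - c) \<kappa> + x h) / x, 1)\<close>, where \<open>c, \<kappa>, h, p\<close> are
  the functions with index \<open>n\<close> below and \<open>c'\<close> is the derivative of \<open>c\<close>.
\<close>

fun branch_centre :: "complex \<Rightarrow> complex \<Rightarrow> nat \<Rightarrow> complex \<Rightarrow> complex" where
  "branch_centre I e 0 = (\<lambda>t. 1 + e)"
| "branch_centre I e (Suc 0) = (\<lambda>t. 0)"
| "branch_centre I e (Suc (Suc 0)) = (\<lambda>t. e * g I t)"
| "branch_centre I e (Suc (Suc (Suc n))) = (\<lambda>t. - 2 * g I t)"

fun branch_centre' :: "complex \<Rightarrow> complex \<Rightarrow> nat \<Rightarrow> complex \<Rightarrow> complex" where
  "branch_centre' I e 0 = (\<lambda>t. 0)"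
| "branch_centre' I e (Suc 0) = (\<lambda>t. 0)"
| "branch_centre' I e (Suc (Suc 0)) = (\<lambda>t. - 6 * e * g I t)"
| "branch_centre' I e (Suc (Suc (Suc n))) = (\<lambda>t. 12 * g I t)"

primrec branch_chart :: "complex \<Rightarrow> complex \<Rightarrow> nat \<Rightarrow> c3 \<Rightarrow> point" where
  "branch_chart I e 0 = affine_x"
| "branch_chart I e (Suc n) = first_chart (branch_chart I e n) (\<lambda>_. 0) (branch_centre I e n)"

definition branch_point :: "complex \<Rightarrow> complex \<Rightarrow> nat \<Rightarrow> complex \<Rightarrow> point" where
  "branch_point I e n = (\<lambda>t. branch_chart I e n (0, branch_centre I e n t, t))"

fun branch_p :: "complex \<Rightarrow> complex \<Rightarrow> nat \<Rightarrow> c3 \<Rightarrow> complex" where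
  "branch_p I e 0 = (\<lambda>(x, y, t). - 1 + y + 2 * x)"
| "branch_p I e (Suc 0) = (\<lambda>(x, y, t). e + 2 * x + x * y)"
| "branch_p I e (Suc (Suc 0)) = (\<lambda>(x, y, t). e + 2 * x + x\<^sup>2 * y)"
| "branch_p I e (Suc (Suc (Suc 0))) = (\<lambda>(x, y, t). e + 2 * x + e * g I t * x\<^sup>2 + x ^ 3 * y)"
| "branch_p I e (Suc (Suc (Suc (Suc n)))) =
     (\<lambda>(x, y, t). e + 2 * x + e * g I t * x\<^sup>2 - 2 * g I t * x ^ 3 + x ^ 4 * y)"

fun branch_\<kappa> :: "complex \<Rightarrow> nat \<Rightarrow> c3 \<Rightarrow> complex" where
  "branch_\<kappa> e 0 = (\<lambda>(x, y, t). 2 * (y - (1 - e)))"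
| "branch_\<kappa> e (Suc n) = (\<lambda>(x, y, t). (3 - of_nat n) * e)"

fun branch_h :: "complex \<Rightarrow> complex \<Rightarrow> nat \<Rightarrow> c3 \<Rightarrow> complex" where
  "branch_h I e 0 = (\<lambda>(x, y, t). - 2 * g I t * x)"
| "branch_h I e (Suc 0) = (\<lambda>(x, y, t). y\<^sup>2 - 2 * y - 2 * g I t)"
| "branch_h I e (Suc (Suc 0)) = (\<lambda>(x, y, t). - 4 * y)"
| "branch_h I e (Suc (Suc (Suc n))) = (\<lambda>(x, y, t). - 6 * y - e * g I t * x * y - x\<^sup>2 * y\<^sup>2)"

text \<open>
  The second component of the field after the fourth blow-up, where the pole has cancelled.
\<close>

definition branch_r :: "complex \<Rightarrow> complex \<Rightarrow> c3 \<Rightarrow> complex" where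
  "branch_r I e = (\<lambda>(x, y, t). - 8 * y - e * g I t * (x * y + (x * y - 2 * g I t))
     - x\<^sup>2 * y * (x * y - 2 * g I t) - x * (x * y - 2 * g I t)\<^sup>2)"

abbreviation branch_pole :: "complex \<Rightarrow> complex \<Rightarrow> nat \<Rightarrow> c3 \<Rightarrow> complex" where
  "branch_pole I e n \<equiv> polar_blow_up.main_pole (branch_p I e n) (branch_\<kappa> e n) (branch_h I e n)
     (branch_centre I e n) (branch_centre' I e n)"

lemma less_4_cases:
  assumes "n < (4 :: nat)"
  obtains "n = 0" | "n = Suc 0" | "n = Suc (Suc 0)" | "n = Suc (Suc (Suc 0))"
  using assms by (auto simp: numeral_eq_Suc less_Suc_eq)

lemma holo3_branch:
  assumes "n < 4"
  shows "holo3_on (branch_\<kappa> e n) UNIV" "holo3_on (branch_h I e n) UNIV"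
proof -
  show "holo3_on (branch_\<kappa> e n) UNIV" using assms
    by (cases rule: less_4_cases;
        simp only: branch_\<kappa>.simps case_prod_beta'; intro holo3_intros)
  show "holo3_on (branch_h I e n) UNIV" using assms
    by (cases rule: less_4_cases;
        simp only: branch_h.simps case_prod_beta'; intro holo3_intros holo3_on_g)
qed

lemma holo3_branch_r: "holo3_on (branch_r I e) UNIV"
  unfolding branch_r_def case_prod_beta by (intro holo3_intros holo3_on_g)

lemma nat_cases_3:
  obtains "n = 0" | "n = Suc 0" | "n = Suc (Suc 0)" | m where "n = Suc (Suc (Suc m))"
  by (metis nat.exhaust)

lemma branch_centre'_holomorphic: "branch_centre' I e n holomorphic_on UNIV"
  by (cases n rule: nat_cases_3) (auto intro!: holomorphic_intros g_holomorphic)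

lemma branch_centre_derivative:
  "(branch_centre I e n has_field_derivative branch_centre' I e n t) (at t)"
  by (cases n rule: nat_cases_3) (auto intro!: derivative_eq_intros g_has_field_derivative)

lemma branch_\<kappa>_centre:
  assumes "e = 1 \<or> e = - 1" "n < 4"
  shows "branch_\<kappa> e n (0, branch_centre I e n t, t) \<noteq> 0"
  using assms(2,1) by (cases rule: less_4_cases) auto

lemma branch_blow_up_if_polar:
  assumes "e = 1 \<or> e = - 1" "n < 4"
    and "polar_chart I (branch_chart I e n) (branch_p I e n)
      (\<lambda>(x, y, t). (y - branch_centre I e n t) * branch_\<kappa> e n (x, y, t) +
        x * branch_h I e n (x, y, t))"
  shows "polar_blow_up I (branch_chart I e n) (branch_chart I e (Suc n))
     (second_chart (branch_chart I e n) (\<lambda>_. 0) (branch_centre I e n))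
     (branch_p I e n) (branch_\<kappa> e n) (branch_h I e n) (branch_centre I e n)
     (branch_centre' I e n)"
  unfolding branch_chart.simps(2)
  by (rule polar_blow_up_charts[OF assms(3) holo3_branch[OF assms(2)]
        branch_centre'_holomorphic branch_centre_derivative branch_\<kappa>_centre[OF assms(1,2)]])

lemma branch_p_step:
  assumes "e = 1 \<or> e = - 1" "n < 4"
  shows "(\<lambda>(u, w, t). branch_p I e n (u, branch_centre I e n t + u * w, t)) = branch_p I e (Suc n)"
  using assms(2,1)
  by (cases rule: less_4_cases)
    (auto simp: fun_eq_iff algebra_simps power2_eq_square power3_eq_cube power4_eq_xxxx)

text \<open>
  The computation that determines the centres: each numerator, divided by the coordinate of the
  divisor, has the form required for the next step.  It uses \<open>e\<^sup>2 = 1\<close> and \<open>g' = - 6 g\<close>.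
\<close>

lemma branch_pole_step:
  assumes e: "e = 1 \<or> e = - 1" and n: "n < 3"
    and pb: "polar_blow_up I \<psi> \<psi>\<^sub>1 \<psi>\<^sub>2 (branch_p I e n) (branch_\<kappa> e n) (branch_h I e n)
      (branch_centre I e n) (branch_centre' I e n)"
  shows "branch_pole I e n =
    (\<lambda>(x, y, t). (y - branch_centre I e (Suc n) t) * branch_\<kappa> e (Suc n) (x, y, t) +
        x * branch_h I e (Suc n) (x, y, t))"
proof -
  have "n < 4" using n by simp
  then show ?thesis
    unfolding polar_blow_up.main_pole_def[OF pb]
    by (cases rule: less_4_cases)
      (use e n in \<open>auto simp: fun_eq_iff algebra_simps power2_eq_square power3_eq_cube\<close>)
qed

text \<open>
  After the last step the leading coefficient \<open>\<kappa> - p\<close> vanishes on the divisor, and so does the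
  constant term \<open>12 g - (- 2 g)'\<close>, because \<open>(- 2 g)' = 12 g\<close>.
\<close>

lemma branch_pole_last:
  assumes e: "e = 1 \<or> e = - 1" and n: "n = 3"
    and pb: "polar_blow_up I \<psi> \<psi>\<^sub>1 \<psi>\<^sub>2 (branch_p I e n) (branch_\<kappa> e n) (branch_h I e n)
      (branch_centre I e n) (branch_centre' I e n)"
  shows "branch_pole I e n z = fst z * branch_r I e z"
proof -
  obtain x y t where z: "z = (x, y, t)" by (rule prod_cases3)
  show ?thesis
    unfolding polar_blow_up.main_pole_def[OF pb] z branch_r_def
    using e n by (auto simp: numeral_3_eq_3 algebra_simps power2_eq_square power3_eq_cube)
qed

lemma polar_branch:
  assumes e: "e = 1 \<or> e = - 1"
  shows "n < 4 \<Longrightarrow> polar_chart I (branch_chart I e n) (branch_p I e n)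
      (\<lambda>(x, y, t). (y - branch_centre I e n t) * branch_\<kappa> e n (x, y, t) +
        x * branch_h I e n (x, y, t))"
proof (induction n)
  case 0
  have "(\<lambda>(x, y, t). - 1 + y + 2 * x) = branch_p I e 0" by (auto simp: fun_eq_iff)
  moreover have "(\<lambda>(x, y, t). 2 * y\<^sup>2 - 4 * y - 2 * g I t * x\<^sup>2) =
      (\<lambda>(x, y, t). (y - branch_centre I e 0 t) * branch_\<kappa> e 0 (x, y, t) +
        x * branch_h I e 0 (x, y, t))"
    using e by (auto simp: fun_eq_iff algebra_simps power2_eq_square)
  ultimately show ?case using polar_affine_x[of I] by simp
next
  case (Suc n)
  then have n: "n < 3" "n < 4" by simp_all
  note pb = branch_blow_up_if_polar[OF e n(2) Suc.IH[OF n(2)]]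
  show ?case
    using polar_blow_up.main_chart[OF pb]
    unfolding branch_p_step[OF e n(2)] branch_pole_step[OF e n(1) pb] .
qed

lemmas branch_blow_up = branch_blow_up_if_polar[OF _ _ polar_branch]

lemma branch_stage_step:
  assumes e: "e = 1 \<or> e = - 1" and n: "n < 3"
    and st: "stage I cs A (range (branch_point I e n) \<union> R) T"
    and A: "(V, branch_chart I e n) \<in> A"
    and V: "open V" "- {z. fst z = 0} \<subseteq> V" "\<And>u w t. (u, branch_centre I e n t + u * w, t) \<in> V"
    and old: "\<And>t. n = 0 \<Longrightarrow> (0, 1 - e, t) \<in> V \<Longrightarrow> affine_x (0, 1 - e, t) \<in> R"
  shows "\<exists>A'. stage I (cs @ [branch_point I e n]) A' (range (branch_point I e (Suc n)) \<union> R)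
    (avoiding (range (branch_point I e n)) ` T) \<and> (UNIV, branch_chart I e (Suc n)) \<in> A'"
proof -
  have n4: "n < 4" "Suc n < 4" using n by simp_all
  note pb = branch_blow_up[OF e n4(1) e n4(1)]
  interpret polar_blow_up I "branch_chart I e n" "branch_chart I e (Suc n)"
    "second_chart (branch_chart I e n) (\<lambda>_. 0) (branch_centre I e n)"
    "branch_p I e n" "branch_\<kappa> e n" "branch_h I e n" "branch_centre I e n"
    "branch_centre' I e n" by (rule pb)
  let ?S = "range (branch_point I e (Suc n)) \<union> R"
  have unf: "unfinished I (UNIV, branch_chart I e (Suc n))"
    by (rule polar_blow_up.unfinished_old[OF branch_blow_up[OF e n4(2) e n4(2)]])
  have old': "branch_chart I e n (0, y, t) \<in> ?S"
    if "(0, y, t) \<in> V" "y \<noteq> branch_centre I e n t" "branch_\<kappa> e n (0, y, t) = 0" for y t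
  proof (cases n)
    case 0
    then have "2 * (y - (1 - e)) = 0" using that(3) by (simp only: branch_\<kappa>.simps prod.case)
    then have "y = 1 - e" by (simp only: mult_eq_0_iff) simp
    then show ?thesis using 0 that(1) old by auto
  next
    case (Suc m)
    then have "m = 0 \<or> m = Suc 0" using n by auto
    then show ?thesis using that(3) e Suc by auto
  qed
  have new: "branch_chart I e (Suc n) (0, w, t) \<in> ?S" if "main_pole (0, w, t) = 0" for w t
  proof -
    have "(w - branch_centre I e (Suc n) t) * branch_\<kappa> e (Suc n) (0, w, t) = 0"
      using that unfolding branch_pole_step[OF e n pb] by simp
    moreover have "branch_\<kappa> e (Suc n) (0, w, t) \<noteq> 0"
      using branch_\<kappa>_centre[OF e n4(2)] by simp
    ultimately have "w = branch_centre I e (Suc n) t" by simp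
    then have "branch_chart I e (Suc n) (0, w, t) = branch_point I e (Suc n) t"
      unfolding branch_point_def by simp
    then show ?thesis by blast
  qed
  have new': "\<forall>w t. main_pole (0, w, t) = 0 \<longrightarrow> branch_chart I e (Suc n) (0, w, t) \<in> ?S"
    using new by blast
  have L: "({} :: point chart set) = {(UNIV, branch_chart I e (Suc n))} \<or>
      ({} :: point chart set) = {} \<and> unfinished I (UNIV, branch_chart I e (Suc n))"
    using unf by blast
  have "\<exists>A'. stage I (cs @ [branch_point I e n]) A' ?S
    (avoiding (range (branch_point I e n)) ` T \<union> {}) \<and> (UNIV, branch_chart I e (Suc n)) \<in> A'"
    by (rule stage_blow_up[OF branch_chart.simps(2) refl branch_point_def st A V Un_upper2
        _ disjI2[OF new'] L]) (rule old')
  then show ?thesis by (simp only: Un_empty_right)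
qed

lemma branch_stage_last:
  assumes e: "e = 1 \<or> e = - 1"
    and st: "stage I cs A (range (branch_point I e 3) \<union> R) T"
    and A: "(UNIV, branch_chart I e 3) \<in> A"
  shows "\<exists>A'. stage I (cs @ [branch_point I e 3]) A' R
    (avoiding (range (branch_point I e 3)) ` T \<union> {(UNIV, branch_chart I e 4)})"
proof -
  have n: "(3 :: nat) < 4" by simp
  have S: "(4 :: nat) = Suc 3" by simp
  note pb = branch_blow_up[OF e n e n]
  interpret polar_blow_up I "branch_chart I e 3" "branch_chart I e (Suc 3)"
    "second_chart (branch_chart I e 3) (\<lambda>_. 0) (branch_centre I e 3)"
    "branch_p I e 3" "branch_\<kappa> e 3" "branch_h I e 3" "branch_centre I e 3"
    "branch_centre' I e 3" by (rule pb)
  have \<kappa>: "branch_\<kappa> e 3 (0, y, t) \<noteq> 0" for y t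
    using e by (auto simp: numeral_3_eq_3)
  have r: "\<exists>r. holo3_on r UNIV \<and> (\<forall>z. main_pole z = fst z * r z)"
    using holo3_branch_r branch_pole_last[OF e refl pb] by blast
  have "\<exists>A'. stage I (cs @ [branch_point I e 3]) A' R
    (avoiding (range (branch_point I e 3)) ` T \<union> {(UNIV, branch_chart I e (Suc 3))}) \<and>
    (UNIV, branch_chart I e (Suc 3)) \<in> A'"
    by (rule stage_blow_up[OF branch_chart.simps(2) refl branch_point_def st A open_UNIV
          subset_UNIV UNIV_I subset_refl _ disjI1[OF r] disjI1[OF refl]]) (use \<kappa> in blast)
  then show ?thesis unfolding S by blast
qed

lemma branch_field:
  assumes e: "e = 1 \<or> e = - 1"
  shows "chart_field I (branch_chart I e 4) {z. fst z = 0}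
    (\<lambda>z. (branch_p I e 4 z, branch_r I e z, 1))"
proof -
  have n: "(3 :: nat) < 4" by simp
  have S: "(4 :: nat) = Suc 3" by simp
  note pb = branch_blow_up[OF e n e n]
  have "chart_field I (branch_chart I e 4) {z. fst z = 0}
      (\<lambda>z. (branch_p I e 4 z, branch_pole I e 3 z / fst z, 1))"
    using polar_blow_up.main_chart[OF pb] unfolding branch_p_step[OF e n] S polar_chart_def
    by blast
  then show ?thesis
    by (rule chart_field_cong) (use branch_pole_last[OF e refl pb] in auto)
qed

text \<open>
  The chart at infinity may have lost points before; the premise on \<open>1 - e\<close> says that the
  other singularity of this chart is either still to be treated or already gone.
\<close>

lemma branch_resolution:
  assumes e: "e = 1 \<or> e = - 1"
    and st: "stage I cs A (range (branch_point I e 0) \<union> R) T"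
    and A: "(V, affine_x) \<in> A"
    and V: "open V" "- {z. fst z = 0} \<subseteq> V" "\<And>t. (0, 1 + e, t) \<in> V"
    and old: "\<And>t. (0, 1 - e, t) \<in> V \<Longrightarrow> affine_x (0, 1 - e, t) \<in> R"
  shows "\<exists>A'. stage I (cs @ map (branch_point I e) [0, 1, 2, 3]) A' R
    (avoiding (\<Union>n<4. range (branch_point I e n)) ` T \<union> {(UNIV, branch_chart I e 4)})"
proof -
  have V': "(u, branch_centre I e 0 t + u * w, t) \<in> V" for u w t
    using V(2,3) by (cases "u = 0") auto
  have A0: "(V, branch_chart I e 0) \<in> A" using A by simp
  obtain A1 where A1: "stage I (cs @ [branch_point I e 0]) A1 (range (branch_point I e 1) \<union> R)
    (avoiding (range (branch_point I e 0)) ` T)" "(UNIV, branch_chart I e 1) \<in> A1"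
    using branch_stage_step[OF e _ st A0 V(1,2) V' old] by auto
  obtain A2 where A2: "stage I ((cs @ [branch_point I e 0]) @ [branch_point I e 1]) A2
    (range (branch_point I e 2) \<union> R) (avoiding (range (branch_point I e 1)) `
      avoiding (range (branch_point I e 0)) ` T)" "(UNIV, branch_chart I e 2) \<in> A2"
    using branch_stage_step[OF e _ A1 open_UNIV] by (auto simp: numeral_2_eq_2)
  obtain A3 where A3: "stage I (((cs @ [branch_point I e 0]) @ [branch_point I e 1]) @
      [branch_point I e 2]) A3
    (range (branch_point I e 3) \<union> R) (avoiding (range (branch_point I e 2)) `
      avoiding (range (branch_point I e 1)) ` avoiding (range (branch_point I e 0)) ` T)"
    "(UNIV, branch_chart I e 3) \<in> A3"
    using branch_stage_step[OF e _ A2 open_UNIV] by (auto simp: numeral_3_eq_3 numeral_2_eq_2)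
  obtain A4 where A4: "stage I ((((cs @ [branch_point I e 0]) @ [branch_point I e 1]) @
      [branch_point I e 2]) @ [branch_point I e 3]) A4 R
    (avoiding (range (branch_point I e 3)) ` avoiding (range (branch_point I e 2)) `
      avoiding (range (branch_point I e 1)) ` avoiding (range (branch_point I e 0)) ` T \<union>
      {(UNIV, branch_chart I e 4)})"
    using branch_stage_last[OF e A3] by blast
  have "range (branch_point I e 3) \<union> (range (branch_point I e 2) \<union> (range (branch_point I e 1) \<union>
      range (branch_point I e 0))) = (\<Union>n<4. range (branch_point I e n))"
    by (auto simp: numeral_eq_Suc lessThan_Suc)
  then show ?thesis using A4 unfolding avoiding_avoiding by auto
qed

subsection \<open>The point at infinity of the y-axis\<close>

text \<open>
  Here the second chart of each blow-up continues the tower.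
\<close>

primrec axis_chart :: "nat \<Rightarrow> c3 \<Rightarrow> point" where
  "axis_chart 0 = affine_y"
| "axis_chart (Suc n) = second_chart (axis_chart n) (\<lambda>_. 0) (\<lambda>_. 0)"

definition axis_point :: "nat \<Rightarrow> complex \<Rightarrow> point" where
  "axis_point n = (\<lambda>t. axis_chart n (0, 0, t))"

definition axis_r :: "complex \<Rightarrow> c3 \<Rightarrow> complex" where
  "axis_r I = (\<lambda>(x, y, t). - 2 * x * y\<^sup>2 - 4 * y - 2 * g I t * x * y)"

abbreviation axis_pole_0 :: "complex \<Rightarrow> c3 \<Rightarrow> complex" where
  "axis_pole_0 I \<equiv> polar_blow_up.main_pole (\<lambda>(x, y, t). - 1 + 3 * y + 2 * x + 2 * g I t * x\<^sup>2)
     (\<lambda>(x, y, t). 4 * y - 2) (\<lambda>(x, y, t). 2 * g I t * x * y) (\<lambda>_. 0) (\<lambda>_. 0)"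

abbreviation axis_pole_1 :: "complex \<Rightarrow> c3 \<Rightarrow> complex" where
  "axis_pole_1 I \<equiv> polar_blow_up.main_pole (\<lambda>(x, y, t). - 1 + 3 * x * y + 2 * x + 2 * g I t * x\<^sup>2)
     (\<lambda>(x, y, t). - 1) (\<lambda>(x, y, t). y\<^sup>2 - 2 * y) (\<lambda>_. 0) (\<lambda>_. 0)"

lemma axis_blow_up_0:
  "polar_blow_up I (axis_chart 0 \<circ> swap) (axis_chart (Suc 0) \<circ> swap)
    (first_chart (axis_chart 0) (\<lambda>_. 0) (\<lambda>_. 0) \<circ> swap)
    (\<lambda>(x, y, t). - 1 + 3 * y + 2 * x + 2 * g I t * x\<^sup>2) (\<lambda>(x, y, t). 4 * y - 2)
    (\<lambda>(x, y, t). 2 * g I t * x * y) (\<lambda>_. 0) (\<lambda>_. 0)"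
proof -
  have eq: "(\<lambda>(x, y, t). 4 * y\<^sup>2 - 2 * y + 2 * g I t * x\<^sup>2 * y) =
      (\<lambda>(x, y, t). y * (\<lambda>(x, y, t). 4 * y - 2) (x, y, t) +
        x * (\<lambda>(x, y, t). 2 * g I t * x * y) (x, y, t))"
    by (auto simp: fun_eq_iff algebra_simps power2_eq_square)
  show ?thesis
    unfolding axis_chart.simps
    by (rule polar_blow_up_swapped_charts[OF polar_affine_y[of I, unfolded eq]])
      (unfold case_prod_beta, (intro holo3_intros holo3_on_g)+, simp)
qed

lemma axis_blow_up_1:
  "polar_blow_up I (axis_chart (Suc 0) \<circ> swap) (axis_chart (Suc (Suc 0)) \<circ> swap)
    (first_chart (axis_chart (Suc 0)) (\<lambda>_. 0) (\<lambda>_. 0) \<circ> swap)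
    (\<lambda>(x, y, t). - 1 + 3 * x * y + 2 * x + 2 * g I t * x\<^sup>2) (\<lambda>(x, y, t). - 1)
    (\<lambda>(x, y, t). y\<^sup>2 - 2 * y) (\<lambda>_. 0) (\<lambda>_. 0)"
proof -
  have eq: "axis_pole_0 I =
      (\<lambda>(x, y, t). y * (\<lambda>(x, y, t). - 1) (x, y, t) + x * (\<lambda>(x, y, t). y\<^sup>2 - 2 * y) (x, y, t))"
    unfolding polar_blow_up.main_pole_def[OF axis_blow_up_0]
    by (auto simp: fun_eq_iff algebra_simps power2_eq_square)
  have eq': "(\<lambda>(u, w, t). (\<lambda>(x, y, t). - 1 + 3 * y + 2 * x + 2 * g I t * x\<^sup>2) (u, 0 + u * w, t)) =
      (\<lambda>(x, y, t). - 1 + 3 * x * y + 2 * x + 2 * g I t * x\<^sup>2)"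
    by (auto simp: fun_eq_iff algebra_simps)
  have "polar_chart I (axis_chart (Suc 0) \<circ> swap)
      (\<lambda>(x, y, t). - 1 + 3 * x * y + 2 * x + 2 * g I t * x\<^sup>2)
      (\<lambda>(x, y, t). y * (\<lambda>(x, y, t). - 1) (x, y, t) + x * (\<lambda>(x, y, t). y\<^sup>2 - 2 * y) (x, y, t))"
    using polar_blow_up.main_chart[OF axis_blow_up_0, of I] unfolding eq eq' .
  then show ?thesis
    unfolding axis_chart.simps(2)[of "Suc 0"]
    by (rule polar_blow_up_swapped_charts)
      (unfold case_prod_beta, (intro holo3_intros)+, simp)
qed

text \<open>
  Two blow-ups suffice, as the coefficient of the pole is \<open>- 2\<close>, \<open>- 1\<close>, \<open>0\<close> in turn.
\<close>

lemma axis_pole_last: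
  "axis_pole_1 I z = fst z * axis_r I z"
proof -
  obtain x y t where z: "z = (x, y, t)" by (rule prod_cases3)
  show ?thesis
    unfolding polar_blow_up.main_pole_def[OF axis_blow_up_1] z axis_r_def
    by (simp add: algebra_simps power2_eq_square)
qed

lemma axis_field:
  "chart_field I (axis_chart 2 \<circ> swap) {z. fst z = 0}
    (\<lambda>z. ((\<lambda>(x, y, t). - 1 + 3 * x\<^sup>2 * y + 2 * x + 2 * g I t * x\<^sup>2) z, axis_r I z, 1))"
proof -
  have eq: "(\<lambda>(u, w, t). (\<lambda>(x, y, t). - 1 + 3 * x * y + 2 * x + 2 * g I t * x\<^sup>2)
        (u, 0 + u * w, t)) =
      (\<lambda>(x, y, t). - 1 + 3 * x\<^sup>2 * y + 2 * x + 2 * g I t * x\<^sup>2)"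
    by (auto simp: fun_eq_iff algebra_simps power2_eq_square)
  have two: "axis_chart 2 = axis_chart (Suc (Suc 0))" by (simp add: numeral_2_eq_2)
  have "chart_field I (axis_chart 2 \<circ> swap) {z. fst z = 0}
    (\<lambda>z. ((\<lambda>(x, y, t). - 1 + 3 * x\<^sup>2 * y + 2 * x + 2 * g I t * x\<^sup>2) z,
      axis_pole_1 I z / fst z, 1))"
    using polar_blow_up.main_chart[OF axis_blow_up_1[of I]] unfolding eq polar_chart_def two
    by (rule conjunct1)
  then show ?thesis
    by (rule chart_field_cong) (use axis_pole_last in auto)
qed

lemma axis_resolution:
  assumes st: "stage I cs A (range (axis_point 0) \<union> R) T"
    and A: "(UNIV, affine_y) \<in> A"
    and old: "\<And>t. affine_y (1 / 2, 0, t) \<in> R"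
  shows "\<exists>A'. stage I (cs @ map axis_point [0, 1]) A' R
    (avoiding (\<Union>n<2. range (axis_point n)) ` T \<union> {(UNIV, axis_chart 2)})"
proof -
  have A0: "(UNIV, axis_chart 0) \<in> A" using A by simp
  have cf: "chart_field I (axis_chart (Suc 0)) (swap -` B) (\<lambda>z. swap (G (swap z)))"
    if "chart_field I (axis_chart (Suc 0) \<circ> swap) B G" for B G
    using chart_field_swap[OF that] unfolding comp_swap_swap .
  have unf: "unfinished I (UNIV, axis_chart (Suc 0))"
  proof -
    obtain B G where "chart_field I (axis_chart (Suc 0) \<circ> swap) B G"
      using polar_blow_up.polar[OF axis_blow_up_1] unfolding polar_chart_def by blast
    note c = cf[OF this]
    obtain z where "\<not> regular_in_chart I (UNIV, axis_chart (Suc 0) \<circ> swap) z"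
      using polar_blow_up.unfinished_old[OF axis_blow_up_1] unfolding unfinished.simps by blast
    then show ?thesis using regular_swap[OF c] unfolding unfinished.simps by blast
  qed
  have old': "axis_chart 0 (y, 0, t) \<in> range (axis_point (Suc 0)) \<union> R"
    if "y \<noteq> 0" "(\<lambda>(x, y, t). 4 * y - 2) (0 :: complex, y, t :: complex) = 0" for y t
  proof -
    have "y = 1 / 2" using that(2) by (simp add: field_simps)
    then show ?thesis using old unfolding axis_chart.simps(1) by blast
  qed
  have new: "axis_chart (Suc 0) (w, 0, t) \<in> range (axis_point (Suc 0)) \<union> R"
    if "axis_pole_0 I (0, w, t) = 0"
    for w t
  proof -
    have "w = 0" using that unfolding polar_blow_up.main_pole_def[OF axis_blow_up_0] by simp
    then have "axis_chart (Suc 0) (w, 0, t) = axis_point (Suc 0) t"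
      unfolding axis_point_def by simp
    then show ?thesis by blast
  qed
  have new': "\<forall>w t. axis_pole_0 I (0, w, t) = 0 \<longrightarrow>
      axis_chart (Suc 0) (w, 0, t) \<in> range (axis_point (Suc 0)) \<union> R"
    using new by blast
  have L: "({} :: point chart set) = {(UNIV, axis_chart (Suc 0))} \<or>
      ({} :: point chart set) = {} \<and> unfinished I (UNIV, axis_chart (Suc 0))"
    using unf by blast
  have "\<exists>A'. stage I (cs @ [axis_point 0]) A' (range (axis_point (Suc 0)) \<union> R)
    (avoiding (range (axis_point 0)) ` T \<union> {}) \<and> (UNIV, axis_chart (Suc 0)) \<in> A'"
    by (rule stage_blow_up_swapped[OF axis_blow_up_0[unfolded axis_chart.simps(2)]
        axis_chart.simps(2) axis_point_def st A0 Un_upper2 _ disjI2[OF new'] L]) (rule old')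
  then obtain A1 where A1: "stage I (cs @ [axis_point 0]) A1 (range (axis_point (Suc 0)) \<union> R)
    (avoiding (range (axis_point 0)) ` T)" "(UNIV, axis_chart (Suc 0)) \<in> A1"
    by (auto simp only: Un_empty_right)
  have r: "\<exists>r. holo3_on r UNIV \<and> (\<forall>z. axis_pole_1 I z = fst z * r z)"
  proof (intro exI conjI allI)
    show "holo3_on (axis_r I) UNIV"
      unfolding axis_r_def case_prod_beta by (intro holo3_intros holo3_on_g)
  qed (rule axis_pole_last)
  have "\<exists>A'. stage I ((cs @ [axis_point 0]) @ [axis_point (Suc 0)]) A' R
    (avoiding (range (axis_point (Suc 0))) ` avoiding (range (axis_point 0)) ` T \<union>
      {(UNIV, axis_chart (Suc (Suc 0)))}) \<and> (UNIV, axis_chart (Suc (Suc 0))) \<in> A'"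
    by (rule stage_blow_up_swapped[OF axis_blow_up_1[unfolded axis_chart.simps(2)[of "Suc 0"]]
        axis_chart.simps(2) axis_point_def A1 subset_refl _ disjI1[OF r] disjI1[OF refl]]) simp
  then obtain A2 where A2: "stage I ((cs @ [axis_point 0]) @ [axis_point (Suc 0)]) A2 R
    (avoiding (range (axis_point (Suc 0))) ` avoiding (range (axis_point 0)) ` T \<union>
      {(UNIV, axis_chart (Suc (Suc 0)))})"
    by blast
  have "range (axis_point (Suc 0)) \<union> range (axis_point 0) = (\<Union>n<2. range (axis_point n))"
    by (auto simp: numeral_eq_Suc lessThan_Suc)
  then show ?thesis using A2 unfolding avoiding_avoiding by (auto simp: numeral_2_eq_2)
qed

subsection \<open>The plane\<close>

lemma affine_x_centre: "branch_point I e 0 = (\<lambda>t. affine_x (0, 1 + e, t))"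
  by (simp add: branch_point_def)

text \<open>
  The second zero of the pole in this chart is the point \<open>y / x = 2\<close> seen before.
\<close>

lemma affine_y_half: "affine_y (1 / 2, 0, t) = affine_x (0, 2, t)"
  by (auto simp: affine_x_def affine_y_def ratio3_eq_iff intro!: exI[of _ 2])

lemma stage_plane:
  "stage I [] plane
    (range (axis_point 0) \<union> (range (branch_point I (- 1) 0) \<union> range (branch_point I 1 0)))
    {(UNIV, original), (UNIV, affine_x)}"
proof -
  let ?S = "range (axis_point 0) \<union> (range (branch_point I (- 1) 0) \<union> range (branch_point I 1 0))"
  have plane: "plane = {(UNIV, original), (UNIV, affine_x), (UNIV, affine_y)}"
    unfolding plane_def affine_x_def affine_y_def ..
  have e: "branch_point I (- 1) 0 t = affine_x (0, 0, t)" "branch_point I 1 0 t = affine_x (0, 2, t)"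
    for t unfolding affine_x_centre by simp_all
  have "\<not> accessible_in_chart I (UNIV, original) z" for z
    unfolding accessible_in_chart.simps by blast
  then have 1: "tame I ?S (UNIV, original)"
    unfolding tame.simps using chart_field_original by blast
  have "affine_x z \<in> ?S" if acc: "accessible_in_chart I (UNIV, affine_x) z" for z
  proof -
    obtain x y t where z: "z = (x, y, t)" by (rule prod_cases3)
    have x: "x = 0" and "2 * y\<^sup>2 - 4 * y = 0"
      using polar_accessible[OF polar_affine_x acc] unfolding z by simp_all
    then have "y * (y - 2) = 0" by (simp add: algebra_simps power2_eq_square)
    then have "y = 0 \<or> y = 2" by simp
    then have "affine_x z \<in> {branch_point I (- 1) 0 t, branch_point I 1 0 t}"
      unfolding z x e by blast
    then show ?thesis by blast
  qed
  then have 2: "tame I ?S (UNIV, affine_x)"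
    unfolding tame.simps using polar_affine_x[of I] unfolding polar_chart_def by blast
  have "(affine_y \<circ> swap) z \<in> ?S" if acc: "accessible_in_chart I (UNIV, affine_y \<circ> swap) z" for z
  proof -
    obtain x y t where z: "z = (x, y, t)" by (rule prod_cases3)
    have x: "x = 0" and q: "4 * y\<^sup>2 - 2 * y + 2 * g I t * x\<^sup>2 * y = 0"
      using polar_accessible[OF polar_affine_y acc] unfolding z fst_conv prod.case by blast+
    have "2 * (y * (2 * y - 1)) = 4 * y\<^sup>2 - 2 * y + 2 * g I t * x\<^sup>2 * y"
      using x by (simp add: algebra_simps power2_eq_square)
    then have "y * (2 * y - 1) = 0" using q by simp
    then have "y = 0 \<or> y = 1 / 2" by (auto simp: field_simps)
    then have "(affine_y \<circ> swap) z \<in> {axis_point 0 t, branch_point I 1 0 t}"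
      unfolding z x e axis_point_def affine_y_half[symmetric]
      by (elim disjE) (simp_all only: o_apply swap_simps insert_iff axis_chart.simps simp_thms)
    then show ?thesis by blast
  qed
  moreover have "\<exists>B G. chart_field I (affine_y \<circ> swap) B G \<and> - B \<subseteq> swap -` UNIV"
    using polar_affine_y[of I] unfolding polar_chart_def vimage_UNIV by blast
  ultimately have "tame I ?S (swap -` UNIV, affine_y \<circ> swap)"
    unfolding tame.simps by blast
  then have 3: "tame I ?S (UNIV, affine_y)" by (rule tame_swap)
  have "unfinished I (UNIV, affine_y)"
    using unfinished_swap[OF 3] polar_blow_up.unfinished_old[OF axis_blow_up_0[of I]]
    unfolding vimage_UNIV axis_chart.simps by blast
  moreover have "\<forall>c\<in>plane. tame I ?S c" unfolding plane using 1 2 3 by blast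
  ultimately show ?thesis
    unfolding stage_def using blow_up_sequence.start plane by blast
qed

section \<open>The whole resolution\<close>

text \<open>
  The point of the plane to which a point contracts under all blow-ups.  It distinguishes the three
  towers, so that blow-ups in one of them leave the others untouched.
\<close>

fun foot :: "point \<Rightarrow> c3 set" where
  "foot (Proper Q t) = Q"
| "foot (Near P d) = foot P"

lemma foot_branch_chart: "foot (branch_chart I e (Suc n) (0, w, t)) = ratio3 0 1 (1 + e)"
proof (induction n arbitrary: w)
  case 0
  then show ?case by (simp add: first_chart_def affine_x_def)
next
  case (Suc n)
  then show ?case by (subst branch_chart.simps(2)) (simp add: first_chart_def del: branch_chart.simps)
qed

lemma foot_branch_point: "foot (branch_point I e n t) = ratio3 0 1 (1 + e)"
  by (cases n) (simp_all add: branch_point_def foot_branch_chart affine_x_def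
      del: branch_chart.simps(2))

lemma foot_axis_chart_Suc: "foot (axis_chart (Suc n) (w, 0, t)) = ratio3 0 0 1"
proof (induction n arbitrary: w)
  case 0
  then show ?case by (simp add: second_chart_def affine_y_def)
next
  case (Suc n)
  then show ?case by (subst axis_chart.simps(2)) (simp add: second_chart_def del: axis_chart.simps)
qed

lemma foot_axis_point: "foot (axis_point n t) = ratio3 0 0 1"
  by (cases n) (simp_all add: axis_point_def foot_axis_chart_Suc affine_y_def
      del: axis_chart.simps(2))

lemma regular_everywhere:
  assumes "chart_field I \<psi> B G" "holo3_map_on G UNIV"
  shows "\<not> unfinished I (UNIV, \<psi>)"
  unfolding unfinished.simps regular_iff[OF assms(1)] using assms(2) open_UNIV by blast

lemma axis_field':
  "chart_field I (axis_chart 2) {z. fst (snd z) = 0}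
    (\<lambda>(x, y, t). (- 2 * y * x\<^sup>2 - 4 * x - 2 * g I t * y * x,
      - 1 + 3 * y\<^sup>2 * x + 2 * y + 2 * g I t * y\<^sup>2, 1))"
proof -
  have B: "swap -` {z. fst z = 0} = {z. fst (snd z) = 0}" by auto
  show ?thesis
    using chart_field_swap[OF axis_field[of I]] unfolding comp_swap_swap B
    by (rule chart_field_cong) (auto simp: axis_r_def)
qed

lemma holo3_map_original: "holo3_map_on (system_field I) UNIV"
proof -
  have "system_field I = (\<lambda>z. ((fst z)\<^sup>2 - fst z * fst (snd z) - 2 * fst z,
      (fst (snd z))\<^sup>2 - 3 * fst z * fst (snd z) - 2 * fst (snd z) - 2 * g I (snd (snd z)), 1))"
    by (auto simp: fun_eq_iff g_def)
  then show ?thesis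
    unfolding holo3_map_on_def by (simp only: fst_conv snd_conv) (intro conjI holo3_intros holo3_on_g)
qed

lemma holo3_map_branch:
  "holo3_map_on (\<lambda>z. (branch_p I e 4 z, branch_r I e z, 1)) UNIV"
  unfolding holo3_map_on_def fst_conv snd_conv
proof (intro conjI holo3_branch_r holo3_on_const)
  have "branch_p I e 4 = (\<lambda>z. e + 2 * fst z + e * g I (snd (snd z)) * (fst z)\<^sup>2 -
      2 * g I (snd (snd z)) * fst z ^ 3 + fst z ^ 4 * fst (snd z))"
    by (auto simp: fun_eq_iff numeral_eq_Suc)
  then show "holo3_on (branch_p I e 4) UNIV"
    by (simp only:) (intro holo3_intros holo3_on_g)
qed

lemma holo3_map_axis:
  "holo3_map_on (\<lambda>(x, y, t). (- 2 * y * x\<^sup>2 - 4 * x - 2 * g I t * y * x,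
      - 1 + 3 * y\<^sup>2 * x + 2 * y + 2 * g I t * y\<^sup>2, 1)) UNIV"
  unfolding holo3_map_on_def case_prod_beta' fst_conv snd_conv
  by (intro conjI holo3_intros holo3_on_g)

text \<open>
  The four charts of the phase space, in the order of the four copies.
\<close>

definition final_chart :: "complex \<Rightarrow> nat \<Rightarrow> c3 \<Rightarrow> point" where
  "final_chart I j = [original, branch_chart I (- 1) 4, branch_chart I 1 4, axis_chart 2] ! j"

definition boundary :: "nat \<Rightarrow> c3 set" where
  "boundary j = [{}, {z. fst z = 0}, {z. fst z = 0}, {z. fst (snd z) = 0}] ! j"

lemma less_4E:
  assumes "(j :: nat) < 4"
  obtains "j = 0" | "j = 1" | "j = 2" | "j = 3"
  using assms by fastforce

lemma final_chart_simps [simp]: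
  "final_chart I 0 = original" "final_chart I 1 = branch_chart I (- 1) 4"
  "final_chart I (Suc 0) = branch_chart I (- 1) 4"
  "final_chart I 2 = branch_chart I 1 4" "final_chart I 3 = axis_chart 2"
  by (simp_all add: final_chart_def)

lemma boundary_simps [simp]:
  "boundary 0 = {}" "boundary 1 = {z. fst z = 0}" "boundary (Suc 0) = {z. fst z = 0}"
  "boundary 2 = {z. fst z = 0}" "boundary 3 = {z. fst (snd z) = 0}"
  by (simp_all add: boundary_def)

lemma final_chart_field:
  assumes "j < 4"
  shows "\<exists>G. chart_field I (final_chart I j) (boundary j) G"
  using assms
  by (cases rule: less_4E; simp only: final_chart_simps boundary_simps)
    (rule exI, rule chart_field_original, rule exI, rule branch_field, simp,
      rule exI, rule branch_field, simp, rule exI, rule axis_field')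

lemma final_chart_boundary:
  "j < 4 \<Longrightarrow> final_chart I j z \<notin> range original \<longleftrightarrow> z \<in> boundary j"
  using final_chart_field chart_field_boundary by blast

definition boundary_foot :: "nat \<Rightarrow> c3 set" where
  "boundary_foot j = [{}, ratio3 0 1 0, ratio3 0 1 2, ratio3 0 0 1] ! j"

lemma boundary_foot_simps [simp]:
  "boundary_foot 1 = ratio3 0 1 0" "boundary_foot (Suc 0) = ratio3 0 1 0"
  "boundary_foot 2 = ratio3 0 1 2" "boundary_foot 3 = ratio3 0 0 1"
  by (simp_all add: boundary_foot_def)

lemma foot_final_chart:
  assumes "j < 4" "z \<in> boundary j"
  shows "foot (final_chart I j z) = boundary_foot j"
proof -
  obtain x y t where z: "z = (x, y, t)" by (rule prod_cases3)
  have four: "foot (branch_chart I e 4 (0, y, t)) = ratio3 0 1 (1 + e)" for e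
    using foot_branch_chart[of I e 3 y t] by (simp del: branch_chart.simps)
  have two: "foot (axis_chart 2 (x, 0, t)) = ratio3 0 0 1"
    using foot_axis_chart_Suc[of 1 x t] by (simp del: axis_chart.simps add: numeral_2_eq_2)
  from assms(1) show ?thesis
  proof (cases rule: less_4E)
    assume "j = 0"
    then show ?thesis using assms(2) by simp
  next
    assume j: "j = 1"
    then have "x = 0" using assms(2) z by simp
    then show ?thesis using four[of "- 1"] j z by simp
  next
    assume j: "j = 2"
    then have "x = 0" using assms(2) z by simp
    then show ?thesis using four[of 1] j z by simp
  next
    assume j: "j = 3"
    then have "y = 0" using assms(2) z by simp
    then show ?thesis using two j z by simp
  qed
qed

lemma feet_distinct:
  "ratio3 0 0 1 \<noteq> ratio3 0 1 0" "ratio3 0 0 1 \<noteq> ratio3 0 1 2" "ratio3 0 1 0 \<noteq> ratio3 0 1 2"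
  by (auto simp: ratio3_eq_iff)

lemma boundary_foot_eq:
  assumes "0 < j" "0 < k" "j < 4" "k < 4" "boundary_foot j = boundary_foot k"
  shows "j = k"
proof -
  have "j \<in> {1, 2, 3}" "k \<in> {1, 2, 3}" using assms(1-4) by auto
  then show ?thesis using assms(5) feet_distinct feet_distinct[symmetric]
    by (elim insertE emptyE) (simp_all only: boundary_foot_simps)
qed

lemma boundary_0: "z \<in> boundary j \<Longrightarrow> j < 4 \<Longrightarrow> 0 < j"
  by (cases j) auto

lemma branch_point_boundary:
  assumes "e = 1 \<or> e = - 1" "n < 4"
  shows "branch_point I e n t \<notin> range original"
proof -
  have "branch_chart I e n (0, branch_centre I e n t, t) \<notin> range original"
    using polar_blow_up.psi_boundary[OF branch_blow_up[OF assms(1,2) assms]]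
    by (simp del: branch_chart.simps)
  then show ?thesis unfolding branch_point_def .
qed

lemma axis_point_boundary:
  assumes "n < 2"
  shows "axis_point n t \<notin> range original"
proof -
  have "n = 0 \<or> n = Suc 0" using assms by auto
  then have "(axis_chart n \<circ> swap) (0, 0, t) \<notin> range original"
    using polar_blow_up.psi_boundary[OF axis_blow_up_0] polar_blow_up.psi_boundary[OF axis_blow_up_1]
    by (metis fst_conv)
  then show ?thesis by (simp add: axis_point_def)
qed

lemma final_chart_avoids:
  assumes j: "j < 4" and C: "\<And>P. P \<in> C \<Longrightarrow> P \<notin> range original \<and> foot P \<noteq> boundary_foot j"
  shows "final_chart I j z \<notin> C"
  using C final_chart_boundary[OF j] foot_final_chart[OF j] by blast

text \<open>
  The tower over the y-axis comes first, then \<open>e = - 1\<close> and \<open>e = 1\<close>; the charts of the towers that are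
  complete keep all their points, since the later centres have a different foot.  The chart
  \<open>affine_x\<close> serves the last two towers and ends up without the two centres, hence outside the phase
  space.
\<close>

theorem resolution_exists:
  "\<exists>A. resolution I (map axis_point [0, 1] @ map (branch_point I (- 1)) [0, 1, 2, 3] @
      map (branch_point I 1) [0, 1, 2, 3]) A \<and>
    phase_space I A = {(UNIV, final_chart I j) |j. j < 4}"
proof -
  have m: "(- 1 :: complex) = 1 \<or> (- 1 :: complex) = - 1" and p: "(1 :: complex) = 1 \<or> (1 :: complex) = - 1"
    by simp_all
  define Ca where "Ca = (\<Union>n<2. range (axis_point n))"
  define Cm where "Cm = (\<Union>n<4. range (branch_point I (- 1) n))"
  define Cp where "Cp = (\<Union>n<4. range (branch_point I 1 n))"
  have Ca: "P \<notin> range original \<and> foot P = ratio3 0 0 1" if "P \<in> Ca" for P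
    using that axis_point_boundary foot_axis_point unfolding Ca_def by fastforce
  have Cm: "P \<notin> range original \<and> foot P = ratio3 0 1 0" if "P \<in> Cm" for P
    using that branch_point_boundary[OF m] foot_branch_point[of I "- 1"] unfolding Cm_def
    by fastforce
  have Cp: "P \<notin> range original \<and> foot P = ratio3 0 1 2" if "P \<in> Cp" for P
    using that branch_point_boundary[OF p] foot_branch_point[of I 1] unfolding Cp_def
    by fastforce
  let ?o = "(UNIV :: c3 set, original)" and ?x = "(UNIV :: c3 set, affine_x)"
    and ?a = "(UNIV :: c3 set, axis_chart 2)" and ?m = "(UNIV :: c3 set, branch_chart I (- 1) 4)"
    and ?p = "(UNIV :: c3 set, branch_chart I 1 4)"
  have o: "avoiding C ?o = ?o" if "C = Ca \<or> C = Cm \<or> C = Cp" for C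
    by (rule avoiding_id) (use that Ca Cm Cp in blast)
  note neq = feet_distinct
  have a: "avoiding C ?a = ?a" if "C = Cm \<or> C = Cp" for C
  proof (rule avoiding_id)
    fix z
    have "final_chart I 3 z \<notin> C"
      by (rule final_chart_avoids) (use that Cm Cp neq in \<open>simp, metis boundary_foot_simps(4)\<close>)
    then show "axis_chart 2 z \<notin> C" by simp
  qed
  have mm: "avoiding Cp ?m = ?m"
  proof (rule avoiding_id)
    fix z
    have "final_chart I 1 z \<notin> Cp"
      by (rule final_chart_avoids) (use Cp neq in \<open>simp, metis boundary_foot_simps(1)\<close>)
    then show "branch_chart I (- 1) 4 z \<notin> Cp" by simp
  qed
  have x: "avoiding Ca ?x = ?x"
  proof (rule avoiding_id)
    fix z
    have "foot (affine_x z) \<noteq> ratio3 0 0 1"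
      by (cases z rule: prod_cases3) (simp add: affine_x_def ratio3_eq_iff)
    then show "affine_x z \<notin> Ca" using Ca by blast
  qed
  \<comment> \<open>After the tower for \<open>\e = - 1\<close> the chart has lost exactly the line of its proper centre; the
    centre of the next tower is still there.\<close>
  define W where "W = {z. affine_x z \<notin> Cm}"
  have W: "W = {z. fst z \<noteq> 0 \<or> fst (snd z) \<noteq> 0}"
  proof (intro set_eqI)
    fix z :: c3
    obtain x y t where z: "z = (x, y, t)" by (rule prod_cases3)
    have "affine_x z \<in> Cm \<longleftrightarrow> x = 0 \<and> y = 0"
    proof
      assume "affine_x z \<in> Cm"
      then have "ratio3 x 1 y = ratio3 0 1 0" using Cm[of "affine_x z"] unfolding z affine_x_def by simp
      then show "x = 0 \<and> y = 0" unfolding ratio3_eq_iff by auto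
    next
      assume "x = 0 \<and> y = 0"
      then have "affine_x z = branch_point I (- 1) 0 t" unfolding z affine_x_centre by simp
      then have "affine_x z \<in> range (branch_point I (- 1) 0)" by (simp only: rangeI)
      then show "affine_x z \<in> Cm" unfolding Cm_def by (rule UN_I[rotated]) simp
    qed
    then show "z \<in> W \<longleftrightarrow> z \<in> {z. fst z \<noteq> 0 \<or> fst (snd z) \<noteq> 0}" unfolding W_def z by simp
  qed
  have avx: "avoiding Cm ?x = (W, affine_x)" unfolding avoiding_def W_def by simp
  have oW: "open W" unfolding W by (intro open_Collect_disj open_Collect_neq continuous_intros)
  let ?Sm = "range (branch_point I (- 1) 0)" and ?Sp = "range (branch_point I 1 0)"
  have yA: "(UNIV, affine_y) \<in> plane" unfolding plane_def affine_y_def by blast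
  have "affine_y (1 / 2, 0, t) = branch_point I 1 0 t" for t
    by (simp add: affine_y_half affine_x_centre)
  then have old1: "affine_y (1 / 2, 0, t) \<in> ?Sm \<union> ?Sp" for t by (simp only: rangeI UnI2)
  have eq1: "avoiding Ca ` {?o, ?x} \<union> {?a} = {?o, ?x, ?a}"
    unfolding image_insert image_empty o[of Ca, simplified] x by blast
  obtain A1 where A1: "stage I (map axis_point [0, 1]) A1 (?Sm \<union> ?Sp) {?o, ?x, ?a}"
    using axis_resolution[OF stage_plane yA old1] unfolding Ca_def[symmetric] eq1 append_Nil
    by blast
  have xA1: "?x \<in> A1" using A1 unfolding stage_def by blast
  have "affine_x (0, 1 - - 1, t) = branch_point I 1 0 t" for t
    by (simp add: affine_x_centre)
  then have old2: "affine_x (0, 1 - - 1, t) \<in> ?Sp" for t by (simp only: rangeI)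
  have eq2: "avoiding Cm ` {?o, ?x, ?a} \<union> {?m} = {?o, (W, affine_x), ?a, ?m}"
    unfolding image_insert image_empty o[of Cm, simplified] a[of Cm, simplified] avx by blast
  obtain A2 where A2: "stage I (map axis_point [0, 1] @ map (branch_point I (- 1)) [0, 1, 2, 3]) A2
      (?Sp \<union> {}) {?o, (W, affine_x), ?a, ?m}"
    using branch_resolution[OF m A1 xA1 open_UNIV subset_UNIV UNIV_I old2]
    unfolding Cm_def[symmetric] eq2 Un_empty_right by blast
  have xA2: "(W, affine_x) \<in> A2" using A2 unfolding stage_def by blast
  define W' where "W' = {z \<in> W. affine_x z \<notin> Cp}"
  have avW: "avoiding Cp (W, affine_x) = (W', affine_x)" unfolding avoiding_def W'_def by simp
  have eq3: "avoiding Cp ` {?o, (W, affine_x), ?a, ?m} \<union> {?p} = {?o, (W', affine_x), ?a, ?m, ?p}"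
    unfolding image_insert image_empty o[of Cp, simplified] a[of Cp, simplified] mm avW by blast
  have W_full: "- {z. fst z = 0} \<subseteq> W" and W_centre: "(0, 1 + 1, t) \<in> W"
    and W_old: "(0, 1 - 1, t) \<in> W \<Longrightarrow> affine_x (0, 1 - 1, t) \<in> {}" for t
    unfolding W by auto
  have "\<exists>A'. stage I ((map axis_point [0, 1] @ map (branch_point I (- 1)) [0, 1, 2, 3]) @
      map (branch_point I 1) [0, 1, 2, 3]) A' {} (avoiding Cp ` {?o, (W, affine_x), ?a, ?m} \<union> {?p})"
    unfolding Cp_def by (rule branch_resolution[OF p A2 xA2 oW W_full W_centre W_old])
  then obtain A3 where A4: "stage I (map axis_point [0, 1] @
      map (branch_point I (- 1)) [0, 1, 2, 3] @ map (branch_point I 1) [0, 1, 2, 3]) A3 {}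
      {?o, (W', affine_x), ?a, ?m, ?p}"
    unfolding eq3 append_assoc by blast
  have "(0, 0, 0) \<notin> W'" unfolding W'_def W by simp
  then have "unfinished I (W', affine_x)" by auto
  moreover have "\<not> unfinished I ?o" by (rule regular_everywhere[OF chart_field_original holo3_map_original])
  moreover have "\<not> unfinished I ?a" by (rule regular_everywhere[OF axis_field' holo3_map_axis])
  moreover have "\<not> unfinished I ?m" by (rule regular_everywhere[OF branch_field[OF m] holo3_map_branch])
  moreover have "\<not> unfinished I ?p" by (rule regular_everywhere[OF branch_field[OF p] holo3_map_branch])
  ultimately have "phase_space I A3 = {?o, ?m, ?p, ?a}"
    unfolding stage_phase_space[OF A4] by (auto simp del: unfinished.simps)
  also have "\<dots> = {(UNIV, final_chart I j) |j. j < 4}"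
  proof -
    have "{(UNIV :: c3 set, final_chart I j) |j. j < 4} = (\<lambda>j. (UNIV, final_chart I j)) ` {0, 1, 2, 3}"
      by (auto elim!: less_4E simp del: final_chart_simps)
    then show ?thesis by simp
  qed
  finally show ?thesis using stage_resolution[OF A4] by blast
qed

section \<open>Polynomial right-hand sides\<close>

text \<open>
  A list of monomials \<open>c(t) x\<^sup>i y\<^sup>j\<close> is turned into the array of coefficients that the
  definition asks for.
\<close>

lemma polynomial_in_chartI:
  assumes cf: "chart_field I \<psi> B G"
    and G: "\<And>x y t. (x, y, t) \<notin> B \<Longrightarrow> G (x, y, t) =
      (\<Sum>(c, i, j)\<leftarrow>ms. c t * x ^ i * y ^ j, \<Sum>(c, i, j)\<leftarrow>ns. c t * x ^ i * y ^ j, 1)"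
    and hol: "\<And>c i j. (c, i, j) \<in> set ms \<union> set ns \<Longrightarrow> c holomorphic_on UNIV \<and> i \<le> d \<and> j \<le> d"
  shows "polynomial_in_chart I (UNIV, \<psi>)"
proof -
  \<comment> \<open>A monomial may occur several times in a list, hence the sum.\<close>
  define coeff :: "((complex \<Rightarrow> complex) \<times> nat \<times> nat) list \<Rightarrow> nat \<Rightarrow> nat \<Rightarrow> complex \<Rightarrow> complex" where
    "coeff ms i j t = (\<Sum>(c, k, l)\<leftarrow>ms. if k = i \<and> l = j then c t else 0)" for ms i j t
  have holc: "coeff ms i j holomorphic_on UNIV"
    if "\<And>c i j. (c, i, j) \<in> set ms \<Longrightarrow> c holomorphic_on UNIV \<and> i \<le> d \<and> j \<le> d" for ms i j
    using that
  proof (induction ms)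
    case Nil
    then show ?case by (simp add: coeff_def[abs_def])
  next
    case (Cons m ms)
    obtain c k l where m: "m = (c, k, l)" by (rule prod_cases3)
    have "coeff (m # ms) i j = (\<lambda>t. (if k = i \<and> l = j then c t else 0) + coeff ms i j t)"
      by (simp add: coeff_def[abs_def] m)
    moreover have "coeff ms i j holomorphic_on UNIV"
      by (rule Cons.IH) (use Cons.prems in auto)
    moreover have "c holomorphic_on UNIV" using Cons.prems[of c k l] m by simp
    ultimately show ?case by (cases "k = i \<and> l = j") (auto intro!: holomorphic_intros)
  qed
  have sum: "(\<Sum>(c, i, j)\<leftarrow>ms. c t * x ^ i * y ^ j) = (\<Sum>i\<le>d. \<Sum>j\<le>d. coeff ms i j t * x ^ i * y ^ j)"
    if "\<And>c i j. (c, i, j) \<in> set ms \<Longrightarrow> c holomorphic_on UNIV \<and> i \<le> d \<and> j \<le> d" for ms x y t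
    using that
  proof (induction ms)
    case Nil
    then show ?case by (simp add: coeff_def)
  next
    case (Cons m ms)
    obtain c k l where m: "m = (c, k, l)" by (rule prod_cases3)
    have kl: "k \<le> d" "l \<le> d" using Cons.prems[of c k l] m by simp_all
    have "(\<Sum>i\<le>d. \<Sum>j\<le>d. coeff (m # ms) i j t * x ^ i * y ^ j) =
        (\<Sum>i\<le>d. \<Sum>j\<le>d. (if k = i then if l = j then c t * x ^ i * y ^ j else 0 else 0) +
          coeff ms i j t * x ^ i * y ^ j)"
      by (intro sum.cong refl) (auto simp: coeff_def m algebra_simps)
    also have "\<dots> = (\<Sum>i\<le>d. \<Sum>j\<le>d. if k = i then if l = j then c t * x ^ i * y ^ j else 0 else 0) +
        (\<Sum>i\<le>d. \<Sum>j\<le>d. coeff ms i j t * x ^ i * y ^ j)"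
      by (simp add: sum.distrib)
    also have "(\<Sum>i\<le>d. \<Sum>j\<le>d. if k = i then if l = j then c t * x ^ i * y ^ j else 0 else 0) =
        (\<Sum>i\<le>d. if k = i then \<Sum>j\<le>d. if l = j then c t * x ^ i * y ^ j else 0 else 0)"
      by (intro sum.cong refl) auto
    also have "\<dots> = c t * x ^ k * y ^ l" using kl by (simp add: sum.delta')
    finally have "(\<Sum>i\<le>d. \<Sum>j\<le>d. coeff (m # ms) i j t * x ^ i * y ^ j) =
        c t * x ^ k * y ^ l + (\<Sum>i\<le>d. \<Sum>j\<le>d. coeff ms i j t * x ^ i * y ^ j)" .
    moreover have "(\<Sum>(c, i, j)\<leftarrow>ms. c t * x ^ i * y ^ j) =
        (\<Sum>i\<le>d. \<Sum>j\<le>d. coeff ms i j t * x ^ i * y ^ j)"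
      by (rule Cons.IH) (use Cons.prems in auto)
    ultimately show ?case by (simp add: m)
  qed
  have "field_in_chart I (UNIV, \<psi>)
      (\<lambda>(x, y, t). (\<Sum>i\<le>d. \<Sum>j\<le>d. coeff ms i j t * x ^ i * y ^ j,
         \<Sum>i\<le>d. \<Sum>j\<le>d. coeff ns i j t * x ^ i * y ^ j, 1)) UNIV"
    unfolding field_in_chart_iff[OF cf subset_UNIV subset_UNIV]
  proof
    fix z assume z: "z \<in> UNIV - B"
    obtain x y t where zz: "z = (x, y, t)" by (rule prod_cases3)
    show "(\<lambda>(x, y, t). (\<Sum>i\<le>d. \<Sum>j\<le>d. coeff ms i j t * x ^ i * y ^ j,
         \<Sum>i\<le>d. \<Sum>j\<le>d. coeff ns i j t * x ^ i * y ^ j, 1)) z = G z"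
    proof -
      have "(\<Sum>(c, i, j)\<leftarrow>ms. c t * x ^ i * y ^ j) =
          (\<Sum>i\<le>d. \<Sum>j\<le>d. coeff ms i j t * x ^ i * y ^ j)"
        "(\<Sum>(c, i, j)\<leftarrow>ns. c t * x ^ i * y ^ j) =
          (\<Sum>i\<le>d. \<Sum>j\<le>d. coeff ns i j t * x ^ i * y ^ j)"
        by (rule sum; use hol in blast)+
      then show ?thesis using z G[of x y t] unfolding zz by simp
    qed
  qed
  moreover have "coeff ms i j holomorphic_on UNIV" "coeff ns i j holomorphic_on UNIV" for i j
    by (rule holc; use hol in blast)+
  ultimately show ?thesis
    unfolding polynomial_in_chart_def by blast
qed

lemma polynomial_final_chart:
  assumes "j < 4"
  shows "polynomial_in_chart I (UNIV, final_chart I j)"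
proof -
  have branch: "polynomial_in_chart I (UNIV, branch_chart I e 4)" if "e = 1 \<or> e = - 1" for e
    by (rule polynomial_in_chartI[OF branch_field[OF that], where d = 4 and
          ms = "[(\<lambda>t. e, 0, 0), (\<lambda>t. 2, 1, 0), (\<lambda>t. e * g I t, 2, 0), (\<lambda>t. - 2 * g I t, 3, 0),
            (\<lambda>t. 1, 4, 1)]" and
          ns = "[(\<lambda>t. - 8, 0, 1), (\<lambda>t. - 2 * e * g I t, 1, 1), (\<lambda>t. 2 * e * (g I t)\<^sup>2, 0, 0),
            (\<lambda>t. - 2, 3, 2), (\<lambda>t. 6 * g I t, 2, 1), (\<lambda>t. - 4 * (g I t)\<^sup>2, 1, 0)]"])
      (auto simp: branch_r_def numeral_eq_Suc algebra_simps intro!: holomorphic_intros g_holomorphic)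
  have axis: "polynomial_in_chart I (UNIV, axis_chart 2)"
    by (rule polynomial_in_chartI[OF axis_field', where d = 2 and
          ms = "[(\<lambda>t. - 2, 2, 1), (\<lambda>t. - 4, 1, 0), (\<lambda>t. - 2 * g I t, 1, 1)]" and
          ns = "[(\<lambda>t. - 1, 0, 0), (\<lambda>t. 3, 1, 2), (\<lambda>t. 2, 0, 1), (\<lambda>t. 2 * g I t, 0, 2)]"])
      (auto simp: algebra_simps intro!: holomorphic_intros g_holomorphic)
  have orig: "polynomial_in_chart I (UNIV, original)"
    by (rule polynomial_in_chartI[OF chart_field_original, where d = 2 and
          ms = "[(\<lambda>t. 1, 2, 0), (\<lambda>t. - 1, 1, 1), (\<lambda>t. - 2, 1, 0)]" and
          ns = "[(\<lambda>t. 1, 0, 2), (\<lambda>t. - 3, 1, 1), (\<lambda>t. - 2, 0, 1), (\<lambda>t. - 2 * g I t, 0, 0)]"])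
      (auto simp: g_def algebra_simps intro!: holomorphic_intros)
  show ?thesis using assms by (cases rule: less_4E) (use orig branch axis in simp_all)
qed

section \<open>Coordinates of the original chart in the final charts\<close>

definition domain :: "nat \<Rightarrow> c3 set" where
  "domain j = [UNIV, {z. fst z \<noteq> 0}, {z. fst z \<noteq> 0}, {z. fst (snd z) \<noteq> 0}] ! j"

definition to_chart :: "complex \<Rightarrow> nat \<Rightarrow> c3 \<Rightarrow> c3" where
  "to_chart I j = [\<lambda>z. z, to_U1 I, to_U2 I, to_U3] ! j"

text \<open>
  The value of \<open>y / x\<close> in the last chart of the tower over \<open>y / x = 1 + e\<close>.
\<close>

definition slope :: "complex \<Rightarrow> complex \<Rightarrow> c3 \<Rightarrow> complex" where
  "slope I e z = 1 + e + fst z * (fst z * (e * g I (snd (snd z)) +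
     fst z * (- 2 * g I (snd (snd z)) + fst z * fst (snd z))))"

definition from_branch :: "complex \<Rightarrow> complex \<Rightarrow> c3 \<Rightarrow> c3" where
  "from_branch I e z = (1 / fst z, slope I e z / fst z, snd (snd z))"

definition from_U3 :: "c3 \<Rightarrow> c3" where
  "from_U3 z = (fst z * fst (snd z), 1 / fst (snd z), snd (snd z))"

definition from_chart :: "complex \<Rightarrow> nat \<Rightarrow> c3 \<Rightarrow> c3" where
  "from_chart I j = [\<lambda>z. z, from_branch I (- 1), from_branch I 1, from_U3] ! j"

lemma coordinate_simps [simp]:
  "domain 0 = UNIV" "domain 1 = {z. fst z \<noteq> 0}" "domain (Suc 0) = {z. fst z \<noteq> 0}"
  "domain 2 = {z. fst z \<noteq> 0}" "domain 3 = {z. fst (snd z) \<noteq> 0}"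
  "to_chart I 0 = (\<lambda>z. z)" "to_chart I 1 = to_U1 I" "to_chart I (Suc 0) = to_U1 I"
  "to_chart I 2 = to_U2 I" "to_chart I 3 = to_U3"
  "from_chart I 0 = (\<lambda>z. z)" "from_chart I 1 = from_branch I (- 1)"
  "from_chart I (Suc 0) = from_branch I (- 1)"
  "from_chart I 2 = from_branch I 1" "from_chart I 3 = from_U3"
  by (simp_all add: domain_def to_chart_def from_chart_def)

lemma branch_chart_original:
  assumes "fst z \<noteq> 0"
  shows "branch_chart I e 4 z = original (from_branch I e z)"
proof -
  obtain u w t where z: "z = (u, w, t)" by (rule prod_cases3)
  have "branch_chart I e 4 z = affine_x (u, slope I e z, t)"
    using assms unfolding z by (simp add: numeral_eq_Suc first_chart_def slope_def)
  then show ?thesis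
    using assms unfolding z from_branch_def affine_x_def
    by (auto simp: ratio3_eq_iff intro!: exI[of _ "1 / u"])
qed

lemma axis_chart_original:
  assumes "fst (snd z) \<noteq> 0"
  shows "axis_chart 2 z = original (from_U3 z)"
proof -
  obtain w v t where z: "z = (w, v, t)" by (rule prod_cases3)
  have "axis_chart 2 z = affine_y (w * v * v, v, t)"
    using assms unfolding z by (simp add: numeral_eq_Suc second_chart_def)
  then show ?thesis
    using assms unfolding z from_U3_def affine_y_def
    by (auto simp: ratio3_eq_iff intro!: exI[of _ "1 / v"])
qed

lemma final_chart_original:
  assumes "j < 4" "z \<notin> boundary j"
  shows "final_chart I j z = original (from_chart I j z)"
  using assms(1)
  by (cases rule: less_4E)
    (use assms(2) branch_chart_original axis_chart_original in \<open>simp_all del: original.simps\<close>)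

lemma from_chart_inverse:
  assumes "j < 4" "z \<notin> boundary j"
  shows "from_chart I j z \<in> domain j \<and> to_chart I j (from_chart I j z) = z"
proof -
  obtain x y t where z: "z = (x, y, t)" by (rule prod_cases3)
  from assms(1) show ?thesis
    by (cases rule: less_4E)
      (use assms(2) in \<open>auto simp: z from_branch_def slope_def from_U3_def to_U1_def to_U2_def
        to_U3_def g_def field_simps\<close>)
qed

lemma to_chart_inverse:
  assumes "j < 4" "z \<in> domain j"
  shows "to_chart I j z \<notin> boundary j \<and> from_chart I j (to_chart I j z) = z"
proof -
  obtain x y t where z: "z = (x, y, t)" by (rule prod_cases3)
  from assms(1) show ?thesis
    by (cases rule: less_4E)
      (use assms(2) in \<open>auto simp: z from_branch_def slope_def from_U3_def to_U1_def to_U2_def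
        to_U3_def g_def field_simps\<close>)
qed

lemma chart_fibred:
  "j < 4 \<Longrightarrow> snd (snd (to_chart I j z)) = snd (snd z) \<and> snd (snd (from_chart I j z)) = snd (snd z)"
  by (elim less_4E) (auto simp: from_branch_def from_U3_def to_U1_def to_U2_def to_U3_def
      split: prod.splits)

lemma open_domain: "j < 4 \<Longrightarrow> open (domain j)"
  by (elim less_4E) (auto intro!: open_Collect_neq continuous_intros)

lemma open_interior: "j < 4 \<Longrightarrow> open (- boundary j)"
proof -
  assume "j < 4"
  moreover have "- {z :: c3. fst z = 0} = {z. fst z \<noteq> 0}"
    "- {z :: c3. fst (snd z) = 0} = {z. fst (snd z) \<noteq> 0}" by auto
  ultimately show ?thesis
    by (elim less_4E) (auto intro!: open_Collect_neq continuous_intros)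
qed

lemma holo3_to_chart: "j < 4 \<Longrightarrow> holo3_map_on (to_chart I j) (domain j)"
  unfolding holo3_map_on_def
  by (elim less_4E;
      simp only: coordinate_simps to_U1_def to_U2_def to_U3_def case_prod_beta' fst_conv snd_conv;
      intro conjI holo3_intros; simp)

lemma holo3_slope: "holo3_on (slope I e) S"
  unfolding slope_def[abs_def] by (intro holo3_intros holo3_on_g)

lemma holo3_from_chart: "j < 4 \<Longrightarrow> holo3_map_on (from_chart I j) (- boundary j)"
  unfolding holo3_map_on_def
  by (elim less_4E;
      simp only: coordinate_simps boundary_simps from_branch_def from_U3_def fst_conv snd_conv;
      intro conjI holo3_intros holo3_slope; simp)

lemma boundary_injective:
  assumes j: "j < 4" and z: "z \<in> boundary j" "z' \<in> boundary j"
    and eq: "final_chart I j z = final_chart I j z'"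
  shows "z = z'"
proof -
  obtain x y t x' y' t' where zz: "z = (x, y, t)" "z' = (x', y', t')"
    by (metis prod_cases3)
  have branch: "y = y' \<and> t = t'"
    if "branch_chart I e 4 (0, y, t) = branch_chart I e 4 (0, y', t')" for e
    using that by (auto simp: numeral_eq_Suc first_chart_def affine_x_def ratio2_eq_iff)
  have axis: "x = x' \<and> t = t'" if "axis_chart 2 (x, 0, t) = axis_chart 2 (x', 0, t')"
    using that by (auto simp: numeral_eq_Suc second_chart_def affine_y_def ratio2_eq_iff)
  from j show ?thesis
    by (cases rule: less_4E) (use z eq branch axis zz in auto)
qed

text \<open>
  The whole gluing: two charts meet only over the original space.  On the boundary, equal points have
  equal feet and hence belong to the same chart, and there the parametrisation is injective.
\<close>

lemma final_chart_eq_iff: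
  assumes j: "j < 4" and k: "k < 4"
  shows "final_chart I j z = final_chart I k z' \<longleftrightarrow> (j = k \<and> z = z') \<or>
    (z \<notin> boundary j \<and> z' \<notin> boundary k \<and> from_chart I j z = from_chart I k z')"
proof (cases "z \<in> boundary j \<longleftrightarrow> z' \<in> boundary k")
  case False
  then have "final_chart I j z \<noteq> final_chart I k z'"
    using final_chart_boundary[OF j, of I z] final_chart_boundary[OF k, of I z'] by metis
  moreover have "\<not> (j = k \<and> z = z')" using False by blast
  ultimately show ?thesis using False by blast
next
  case True
  show ?thesis
  proof (cases "z \<in> boundary j")
    case inside: False
    then have "final_chart I j z = original (from_chart I j z)"
      "final_chart I k z' = original (from_chart I k z')"
      using True final_chart_original j k by blast+
    then show ?thesis using inside True original_inj by (metis injD)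
  next
    case bd: True
    then have bd': "z' \<in> boundary k" using True by blast
    have "j = k" if "final_chart I j z = final_chart I k z'"
      using foot_final_chart[OF j bd, of I] foot_final_chart[OF k bd', of I] that
        boundary_foot_eq[OF boundary_0[OF bd j] boundary_0[OF bd' k] j k] by simp
    then show ?thesis using bd bd' boundary_injective[OF j bd] by blast
  qed
qed

section \<open>The phase space as a Hausdorff manifold\<close>

definition final_atlas :: "complex \<Rightarrow> point chart set" where
  "final_atlas I = {(UNIV, final_chart I j) |j. j < 4}"

lemma holo3_map_comp:
  assumes "holo3_map_on F S" "holo3_map_on G T" "\<And>z. z \<in> S \<Longrightarrow> F z \<in> T"
  shows "holo3_map_on (\<lambda>z. G (F z)) S"
proof -
  have *: "holo3_on (\<lambda>z. f (F z)) S" if "holo3_on f T" for f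
    using holo3_on_comp3[OF that, of "\<lambda>z. fst (F z)" S "\<lambda>z. fst (snd (F z))" "\<lambda>z. snd (snd (F z))"]
      assms(1,3) unfolding holo3_map_on_def by simp
  show ?thesis using assms(2) * unfolding holo3_map_on_def by blast
qed

lemma holo3_map_continuous: "holo3_map_on F S \<Longrightarrow> continuous_on S F"
proof -
  assume "holo3_map_on F S"
  then have "continuous_on S (\<lambda>z. (fst (F z), fst (snd (F z)), snd (snd (F z))))"
    unfolding holo3_map_on_def by (intro continuous_on_Pair holo3_on_continuous_on) blast+
  then show ?thesis by simp
qed

lemma holo3_map_cong:
  assumes "holo3_map_on F S" "open S" "\<And>z. z \<in> S \<Longrightarrow> F z = G z"
  shows "holo3_map_on G S"
  using assms unfolding holo3_map_on_def by (auto intro: holo3_on_cong simp del: split_paired_All)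

lemma overlap_preimage:
  assumes j: "j < 4" and k: "k < 4" and "j \<noteq> k"
  shows "{z. final_chart I j z \<in> final_chart I k ` S} =
    {z \<in> - boundary j. from_chart I j z \<in> {p \<in> domain k. to_chart I k p \<in> S}}"
proof (intro set_eqI iffI)
  fix z assume "z \<in> {z. final_chart I j z \<in> final_chart I k ` S}"
  then obtain w where w: "w \<in> S" "final_chart I j z = final_chart I k w" by blast
  then have "z \<notin> boundary j" "w \<notin> boundary k" "from_chart I j z = from_chart I k w"
    using final_chart_eq_iff[OF j k] assms(3) by blast+
  then show "z \<in> {z \<in> - boundary j. from_chart I j z \<in> {p \<in> domain k. to_chart I k p \<in> S}}"
    using from_chart_inverse[OF k] w(1) by simp
next
  fix z assume A: "z \<in> {z \<in> - boundary j. from_chart I j z \<in> {p \<in> domain k. to_chart I k p \<in> S}}"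
  then have B: "to_chart I k (from_chart I j z) \<notin> boundary k"
    "from_chart I k (to_chart I k (from_chart I j z)) = from_chart I j z"
    using to_chart_inverse[OF k] by blast+
  then have "final_chart I j z = final_chart I k (to_chart I k (from_chart I j z))"
    using final_chart_eq_iff[OF j k] A by simp
  then show "z \<in> {z. final_chart I j z \<in> final_chart I k ` S}" using A by blast
qed

lemma final_chart_inj: "j < 4 \<Longrightarrow> inj (final_chart I j)"
proof (rule injI)
  fix z z' assume j: "j < 4" and "final_chart I j z = final_chart I j z'"
  then show "z = z'" using final_chart_eq_iff[OF j j] from_chart_inverse[OF j] by metis
qed

lemma open_overlap_preimage:
  assumes j: "j < 4" and k: "k < 4" and S: "open S"
  shows "open {z. final_chart I j z \<in> final_chart I k ` S}"
proof (cases "j = k")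
  case True
  then have "{z. final_chart I j z \<in> final_chart I k ` S} = S"
    using final_chart_inj[OF k] by (simp add: inj_image_mem_iff)
  then show ?thesis using S by simp
next
  case False
  have "open (domain k \<inter> to_chart I k -` S)"
    by (rule continuous_open_preimage[OF holo3_map_continuous[OF holo3_to_chart[OF k]]
          open_domain[OF k] S])
  then have "open (- boundary j \<inter> from_chart I j -` (domain k \<inter> to_chart I k -` S))"
    by (rule continuous_open_preimage[OF holo3_map_continuous[OF holo3_from_chart[OF j]]
          open_interior[OF j]])
  moreover have "- boundary j \<inter> from_chart I j -` (domain k \<inter> to_chart I k -` S) =
      {z \<in> - boundary j. from_chart I j z \<in> {p \<in> domain k. to_chart I k p \<in> S}}" by blast
  ultimately show ?thesis unfolding overlap_preimage[OF j k False] by simp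
qed

lemma transition_eq:
  assumes j: "j < 4" and k: "k < 4" and "j \<noteq> k"
    and z: "final_chart I j z \<in> range (final_chart I k)"
  shows "inv (final_chart I k) (final_chart I j z) = to_chart I k (from_chart I j z)"
proof -
  have A: "z \<notin> boundary j" "from_chart I j z \<in> domain k"
    using z overlap_preimage[OF j k assms(3), of I UNIV] by auto
  then have "final_chart I j z = final_chart I k (to_chart I k (from_chart I j z))"
    using final_chart_eq_iff[OF j k] to_chart_inverse[OF k] by simp
  then show ?thesis using final_chart_inj[OF k] by (simp add: inv_f_f)
qed

text \<open>
  Any transition passes through the original coordinates.
\<close>

lemma transition_holomorphic:
  assumes j: "j < 4" and k: "k < 4"
  shows "holo3_map_on (\<lambda>z. inv (final_chart I k) (final_chart I j z))
      {z. final_chart I j z \<in> range (final_chart I k)}"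
proof (cases "j = k")
  case True
  have "inv (final_chart I k) (final_chart I j z) = z" for z
    using True final_chart_inj[OF k] by (simp add: inv_f_f)
  then show ?thesis unfolding holo3_map_on_def by (simp only:) (intro conjI holo3_intros)
next
  case False
  let ?S = "{z. final_chart I j z \<in> range (final_chart I k)}"
  have S: "z \<in> - boundary j" "from_chart I j z \<in> domain k" if "z \<in> ?S" for z
    using that overlap_preimage[OF j k False, of I UNIV] by auto
  have "holo3_map_on (from_chart I j) ?S"
    using holo3_from_chart[OF j] S(1) holo3_on_subset[of _ "- boundary j" ?S]
    unfolding holo3_map_on_def by blast
  then have "holo3_map_on (\<lambda>z. to_chart I k (from_chart I j z)) ?S"
    by (rule holo3_map_comp[OF _ holo3_to_chart[OF k] S(2)])
  then show ?thesis
    by (rule holo3_map_cong[OF _ open_overlap_preimage[OF j k open_UNIV]])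
      (use transition_eq[OF j k False] in auto)
qed

lemma transition_fibred:
  assumes j: "j < 4" and k: "k < 4" and z: "final_chart I j z \<in> range (final_chart I k)"
  shows "snd (snd (inv (final_chart I k) (final_chart I j z))) = snd (snd z)"
proof (cases "j = k")
  case True
  then show ?thesis using final_chart_inj[OF k] by (simp add: inv_f_f)
next
  case False
  show ?thesis unfolding transition_eq[OF j k False z] using chart_fibred j k by metis
qed

lemma openin_final_atlas:
  "openin (atlas_topology (final_atlas I)) P \<longleftrightarrow>
     P \<subseteq> points (final_atlas I) \<and> (\<forall>j<4. open {z. final_chart I j z \<in> P})"
proof -
  have "istopology (\<lambda>P. P \<subseteq> points (final_atlas I) \<and>
      (\<forall>(V, \<psi>)\<in>final_atlas I. open {z \<in> V. \<psi> z \<in> P}))"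
    by (rule istopology_atlas) (auto simp: final_atlas_def)
  then show ?thesis
    unfolding atlas_topology_def by (subst topology_inverse') (auto simp: final_atlas_def)
qed

lemma points_final_atlas: "points (final_atlas I) = (\<Union>j<4. range (final_chart I j))"
  unfolding points_def final_atlas_def by auto

lemma openin_chart_image:
  assumes "j < 4" "open S"
  shows "openin (atlas_topology (final_atlas I)) (final_chart I j ` S)"
  unfolding openin_final_atlas points_final_atlas
  using assms open_overlap_preimage by blast

definition separated :: "complex \<Rightarrow> point \<Rightarrow> point \<Rightarrow> bool" where
  "separated I P Q \<longleftrightarrow> (\<exists>U V. openin (atlas_topology (final_atlas I)) U \<and>
     openin (atlas_topology (final_atlas I)) V \<and> P \<in> U \<and> Q \<in> V \<and> U \<inter> V = {})"

lemma separated_sym: "separated I P Q \<Longrightarrow> separated I Q P"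
  unfolding separated_def by (metis inf_commute)

text \<open>
  Two sets in different charts have disjoint images if this holds for their original points, since
  boundary points of different charts are distinct.
\<close>

lemma separatedI:
  assumes j: "j < 4" and k: "k < 4" and "j \<noteq> k"
    and S: "open S" "z \<in> S" and S': "open S'" "z' \<in> S'"
    and disj: "\<And>w w'. w \<in> S \<Longrightarrow> w \<notin> boundary j \<Longrightarrow> w' \<in> S' \<Longrightarrow> w' \<notin> boundary k \<Longrightarrow>
      from_chart I j w \<noteq> from_chart I k w'"
  shows "separated I (final_chart I j z) (final_chart I k z')"
proof -
  have "final_chart I j ` S \<inter> final_chart I k ` S' = {}"
  proof (rule equals0I)
    fix P assume "P \<in> final_chart I j ` S \<inter> final_chart I k ` S'"
    then obtain w w' where "w \<in> S" "w' \<in> S'" "final_chart I j w = final_chart I k w'" by blast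
    then show False using final_chart_eq_iff[OF j k] disj assms(3) by blast
  qed
  then show ?thesis unfolding separated_def
    using openin_chart_image[OF j S(1)] openin_chart_image[OF k S'(1)] S(2) S'(2)
    by (meson imageI)
qed

lemma separated_same_chart:
  assumes j: "j < 4" and "z \<noteq> z'"
  shows "separated I (final_chart I j z) (final_chart I j z')"
proof -
  obtain S S' where S: "open S" "open S'" "z \<in> S" "z' \<in> S'" "S \<inter> S' = {}"
    using hausdorff[OF assms(2)] by blast
  then have "final_chart I j ` S \<inter> final_chart I j ` S' = {}"
    using final_chart_inj[OF j] by (metis image_Int image_empty)
  then show ?thesis unfolding separated_def
    using openin_chart_image[OF j S(1)] openin_chart_image[OF j S(2)] S(3,4) by (meson imageI)
qed

lemma continuous_slope: "continuous_on UNIV (slope I e)"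
  by (rule holo3_on_continuous_on[OF holo3_slope])

text \<open>
  On the boundary of the copies 1 and 2 the coordinate \<open>x\<close> is infinite, on that of copy 3 it is \<open>y\<close>.
\<close>

lemma separated_original_boundary:
  assumes k: "k < 4" and z: "z \<in> boundary k"
  shows "separated I (final_chart I 0 p) (final_chart I k z)"
proof -
  consider "k = 0" | "k = 1 \<or> k = 2" | "k = 3" using k by (metis less_4E)
  then show ?thesis
  proof cases
    case 1
    then show ?thesis using z by simp
  next
    case 2
    show ?thesis
      by (rule separatedI[where S = "{w. norm (fst w) < norm (fst p) + 1}" and
            S' = "{w. norm (fst w) * (norm (fst p) + 1) < 1}"])
        (use z 2 in \<open>auto simp: from_branch_def norm_divide field_simps simp del: split_paired_All
          intro!: open_Collect_less continuous_intros\<close>)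
  next
    case 3
    show ?thesis unfolding 3
      by (rule separatedI[where S = "{w. norm (fst (snd w)) < norm (fst (snd p)) + 1}" and
            S' = "{w. norm (fst (snd w)) * (norm (fst (snd p)) + 1) < 1}"])
        (use z 3 in \<open>auto simp: from_U3_def norm_divide field_simps simp del: split_paired_All
          intro!: open_Collect_less continuous_intros\<close>)
  qed
qed

text \<open>
  The slope \<open>y / x\<close> is 0 on the boundary of copy 1 and 2 on that of copy 2.
\<close>

lemma separated_branches:
  assumes z: "fst z = 0" "fst z' = 0"
  shows "separated I (final_chart I 1 z) (final_chart I 2 z')"
proof (rule separatedI[where S = "{w. norm (slope I (- 1) w) < 1}" and
      S' = "{w. norm (slope I 1 w - 2) < 1}"])
  show "open {w. norm (slope I (- 1) w) < 1}" "open {w. norm (slope I 1 w - 2) < 1}"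
    by (intro open_Collect_less continuous_intros continuous_slope)+
  show "z \<in> {w. norm (slope I (- 1) w) < 1}" "z' \<in> {w. norm (slope I 1 w - 2) < 1}"
    using z by (simp_all add: slope_def)
  fix w w' assume w: "w \<in> {w. norm (slope I (- 1) w) < 1}" "w \<notin> boundary 1"
    "w' \<in> {w. norm (slope I 1 w - 2) < 1}" "w' \<notin> boundary 2"
  show "from_chart I 1 w \<noteq> from_chart I 2 w'"
  proof
    assume A: "from_chart I 1 w = from_chart I 2 w'"
    have e: "fst w = fst w'" using A by (simp add: from_branch_def)
    have e': "slope I (- 1) w / fst w = slope I 1 w' / fst w'"
      using A by (simp only: coordinate_simps from_branch_def prod.inject)
    have "fst w' \<noteq> 0" using w(4) by simp
    then have s: "slope I (- 1) w = slope I 1 w'" using e' unfolding e by simp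
    \<comment> \<open>The slope would be at distance less than 1 from both 0 and 2.\<close>
    have "norm (2 :: complex) \<le> norm (slope I 1 w') + norm (slope I 1 w' - 2)"
      by (metis diff_diff_eq2 diff_add_cancel norm_minus_commute norm_triangle_sub add.commute)
    then show False using w(1,3) s by simp
  qed
qed simp_all

text \<open>
  The coordinate \<open>x\<close> is infinite on the boundary of the copies 1 and 2, and 0 on that of copy 3.
\<close>

lemma separated_branch_axis:
  assumes j: "j = 1 \<or> j = 2" and z: "fst z = 0" "fst (snd z') = 0"
  shows "separated I (final_chart I j z) (final_chart I 3 z')"
proof (rule separatedI[where S = "{w. norm (fst w) < 1}" and
      S' = "{w. norm (fst w * fst (snd w)) < 1}"])
  show "open {w :: c3. norm (fst w) < 1}" "open {w :: c3. norm (fst w * fst (snd w)) < 1}"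
    by (intro open_Collect_less continuous_intros)+
  fix w w' :: c3 assume w: "w \<in> {w. norm (fst w) < 1}" "w \<notin> boundary j"
    "w' \<in> {w. norm (fst w * fst (snd w)) < 1}"
  show "from_chart I j w \<noteq> from_chart I 3 w'"
  proof
    assume "from_chart I j w = from_chart I 3 w'"
    then have "1 / fst w = fst w' * fst (snd w')"
      using j by (auto simp: from_branch_def from_U3_def)
    then have "norm (1 / fst w) < 1" using w(3) by simp
    moreover have "fst w \<noteq> 0" using w(2) j by auto
    ultimately show False using w(1) by (simp add: norm_divide)
  qed
qed (use j z in auto)

lemma separated_boundaries:
  assumes "j < 4" "k < 4" "j \<noteq> k" "z \<in> boundary j" "z' \<in> boundary k"
  shows "separated I (final_chart I j z) (final_chart I k z')"
proof -
  have *: "separated I (final_chart I j z) (final_chart I k z')"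
    if "j < k" "k < 4" "z \<in> boundary j" "z' \<in> boundary k" for j k z z'
  proof -
    have "0 < j" using boundary_0[OF that(3)] that by simp
    then have "j = 1 \<and> k = 2 \<or> j = 1 \<and> k = 3 \<or> j = 2 \<and> k = 3" using that(1,2) by arith
    then show ?thesis
      using that(3,4) separated_branches[of z z' I]
        separated_branch_axis[of 1 z z' I] separated_branch_axis[of 2 z z' I]
      by (elim disjE conjE) simp_all
  qed
  show ?thesis
  proof (cases "j < k")
    case True
    then show ?thesis using * assms by blast
  next
    case False
    then have "k < j" using assms(3) by simp
    then show ?thesis using * assms separated_sym by blast
  qed
qed

lemma Hausdorff_final_atlas: "Hausdorff_space (atlas_topology (final_atlas I))"
  unfolding Hausdorff_space_def
proof (intro allI impI, elim conjE)
  fix P Q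
  assume "P \<in> topspace (atlas_topology (final_atlas I))"
    "Q \<in> topspace (atlas_topology (final_atlas I))" and PQ: "P \<noteq> Q"
  moreover have "topspace (atlas_topology (final_atlas I)) \<subseteq> points (final_atlas I)"
    using openin_final_atlas openin_topspace by blast
  ultimately obtain j k z z' where j: "j < 4" "P = final_chart I j z"
    and k: "k < 4" "Q = final_chart I k z'"
    unfolding points_final_atlas by blast
  have inner: "final_chart I i w = final_chart I 0 (from_chart I i w)"
    if "i < 4" "w \<notin> boundary i" for i w
    using final_chart_original[OF that] by (simp del: original.simps)
  have "separated I P Q"
  proof (cases "j = k")
    case True
    then have "z \<noteq> z'" using PQ j(2) k(2) by auto
    then show ?thesis using separated_same_chart[OF j(1)] True unfolding j(2) k(2) by simp
  next
    case False
    consider "z \<in> boundary j" "z' \<in> boundary k" | "z \<in> boundary j" "z' \<notin> boundary k"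
      | "z \<notin> boundary j" "z' \<in> boundary k" | "z \<notin> boundary j" "z' \<notin> boundary k" by blast
    then show ?thesis
    proof cases
      case 1
      then show ?thesis unfolding j(2) k(2) by (rule separated_boundaries[OF j(1) k(1) False])
    next
      case 2
      show ?thesis unfolding j(2) k(2) inner[OF k(1) 2(2)]
        by (rule separated_sym[OF separated_original_boundary[OF j(1) 2(1)]])
    next
      case 3
      show ?thesis unfolding j(2) k(2) inner[OF j(1) 3(1)]
        by (rule separated_original_boundary[OF k(1) 3(2)])
    next
      case 4
      have "from_chart I j z \<noteq> from_chart I k z'"
        using PQ unfolding j(2) k(2) inner[OF j(1) 4(1)] inner[OF k(1) 4(2)] by metis
      then show ?thesis
        unfolding j(2) k(2) inner[OF j(1) 4(1)] inner[OF k(1) 4(2)]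
        by (intro separated_same_chart) simp_all
    qed
  qed
  then show "\<exists>U V. openin (atlas_topology (final_atlas I)) U \<and>
      openin (atlas_topology (final_atlas I)) V \<and> P \<in> U \<and> Q \<in> V \<and> disjnt U V"
    unfolding separated_def disjnt_def .
qed

theorem fibred_final_atlas: "fibred_complex_manifold (final_atlas I)"
  unfolding fibred_complex_manifold_def
proof (intro conjI Hausdorff_final_atlas)
  have overlap: "open {z \<in> UNIV. final_chart I j z \<in> range (final_chart I k)} \<and>
      holo3_map_on (\<lambda>z. inv (final_chart I k) (final_chart I j z))
        {z \<in> UNIV. final_chart I j z \<in> range (final_chart I k)} \<and>
      (\<forall>z\<in>UNIV. final_chart I j z \<in> range (final_chart I k) \<longrightarrow>
        snd (snd (inv (final_chart I k) (final_chart I j z))) = snd (snd z))"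
    if "j < 4" "k < 4" for j k
  proof -
    have U: "{z \<in> UNIV. final_chart I j z \<in> range (final_chart I k)} =
        {z. final_chart I j z \<in> range (final_chart I k)}" by blast
    show ?thesis unfolding U
      by (intro conjI ballI impI open_overlap_preimage[OF that open_UNIV]
          transition_holomorphic[OF that] transition_fibred[OF that])
  qed
  show "\<forall>(V, \<psi>)\<in>final_atlas I. open V \<and> inj_on \<psi> V"
    unfolding final_atlas_def using final_chart_inj by auto
  show "\<forall>(V, \<psi>)\<in>final_atlas I. \<forall>(W, \<phi>)\<in>final_atlas I.
        open {z \<in> V. \<psi> z \<in> \<phi> ` W} \<and>
        holo3_map_on (\<lambda>z. inv_into W \<phi> (\<psi> z)) {z \<in> V. \<psi> z \<in> \<phi> ` W} \<and>
        (\<forall>z\<in>V. \<psi> z \<in> \<phi> ` W \<longrightarrow> snd (snd (inv_into W \<phi> (\<psi> z))) = snd (snd z))"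
    unfolding final_atlas_def
    by (intro ballI, elim CollectE exE conjE, hypsubst, unfold prod.case,
        intro ballI, elim CollectE exE conjE, hypsubst, unfold prod.case, rule overlap)
qed

section \<open>Gluing\<close>

lemma identifications_eq:
  "identifications I = {((0, p), (j, to_chart I j p)) |j p. 0 < j \<and> j < 4 \<and> p \<in> domain j}"
proof (intro set_eqI iffI)
  fix r assume "r \<in> identifications I"
  then consider x y t where "r = ((0, (x, y, t)), (1, to_U1 I (x, y, t)))" "x \<noteq> 0"
    | x y t where "r = ((0, (x, y, t)), (2, to_U2 I (x, y, t)))" "x \<noteq> 0"
    | x y t where "r = ((0, (x, y, t)), (3, to_U3 (x, y, t)))" "y \<noteq> 0"
    unfolding identifications_def by blast
  then show "r \<in> {((0, p), (j, to_chart I j p)) |j p. 0 < j \<and> j < 4 \<and> p \<in> domain j}"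
  proof cases
    case (1 x y t)
    then show ?thesis by (intro CollectI exI[of _ 1] exI[of _ "(x, y, t)"]) simp
  next
    case (2 x y t)
    then show ?thesis by (intro CollectI exI[of _ 2] exI[of _ "(x, y, t)"]) simp
  next
    case (3 x y t)
    then show ?thesis by (intro CollectI exI[of _ 3] exI[of _ "(x, y, t)"]) simp
  qed
next
  fix r :: "(nat \<times> c3) \<times> (nat \<times> c3)"
  assume "r \<in> {((0, p), (j, to_chart I j p)) |j p. 0 < j \<and> j < 4 \<and> p \<in> domain j}"
  then obtain j p where r: "r = ((0, p), (j, to_chart I j p))" "0 < j" "j < 4" "p \<in> domain j"
    by blast
  obtain x y t where p: "p = (x, y, t)" by (rule prod_cases3)
  from r(3) show "r \<in> identifications I"
    by (cases rule: less_4E) (use r(1,2,4) p in \<open>auto simp: identifications_def\<close>)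
qed

text \<open>
  The identifications preserve the point of the phase space, and conversely two representatives of an
  original point are linked through the copy 0.
\<close>

lemma glued_point_eq_iff:
  assumes j: "j < 4" and k: "k < 4"
  shows "glued_point I j z = glued_point I k z' \<longleftrightarrow> final_chart I j z = final_chart I k z'"
proof -
  define R where "R = identifications I \<union> (identifications I)\<inverse>"
  define val where "val = (\<lambda>q. final_chart I (fst q) (snd q))"
  have "sym R" unfolding R_def by (simp add: sym_Un_converse)
  then have symR: "(q, q') \<in> R\<^sup>* \<Longrightarrow> (q', q) \<in> R\<^sup>*" for q q'
    by (metis sym_rtrancl symD)
  have "val q = val q'" if idf: "(q, q') \<in> identifications I" for q q'
  proof -
    obtain i p where i: "q = (0, p)" "q' = (i, to_chart I i p)" "i < 4" "p \<in> domain i"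
      using idf unfolding identifications_eq by blast
    have "final_chart I i (to_chart I i p) = original p"
      using final_chart_original[OF i(3)] to_chart_inverse[OF i(3,4)] by simp
    then show ?thesis unfolding val_def i by simp
  qed
  then have step: "val q = val q'" if "(q, q') \<in> R" for q q'
    using that unfolding R_def by (metis UnE converseD)
  have val: "val q = val q'" if "(q, q') \<in> R\<^sup>*" for q q'
    using that by (induction rule: rtrancl_induct) (use step in auto)
  have link: "((0, p), (i, w)) \<in> R\<^sup>*" if "i < 4" "w \<notin> boundary i" "from_chart I i w = p" for i w p
  proof (cases "i = 0")
    case True
    then show ?thesis using that by simp
  next
    case False
    have "p \<in> domain i" "to_chart I i p = w" using from_chart_inverse[OF that(1,2)] that(3) by blast+
    then have "((0, p), (i, w)) \<in> identifications I" unfolding identifications_eq using False that by blast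
    then show ?thesis unfolding R_def by blast
  qed
  have "glued_point I j z = glued_point I k z' \<longleftrightarrow> ((j, z), (k, z')) \<in> R\<^sup>*"
  proof
    assume "glued_point I j z = glued_point I k z'"
    moreover have "(k, z') \<in> glued_point I k z'" unfolding glued_point_def by simp
    ultimately show "((j, z), (k, z')) \<in> R\<^sup>*" unfolding glued_point_def R_def by blast
  next
    assume A: "((j, z), (k, z')) \<in> R\<^sup>*"
    show "glued_point I j z = glued_point I k z'"
      unfolding glued_point_def R_def[symmetric] using A symR[OF A] by (auto intro: rtrancl_trans)
  qed
  also have "\<dots> \<longleftrightarrow> final_chart I j z = final_chart I k z'"
  proof
    show "((j, z), (k, z')) \<in> R\<^sup>* \<Longrightarrow> final_chart I j z = final_chart I k z'"
      using val[of "(j, z)" "(k, z')"] unfolding val_def by simp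
    assume "final_chart I j z = final_chart I k z'"
    then consider "j = k" "z = z'" | "z \<notin> boundary j" "z' \<notin> boundary k"
        "from_chart I j z = from_chart I k z'"
      using final_chart_eq_iff[OF j k] by blast
    then show "((j, z), (k, z')) \<in> R\<^sup>*"
    proof cases
      case 1
      then show ?thesis by simp
    next
      case 2
      show ?thesis by (rule rtrancl_trans[OF symR[OF link[OF j 2(1) 2(3)]] link[OF k 2(2) refl]])
    qed
  qed
  finally show ?thesis .
qed

theorem glued_space_isomorphic:
  "\<exists>\<Phi>. chart_isomorphism \<Phi> (glued_space I) (final_atlas I) \<and>
     (\<forall>z. \<Phi> (glued_point I 0 z) = original z)"
proof -
  define \<Phi> where "\<Phi> = (\<lambda>P. THE Q. \<exists>j<4. \<exists>z. P = glued_point I j z \<and> Q = final_chart I j z)"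
  have \<Phi>: "\<Phi> (glued_point I j z) = final_chart I j z" if "j < 4" for j z
    unfolding \<Phi>_def
    by (rule the_equality) (use that glued_point_eq_iff in blast)+
  have comp: "\<Phi> \<circ> glued_point I j = final_chart I j" if "j < 4" for j
    using \<Phi>[OF that] by (simp add: fun_eq_iff del: split_paired_All)
  have pts: "points (glued_space I) = (\<Union>j<4. range (glued_point I j))"
    unfolding points_def glued_space_def by auto
  have "bij_betw \<Phi> (points (glued_space I)) (points (final_atlas I))"
    unfolding bij_betw_def
  proof
    show "inj_on \<Phi> (points (glued_space I))"
    proof (rule inj_onI)
      fix P Q assume "P \<in> points (glued_space I)" "Q \<in> points (glued_space I)" and eq: "\<Phi> P = \<Phi> Q"
      then obtain j k z z' where "j < 4" "P = glued_point I j z" "k < 4" "Q = glued_point I k z'"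
        unfolding pts by blast
      then show "P = Q" using eq \<Phi> glued_point_eq_iff by simp
    qed
    have "\<Phi> ` points (glued_space I) = (\<Union>j<4. range (\<Phi> \<circ> glued_point I j))"
      unfolding pts by (auto simp: image_UN image_comp)
    also have "\<dots> = points (final_atlas I)" unfolding points_final_atlas using comp by simp
    finally show "\<Phi> ` points (glued_space I) = points (final_atlas I)" .
  qed
  moreover have "(\<lambda>(V, \<psi>). (V, \<Phi> \<circ> \<psi>)) ` glued_space I = final_atlas I"
  proof -
    have "(\<lambda>(V, \<psi>). (V, \<Phi> \<circ> \<psi>)) ` glued_space I = {(UNIV, \<Phi> \<circ> glued_point I j) |j. j < 4}"
      unfolding glued_space_def by auto
    also have "\<dots> = final_atlas I" unfolding final_atlas_def using comp by metis
    finally show ?thesis .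
  qed
  moreover have "\<Phi> (glued_point I 0 z) = original z" for z using \<Phi>[of 0 z] by simp
  ultimately show ?thesis unfolding chart_isomorphism_def by blast
qed

lemma near_axis_point: "infinitely_near (axis_point n t) \<longleftrightarrow> 0 < n"
  by (cases n) (simp_all add: axis_point_def affine_y_def second_chart_def)

lemma near_branch_point: "infinitely_near (branch_point I e n t) \<longleftrightarrow> 0 < n"
  by (cases n) (simp_all add: branch_point_def affine_x_def first_chart_def)

theorem proposition6p2:
  fixes I :: complex
  shows "\<exists>cs A.
    resolution I cs A \<and>
    length cs = 10 \<and>
    card {k. k < 10 \<and> (\<forall>t. infinitely_near ((cs ! k) t))} = 7 \<and>
    card {k. k < 10 \<and> (\<forall>t. \<not> infinitely_near ((cs ! k) t))} = 3 \<and>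
    fibred_complex_manifold (phase_space I A) \<and>
    (\<forall>c \<in> phase_space I A. polynomial_in_chart I c) \<and>
    (\<exists>\<Phi>. chart_isomorphism \<Phi> (glued_space I) (phase_space I A) \<and>
         (\<forall>z. \<Phi> (glued_point I 0 z) = original z))"
proof -
  define cs where "cs = map axis_point [0, 1] @ map (branch_point I (- 1)) [0, 1, 2, 3] @
      map (branch_point I 1) [0, 1, 2, 3]"
  obtain A where A: "resolution I cs A" "phase_space I A = final_atlas I"
    using resolution_exists unfolding cs_def final_atlas_def by blast
  have near: "infinitely_near ((cs ! k) t) \<longleftrightarrow> k \<in> {1, 3, 4, 5, 7, 8, 9}" if "k < 10" for k t
  proof -
    have "k \<in> {0, 1, 2, 3, 4, 5, 6, 7, 8, 9}" using that by auto
    then show ?thesis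
      by (elim insertE emptyE) (simp_all add: cs_def near_axis_point near_branch_point)
  qed
  have "{k. k < 10 \<and> (\<forall>t. infinitely_near ((cs ! k) t))} = {1, 3, 4, 5, 7, 8, 9}"
    using near by auto
  then have c7: "card {k. k < 10 \<and> (\<forall>t. infinitely_near ((cs ! k) t))} = 7" by simp
  have "{k. k < 10 \<and> (\<forall>t. \<not> infinitely_near ((cs ! k) t))} = {0, 2, 6}"
    using near by (auto; fastforce)
  then have c3: "card {k. k < 10 \<and> (\<forall>t. \<not> infinitely_near ((cs ! k) t))} = 3" by simp
  have pol: "\<forall>c\<in>phase_space I A. polynomial_in_chart I c"
    unfolding A(2) final_atlas_def using polynomial_final_chart by blast
  have len: "length cs = 10" by (simp add: cs_def)
  show ?thesis
    using A(1) len c7 c3 fibred_final_atlas[of I] pol glued_space_isomorphic[of I]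
    unfolding A(2)[symmetric] by blast
qed

end
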